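(* Let $X,Y$ be two non-degenerate (real-valued) random variables on a sublinear expectation space $(\Omega,\mathcal{H},\hat{\mathbb{E}})$, and let $f$ be a given non-negative real-valued function defined on some interval of $\mathbb{R}$ which contains $0$ as an interior point. Assume that $Y$ is independent of $X$, and that $\lambda X+f(\lambda)Y$ is a non-degenerate random variable whose distribution does not depend on $\lambda$, for all $\lambda$ (in the domain of $f$) such that $f(\lambda)$ is non-negative. Then there exist $a,b>0$ such that: (i) $f(\lambda)=\sqrt{a-b\lambda^2}$ (for all $\lambda$ in the domain of $f$); (ii) $X$ and $Y$ are $G$-normally distributed, with $\overline{\sigma}^2_X=b\,\overline{\sigma}^2_Y$ and $\underline{\sigma}^2_X=b\,\underline{\sigma}^2_Y$, where $\overline{\sigma}^2_X=\hat{\mathbb{E}}[X^2]$, $\underline{\sigma}^2_X=-\hat{\mathbb{E}}[-X^2]$, $\overline{\sigma}^2_Y=\hat{\mathbb{E}}[Y^2]$ and $\underline{\sigma}^2_Y=-\hat{\mathbb{E}}[-Y^2]$.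
   Context: Sublinear expectation space: $\Omega$ is a set and $\mathcal{H}$ is a vector lattice of real-valued functions on $\Omega$ containing all constants, with $|X|\in\mathcal{H}$ whenever $X\in\mathcal{H}$; elements of $\mathcal{H}$ are called random variables. A sublinear expectation is a functional $\hat{\mathbb{E}}:\mathcal{H}\to\mathbb{R}$ such that for all $X,Y\in\mathcal{H}$: (a) $X\ge Y$ implies $\hat{\mathbb{E}}[X]\ge\hat{\mathbb{E}}[Y]$; (b) $\hat{\mathbb{E}}[c]=c$ for constants $c$; (c) $\hat{\mathbb{E}}[X+Y]\le\hat{\mathbb{E}}[X]+\hat{\mathbb{E}}[Y]$; (d) $\hat{\mathbb{E}}[\lambda X]=\lambda\hat{\mathbb{E}}[X]$ for $\lambda\ge 0$. The triple $(\Omega,\mathcal{H},\hat{\mathbb{E}})$ is called a sublinear expectation space. It is understood that functions of random variables appearing inside $\hat{\mathbb{E}}$ below (such as $X^2$, or $\varphi(X)$ and $\varphi(X,Y)$ for test functions $\varphi$) belong to $\mathcal{H}$. $C_{b.Lip}(\mathbb{R}^n)$ denotes the space of bounded Lipschitz functions on $\mathbb{R}^n$. Identically distributed: for $n$-dimensional random vectors $X_1,X_2$ on sublinear expectation spaces $(\Omega_1,\mathcal{H}_1,\hat{\mathbb{E}}_1)$, $(\Omega_2,\mathcal{H}_2,\hat{\mathbb{E}}_2)$, $X_1\overset{d}{=}X_2$ means $\hat{\mathbb{E}}_1[\varphi(X_1)]=\hat{\mathbb{E}}_2[\varphi(X_2)]$ for all $\varphi\in C_{b.Lip}(\mathbb{R}^n)$.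 That the distribution of $\lambda X+f(\lambda)Y$ does not depend on $\lambda$ means $\lambda_1 X+f(\lambda_1)Y\overset{d}{=}\lambda_2 X+f(\lambda_2)Y$ for all admissible $\lambda_1,\lambda_2$. Independence: an $n$-dimensional random vector $Y$ is independent of an $m$-dimensional random vector $X$ (written $Y\bot X$; this relation is not symmetric in general) if for every $\varphi\in C_{b.Lip}(\mathbb{R}^m\times\mathbb{R}^n)$, $\hat{\mathbb{E}}[\varphi(X,Y)]=\hat{\mathbb{E}}\big[\hat{\mathbb{E}}[\varphi(x,Y)]_{x=X}\big]$. An independent copy of $X$ is a random variable $\bar X$ with $\bar X\overset{d}{=}X$ and $\bar X\bot X$. $G$-normal distribution: $X$ is called $G$-normally distributed if for each $a,b\ge 0$, $aX+b\bar X\overset{d}{=}\sqrt{a^2+b^2}\,X$, where $\bar X$ is an independent copy of $X$. (Here $G$ denotes the function $G(A)=\tfrac12\hat{\mathbb{E}}[AX^2]$, $A\in\mathbb{R}$, attached to the variable in question.) Non-degenerate: a random variable $X$ is non-degenerate if $\hat{\mathbb{E}}[X^2]>\big(\hat{\mathbb{E}}[|X|]\big)^2$. *)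

theory Defs
  imports "HOL-Analysis.Analysis"
begin

definition Cb_Lip :: "('b::metric_space \<Rightarrow> real) set" where
  "Cb_Lip = {\<phi>. bounded (range \<phi>) \<and> (\<exists>L. L-lipschitz_on UNIV \<phi>)}"

text \<open>
  The sample space is the whole type \<open>'a\<close>. The functional \<open>E\<close> is a total function, but only its
  values on \<open>H\<close> are constrained. The last two closure conditions make explicit the convention
  that functions of random variables to which \<open>E\<close> is applied are again random variables:
  squares, and test functions of one or two real random variables (for one variable, let the test
  function ignore its second argument). For real random variables no other functions
  occur: in the definition of independence below, the map taking \<open>x\<close> to the expectation
  of \<open>\<phi> (x, Y)\<close> is again bounded and Lipschitz.
\<close>

locale sublinear_expectation_space =
  fixes H :: "('a \<Rightarrow> real) set" and E :: "('a \<Rightarrow> real) \<Rightarrow> real"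
  assumes const_mem: "(\<lambda>_. c) \<in> H"
    and add_mem: "X \<in> H \<Longrightarrow> Y \<in> H \<Longrightarrow> (\<lambda>\<omega>. X \<omega> + Y \<omega>) \<in> H"
    and scale_mem: "X \<in> H \<Longrightarrow> (\<lambda>\<omega>. c * X \<omega>) \<in> H"
    and max_mem: "X \<in> H \<Longrightarrow> Y \<in> H \<Longrightarrow> (\<lambda>\<omega>. max (X \<omega>) (Y \<omega>)) \<in> H"
    and min_mem: "X \<in> H \<Longrightarrow> Y \<in> H \<Longrightarrow> (\<lambda>\<omega>. min (X \<omega>) (Y \<omega>)) \<in> H"
    and abs_mem: "X \<in> H \<Longrightarrow> (\<lambda>\<omega>. \<bar>X \<omega>\<bar>) \<in> H"
    and square_mem: "X \<in> H \<Longrightarrow> (\<lambda>\<omega>. (X \<omega>)\<^sup>2) \<in> H"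
    and Cb_Lip_mem: "X \<in> H \<Longrightarrow> Y \<in> H \<Longrightarrow> \<phi> \<in> Cb_Lip \<Longrightarrow> (\<lambda>\<omega>. \<phi> (X \<omega>, Y \<omega>)) \<in> H"
    and monotone: "X \<in> H \<Longrightarrow> Y \<in> H \<Longrightarrow> (\<And>\<omega>. Y \<omega> \<le> X \<omega>) \<Longrightarrow> E Y \<le> E X"
    and const: "E (\<lambda>_. c) = c"
    and subadditive: "X \<in> H \<Longrightarrow> Y \<in> H \<Longrightarrow> E (\<lambda>\<omega>. X \<omega> + Y \<omega>) \<le> E X + E Y"
    and pos_homogeneous: "X \<in> H \<Longrightarrow> 0 \<le> c \<Longrightarrow> E (\<lambda>\<omega>. c * X \<omega>) = c * E X"

definition ident_distr ::
    "(('a \<Rightarrow> real) \<Rightarrow> real) \<Rightarrow> ('a \<Rightarrow> 'n::euclidean_space) \<Rightarrow>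
     (('b \<Rightarrow> real) \<Rightarrow> real) \<Rightarrow> ('b \<Rightarrow> 'n) \<Rightarrow> bool" where
  "ident_distr E\<^sub>1 X\<^sub>1 E\<^sub>2 X\<^sub>2 \<longleftrightarrow>
     (\<forall>\<phi>\<in>Cb_Lip. E\<^sub>1 (\<lambda>\<omega>. \<phi> (X\<^sub>1 \<omega>)) = E\<^sub>2 (\<lambda>\<omega>. \<phi> (X\<^sub>2 \<omega>)))"

text \<open>\<open>indep_of E Y X\<close>: \<open>Y\<close> is independent of \<open>X\<close>. The relation is not symmetric.\<close>

definition indep_of ::
    "(('a \<Rightarrow> real) \<Rightarrow> real) \<Rightarrow> ('a \<Rightarrow> 'n::euclidean_space) \<Rightarrow> ('a \<Rightarrow> 'm::euclidean_space) \<Rightarrow> bool" where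
  "indep_of E Y X \<longleftrightarrow>
     (\<forall>\<phi>\<in>Cb_Lip. E (\<lambda>\<omega>. \<phi> (X \<omega>, Y \<omega>)) = E (\<lambda>\<omega>. E (\<lambda>\<omega>'. \<phi> (X \<omega>, Y \<omega>'))))"

definition indep_copy ::
    "('a \<Rightarrow> real) set \<Rightarrow> (('a \<Rightarrow> real) \<Rightarrow> real) \<Rightarrow> ('a \<Rightarrow> real) \<Rightarrow> ('a \<Rightarrow> real) \<Rightarrow> bool" where
  "indep_copy H E Z X \<longleftrightarrow> Z \<in> H \<and> ident_distr E Z E X \<and> indep_of E Z X"

text \<open>
  A given space need not carry an independent copy of \<open>X\<close>, so quantifying over the independent
  copies on that space could be vacuous. The pair formed by \<open>X\<close> and its independent copy is
  therefore realised on some sublinear expectation space, with \<open>X\<close> replaced by an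
  identically distributed \<open>X'\<close>. The sample space \<open>real \<times> real\<close> is
  large enough for this, and the choice of realisation does not matter, because the distribution
  of \<open>X\<close> determines that of the pair; see \<open>G_normal_indep_copy\<close> below.
\<close>

definition G_normal :: "('a \<Rightarrow> real) set \<Rightarrow> (('a \<Rightarrow> real) \<Rightarrow> real) \<Rightarrow> ('a \<Rightarrow> real) \<Rightarrow> bool" where
  "G_normal H E X \<longleftrightarrow> X \<in> H \<and>
     (\<exists>H' E' (X' :: real \<times> real \<Rightarrow> real) Z.
        sublinear_expectation_space H' E' \<and> X' \<in> H' \<and>
        ident_distr E' X' E X \<and> indep_copy H' E' Z X' \<and>
        (\<forall>a\<ge>0. \<forall>b\<ge>0. ident_distr E' (\<lambda>\<omega>. a * X' \<omega> + b * Z \<omega>)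
                                 E' (\<lambda>\<omega>. sqrt (a\<^sup>2 + b\<^sup>2) * X' \<omega>)))"

definition nondegenerate :: "(('a \<Rightarrow> real) \<Rightarrow> real) \<Rightarrow> ('a \<Rightarrow> real) \<Rightarrow> bool" where
  "nondegenerate E X \<longleftrightarrow> E (\<lambda>\<omega>. (X \<omega>)\<^sup>2) > (E (\<lambda>\<omega>. \<bar>X \<omega>\<bar>))\<^sup>2"

definition upper_var :: "(('a \<Rightarrow> real) \<Rightarrow> real) \<Rightarrow> ('a \<Rightarrow> real) \<Rightarrow> real" where
  "upper_var E X = E (\<lambda>\<omega>. (X \<omega>)\<^sup>2)"

definition lower_var :: "(('a \<Rightarrow> real) \<Rightarrow> real) \<Rightarrow> ('a \<Rightarrow> real) \<Rightarrow> real" where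
  "lower_var E X = - E (\<lambda>\<omega>. - (X \<omega>)\<^sup>2)"

lemma Cb_LipI:
  fixes \<phi> :: "'b::metric_space \<Rightarrow> real"
  assumes "\<And>x. \<bar>\<phi> x\<bar> \<le> B" "\<And>x y. \<bar>\<phi> x - \<phi> y\<bar> \<le> L * dist x y" "0 \<le> L"
  shows "\<phi> \<in> Cb_Lip"
proof -
  have "L-lipschitz_on UNIV \<phi>"
    using assms(2,3) by (auto simp: lipschitz_on_def dist_real_def)
  moreover have "bounded (range \<phi>)"
    using assms(1) by (auto simp: bounded_iff)
  ultimately show ?thesis by (auto simp: Cb_Lip_def)
qed

lemma Cb_LipE:
  fixes \<phi> :: "'b::metric_space \<Rightarrow> real"
  assumes "\<phi> \<in> Cb_Lip"
  obtains B L where "\<And>x. \<bar>\<phi> x\<bar> \<le> B" "\<And>x y. \<bar>\<phi> x - \<phi> y\<bar> \<le> L * dist x y" "0 \<le> L"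
proof -
  from assms obtain L where "bounded (range \<phi>)" "L-lipschitz_on UNIV \<phi>"
    by (auto simp: Cb_Lip_def)
  moreover from this(1) obtain B where "\<And>x. \<bar>\<phi> x\<bar> \<le> B"
    by (auto simp: bounded_iff)
  ultimately show ?thesis
    by (intro that[of B L]) (auto simp: lipschitz_on_def dist_real_def)
qed

lemma (in sublinear_expectation_space) Cb_Lip_mem1:
  fixes \<phi> :: "real \<Rightarrow> real"
  assumes "X \<in> H" "\<phi> \<in> Cb_Lip"
  shows "(\<lambda>\<omega>. \<phi> (X \<omega>)) \<in> H"
proof -
  from assms(2) obtain B L where
    BL: "\<And>x. \<bar>\<phi> x\<bar> \<le> B" "\<And>x y. \<bar>\<phi> x - \<phi> y\<bar> \<le> L * dist x y" "0 \<le> L"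
    by (rule Cb_LipE) blast
  have "(\<lambda>p::real \<times> real. \<phi> (fst p)) \<in> Cb_Lip"
  proof (rule Cb_LipI[of _ B L])
    show "\<bar>\<phi> (fst p) - \<phi> (fst q)\<bar> \<le> L * dist p q" for p q :: "real \<times> real"
      using BL(2)[of "fst p" "fst q"] mult_left_mono[OF dist_fst_le[of p q] BL(3)] by linarith
  qed (use BL in auto)
  from Cb_Lip_mem[OF assms(1) assms(1) this] show ?thesis by simp
qed

lemma (in sublinear_expectation_space) expectation_diff_le:
  assumes "X \<in> H" "Y \<in> H" "\<And>\<omega>. \<bar>X \<omega> - Y \<omega>\<bar> \<le> c"
  shows "\<bar>E X - E Y\<bar> \<le> c"
proof -
  have *: "E U \<le> E V + c" if "U \<in> H" "V \<in> H" "\<And>\<omega>. \<bar>U \<omega> - V \<omega>\<bar> \<le> c" for U V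
  proof -
    have "U \<omega> \<le> V \<omega> + c" for \<omega> using that(3)[of \<omega>] by linarith
    then have "E U \<le> E (\<lambda>\<omega>. V \<omega> + c)"
      using that by (intro monotone add_mem const_mem) auto
    also have "\<dots> \<le> E V + E (\<lambda>_. c)" using that by (intro subadditive const_mem)
    finally show ?thesis by (simp add: const)
  qed
  have "\<bar>Y \<omega> - X \<omega>\<bar> \<le> c" for \<omega>
    using assms(3)[of \<omega>] by (simp add: abs_minus_commute)
  with *[OF assms] *[OF assms(2,1)] show ?thesis by (simp add: abs_le_iff)
qed

lemma (in sublinear_expectation_space) inner_Cb_Lip:
  fixes \<phi> :: "real \<Rightarrow> real"
  assumes "Z \<in> H" "\<phi> \<in> Cb_Lip"
  shows "(\<lambda>x. E (\<lambda>\<omega>. \<phi> (a * x + b * Z \<omega>))) \<in> Cb_Lip"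
proof -
  from assms(2) obtain B L where
    BL: "\<And>x. \<bar>\<phi> x\<bar> \<le> B" "\<And>x y. \<bar>\<phi> x - \<phi> y\<bar> \<le> L * dist x y" "0 \<le> L"
    by (rule Cb_LipE) blast
  have mem: "(\<lambda>\<omega>. \<phi> (a * x + b * Z \<omega>)) \<in> H" for x
    using Cb_Lip_mem1[OF add_mem[OF const_mem[of "a * x"] scale_mem[OF assms(1), of b]] assms(2)] .
  show ?thesis
  proof (rule Cb_LipI[of _ B "L * \<bar>a\<bar>"])
    show "\<bar>E (\<lambda>\<omega>. \<phi> (a * x + b * Z \<omega>))\<bar> \<le> B" for x
      using expectation_diff_le[OF mem const_mem[of 0], of x B] BL(1) by (simp add: const)
    show "\<bar>E (\<lambda>\<omega>. \<phi> (a * x + b * Z \<omega>)) - E (\<lambda>\<omega>. \<phi> (a * y + b * Z \<omega>))\<bar> \<le> L * \<bar>a\<bar> * dist x y" for x y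
    proof (rule expectation_diff_le[OF mem mem])
      fix \<omega>
      have "\<bar>\<phi> (a * x + b * Z \<omega>) - \<phi> (a * y + b * Z \<omega>)\<bar> \<le> L * dist (a * x + b * Z \<omega>) (a * y + b * Z \<omega>)"
        by (rule BL(2))
      also have "dist (a * x + b * Z \<omega>) (a * y + b * Z \<omega>) = \<bar>a\<bar> * dist x y"
        by (simp add: dist_real_def flip: abs_mult right_diff_distrib)
      finally show "\<bar>\<phi> (a * x + b * Z \<omega>) - \<phi> (a * y + b * Z \<omega>)\<bar> \<le> L * \<bar>a\<bar> * dist x y" by simp
    qed
  qed (use BL in auto)
qed

lemma Cb_Lip_linear:
  fixes \<phi> :: "real \<Rightarrow> real"
  assumes "\<phi> \<in> Cb_Lip"
  shows "(\<lambda>p::real \<times> real. \<phi> (a * fst p + b * snd p)) \<in> Cb_Lip"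
proof -
  from assms obtain B L where
    BL: "\<And>x. \<bar>\<phi> x\<bar> \<le> B" "\<And>x y. \<bar>\<phi> x - \<phi> y\<bar> \<le> L * dist x y" "0 \<le> L"
    by (rule Cb_LipE) blast
  show ?thesis
  proof (rule Cb_LipI[of _ B "L * (\<bar>a\<bar> + \<bar>b\<bar>)"])
    fix p q :: "real \<times> real"
    have "dist (a * fst p + b * snd p) (a * fst q + b * snd q)
        = \<bar>a * (fst p - fst q) + b * (snd p - snd q)\<bar>"
      by (simp add: dist_real_def algebra_simps)
    also have "\<dots> \<le> \<bar>a\<bar> * dist (fst p) (fst q) + \<bar>b\<bar> * dist (snd p) (snd q)"
      by (metis abs_mult abs_triangle_ineq dist_real_def)
    also have "\<dots> \<le> \<bar>a\<bar> * dist p q + \<bar>b\<bar> * dist p q"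
      by (intro add_mono mult_left_mono dist_fst_le dist_snd_le) auto
    finally have "dist (a * fst p + b * snd p) (a * fst q + b * snd q) \<le> (\<bar>a\<bar> + \<bar>b\<bar>) * dist p q"
      by (simp add: algebra_simps)
    from mult_left_mono[OF this BL(3)]
    show "\<bar>\<phi> (a * fst p + b * snd p) - \<phi> (a * fst q + b * snd q)\<bar> \<le> L * (\<bar>a\<bar> + \<bar>b\<bar>) * dist p q"
      using BL(2)[of "a * fst p + b * snd p" "a * fst q + b * snd q"] by (simp only: mult.assoc)
  qed (use BL in auto)
qed

lemma Cb_Lip_scale:
  fixes \<phi> :: "real \<Rightarrow> real"
  assumes "\<phi> \<in> Cb_Lip"
  shows "(\<lambda>x. \<phi> (c * x)) \<in> Cb_Lip"
proof -
  from assms obtain B L where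
    BL: "\<And>x. \<bar>\<phi> x\<bar> \<le> B" "\<And>x y. \<bar>\<phi> x - \<phi> y\<bar> \<le> L * dist x y" "0 \<le> L"
    by (rule Cb_LipE) blast
  show ?thesis
  proof (rule Cb_LipI[of _ B "L * \<bar>c\<bar>"])
    show "\<bar>\<phi> (c * x) - \<phi> (c * y)\<bar> \<le> L * \<bar>c\<bar> * dist x y" for x y
      using BL(2)[of "c * x" "c * y"]
      by (simp add: dist_real_def mult.assoc flip: abs_mult right_diff_distrib)
  qed (use BL in auto)
qed

lemma expectation_pair:
  fixes E\<^sub>1 :: "('a \<Rightarrow> real) \<Rightarrow> real" and E\<^sub>2 :: "('b \<Rightarrow> real) \<Rightarrow> real" and \<phi> :: "real \<Rightarrow> real"
  assumes S: "sublinear_expectation_space H\<^sub>1 E\<^sub>1" "sublinear_expectation_space H\<^sub>2 E\<^sub>2"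
    and X: "ident_distr E\<^sub>1 X\<^sub>1 E\<^sub>2 X\<^sub>2"
    and Z: "indep_copy H\<^sub>1 E\<^sub>1 Z\<^sub>1 X\<^sub>1" "indep_copy H\<^sub>2 E\<^sub>2 Z\<^sub>2 X\<^sub>2"
    and \<phi>: "\<phi> \<in> Cb_Lip"
  shows "E\<^sub>1 (\<lambda>\<omega>. \<phi> (a * X\<^sub>1 \<omega> + b * Z\<^sub>1 \<omega>)) = E\<^sub>2 (\<lambda>\<omega>. \<phi> (a * X\<^sub>2 \<omega> + b * Z\<^sub>2 \<omega>))"
proof -
  interpret S1: sublinear_expectation_space H\<^sub>1 E\<^sub>1 by fact
  let ?\<psi> = "\<lambda>x. E\<^sub>1 (\<lambda>\<omega>. \<phi> (a * x + b * Z\<^sub>1 \<omega>))"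
  have inner: "(\<lambda>z. \<phi> (a * x + b * z)) \<in> Cb_Lip" for x
  proof -
    from \<phi> obtain B L where
      BL: "\<And>x. \<bar>\<phi> x\<bar> \<le> B" "\<And>x y. \<bar>\<phi> x - \<phi> y\<bar> \<le> L * dist x y" "0 \<le> L"
      by (rule Cb_LipE) blast
    show ?thesis
    proof (rule Cb_LipI[of _ B "L * \<bar>b\<bar>"])
      show "\<bar>\<phi> (a * x + b * y) - \<phi> (a * x + b * z)\<bar> \<le> L * \<bar>b\<bar> * dist y z" for y z
        using BL(2)[of "a * x + b * y" "a * x + b * z"]
        by (simp add: dist_real_def mult.assoc flip: abs_mult right_diff_distrib)
    qed (use BL in auto)
  qed
  have eq: "?\<psi> x = E\<^sub>2 (\<lambda>\<omega>. \<phi> (a * x + b * Z\<^sub>2 \<omega>))" for x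
  proof -
    let ?\<chi> = "\<lambda>z. \<phi> (a * x + b * z)"
    have "E\<^sub>1 (\<lambda>\<omega>. ?\<chi> (Z\<^sub>1 \<omega>)) = E\<^sub>1 (\<lambda>\<omega>. ?\<chi> (X\<^sub>1 \<omega>))"
      using bspec[OF Z(1)[unfolded indep_copy_def ident_distr_def, THEN conjunct2, THEN conjunct1] inner] .
    also have "\<dots> = E\<^sub>2 (\<lambda>\<omega>. ?\<chi> (X\<^sub>2 \<omega>))"
      using bspec[OF X[unfolded ident_distr_def] inner] .
    also have "\<dots> = E\<^sub>2 (\<lambda>\<omega>. ?\<chi> (Z\<^sub>2 \<omega>))"
      using bspec[OF Z(2)[unfolded indep_copy_def ident_distr_def, THEN conjunct2, THEN conjunct1] inner] by (rule sym)
    finally show ?thesis .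
  qed
  have "E\<^sub>1 (\<lambda>\<omega>. \<phi> (a * X\<^sub>1 \<omega> + b * Z\<^sub>1 \<omega>)) = E\<^sub>1 (\<lambda>\<omega>. ?\<psi> (X\<^sub>1 \<omega>))"
    using bspec[OF Z(1)[unfolded indep_copy_def indep_of_def, THEN conjunct2, THEN conjunct2]
        Cb_Lip_linear[OF \<phi>, of a b]] by simp
  also have "\<dots> = E\<^sub>2 (\<lambda>\<omega>. ?\<psi> (X\<^sub>2 \<omega>))"
    using bspec[OF X[unfolded ident_distr_def]
        S1.inner_Cb_Lip[OF Z(1)[unfolded indep_copy_def, THEN conjunct1] \<phi>]] .
  also have "\<dots> = E\<^sub>2 (\<lambda>\<omega>. E\<^sub>2 (\<lambda>\<omega>'. \<phi> (a * X\<^sub>2 \<omega> + b * Z\<^sub>2 \<omega>')))"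
    by (simp add: eq)
  also have "\<dots> = E\<^sub>2 (\<lambda>\<omega>. \<phi> (a * X\<^sub>2 \<omega> + b * Z\<^sub>2 \<omega>))"
    using bspec[OF Z(2)[unfolded indep_copy_def indep_of_def, THEN conjunct2, THEN conjunct2]
        Cb_Lip_linear[OF \<phi>, of a b]] by simp
  finally show ?thesis .
qed

lemma G_normal_indep_copy:
  assumes S: "sublinear_expectation_space H E" and G: "G_normal H E X"
    and Z: "indep_copy H E Z X" and ab: "0 \<le> a" "0 \<le> b"
  shows "ident_distr E (\<lambda>\<omega>. a * X \<omega> + b * Z \<omega>) E (\<lambda>\<omega>. sqrt (a\<^sup>2 + b\<^sup>2) * X \<omega>)"
  unfolding ident_distr_def
proof
  fix \<phi> :: "real \<Rightarrow> real" assume \<phi>: "\<phi> \<in> Cb_Lip"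
  from G obtain H' E' and X' Z' :: "real \<times> real \<Rightarrow> real" where
    R: "sublinear_expectation_space H' E'" "ident_distr E' X' E X" "indep_copy H' E' Z' X'"
    and N: "\<forall>a\<ge>0. \<forall>b\<ge>0. ident_distr E' (\<lambda>\<omega>. a * X' \<omega> + b * Z' \<omega>)
                               E' (\<lambda>\<omega>. sqrt (a\<^sup>2 + b\<^sup>2) * X' \<omega>)"
    unfolding G_normal_def by blast
  let ?c = "sqrt (a\<^sup>2 + b\<^sup>2)"
  have "E (\<lambda>\<omega>. \<phi> (a * X \<omega> + b * Z \<omega>)) = E' (\<lambda>\<omega>. \<phi> (a * X' \<omega> + b * Z' \<omega>))"
    using expectation_pair[OF R(1) S R(2,3) Z \<phi>] by simp
  also have "\<dots> = E' (\<lambda>\<omega>. \<phi> (?c * X' \<omega>))"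
    using N ab \<phi> by (simp add: ident_distr_def)
  also have "\<dots> = E (\<lambda>\<omega>. \<phi> (?c * X \<omega>))"
    using bspec[OF R(2)[unfolded ident_distr_def] Cb_Lip_scale[OF \<phi>, of ?c]] .
  finally show "E (\<lambda>\<omega>. \<phi> (a * X \<omega> + b * Z \<omega>)) = E (\<lambda>\<omega>. \<phi> (?c * X \<omega>))" .
qed

end

theory Submission
  imports Defs
begin

text \<open>
  First moments, together with non-degeneracy, force \<open>X\<close> and \<open>Y\<close> to have no mean uncertainty; second
  moments then give \<open>(f l)\<^sup>2 = a - b * l\<^sup>2\<close> and the relations between the variances. Write \<open>T\<^sub>t \<phi> (x)\<close> for
  \<open>E (\<phi> (x + sqrt t * Y))\<close> and \<open>S\<^sub>r \<phi> (x)\<close> for \<open>E (\<phi> (x + r * X))\<close>. By scaling, the hypothesis says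
  \<open>S\<^sub>r T\<^sub>t = T\<^bsub>t + b * r\<^sup>2\<^esub>\<close> whenever \<open>r\<^sup>2\<close> is at most a fixed multiple of \<open>t\<close>. Iterating small steps of \<open>X\<close> and letting
  the initial time tend to \<open>0\<close> shows that \<open>T\<close> is a semigroup, so \<open>Y\<close> is \<open>G\<close>-normal.

  Since the domain of \<open>f\<close> may be small, \<open>f\<close> need not reach \<open>0\<close>, and the law of \<open>X\<close> is only known on functions that
  have been smoothed by \<open>T\<^sub>t\<close> for some fixed \<open>t\<close>. This suffices because the range of \<open>T\<^sub>t\<close> is dense, although
  \<open>T\<^sub>t\<close> is the nonlinear flow of \<open>\<partial>\<^sub>t u = G (\<partial>\<^sub>x\<^sub>x u)\<close>. If a periodic eigenfunction of \<open>G (u'')\<close> of high frequency is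
  added to the initial value with a large amplitude, its curvature decides between the two variances, so that the slow part of
  the solution obeys a linear equation whose coefficients oscillate rapidly, in the limit a linear heat equation. The latter
  can be solved backwards for trigonometric sums, while the eigenfunction itself has decayed at time \<open>t\<close>.
\<close>

section \<open>Functions of polynomial growth\<close>

text \<open>Two obstacles shape the details. The hypotheses concern bounded Lipschitz test
  functions, whereas the argument needs moments; \<open>H\<close> is closed under squares, so all
  polynomial moments are finite and truncation carries the identities over. The other obstacle is
  the balance of amplitudes. Let p and q be the lower and upper variance of \<open>Y\<close>. If p >
  0, positive arcs of sqrt p sin(x / sqrt p) and negative arcs of sqrt q sin(x / sqrt q) join to a
  pattern \<Phi> with G(\<Phi>'') = -\<Phi>/2, so \<Phi>(m x) decays like exp(-m^2 t/2). Starting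
  from amplitude A exp(m^2 T/2)/m^2, the curvature amplitude stays at least A up to time T, yet only
  A/m^2 is left of the pattern itself. As A depends on the waves and the accuracy but not on m,
  letting m grow removes the pattern. Near the zeros of \<Phi> no amplitude suffices, and a barrier
  is added there. If p = 0 there is no such eigenfunction; it is imitated up to an error that is
  made small after m has been fixed.\<close>

lemma Cb_Lip_compose:
  fixes \<phi> :: "'b::metric_space \<Rightarrow> real" and g :: "'c::metric_space \<Rightarrow> 'b"
  assumes "\<phi> \<in> Cb_Lip" "\<And>x y. dist (g x) (g y) \<le> K * dist x y"
  shows "(\<lambda>x. \<phi> (g x)) \<in> Cb_Lip"
proof -
  from assms(1) obtain B L where
    BL: "\<And>x. \<bar>\<phi> x\<bar> \<le> B" "\<And>x y. \<bar>\<phi> x - \<phi> y\<bar> \<le> L * dist x y" "0 \<le> L"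
    by (rule Cb_LipE) blast
  show ?thesis
  proof (rule Cb_LipI[of _ B "L * max 0 K"])
    fix x y
    have "dist (g x) (g y) \<le> max 0 K * dist x y"
      using assms(2)[of x y] mult_right_mono[of K "max 0 K" "dist x y"] by auto
    then have "L * dist (g x) (g y) \<le> L * (max 0 K * dist x y)"
      using BL(3) by (rule mult_left_mono)
    with BL(2)[of "g x" "g y"] show "\<bar>\<phi> (g x) - \<phi> (g y)\<bar> \<le> L * max 0 K * dist x y"
      by (simp add: mult.assoc)
  qed (use BL in auto)
qed

text \<open>For a sublinear expectation, mean 0 of \<open>Y\<close> and mean 0 of its negative are
  separate facts. The second comes from the argument for the first, applied to the pair of
  negatives.\<close>

lemma indep_of_minus:
  fixes X Y :: "'a \<Rightarrow> real"
  assumes "indep_of E Y X"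
  shows "indep_of E (\<lambda>\<omega>. - Y \<omega>) (\<lambda>\<omega>. - X \<omega>)"
  unfolding indep_of_def
proof
  fix \<phi> :: "real \<times> real \<Rightarrow> real" assume "\<phi> \<in> Cb_Lip"
  then have "(\<lambda>p. \<phi> (- p)) \<in> Cb_Lip" by (rule Cb_Lip_compose[of _ _ 1]) (simp add: dist_minus)
  then have "E (\<lambda>\<omega>. \<phi> (- (X \<omega>, Y \<omega>))) = E (\<lambda>\<omega>. E (\<lambda>\<omega>'. \<phi> (- (X \<omega>, Y \<omega>'))))"
    using assms unfolding indep_of_def by (rule bspec[rotated])
  then show "E (\<lambda>\<omega>. \<phi> (- X \<omega>, - Y \<omega>)) = E (\<lambda>\<omega>. E (\<lambda>\<omega>'. \<phi> (- X \<omega>, - Y \<omega>')))"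
    by simp
qed

lemma ident_distr_minus:
  fixes X Y :: "'a \<Rightarrow> real"
  assumes "ident_distr E X E Y"
  shows "ident_distr E (\<lambda>\<omega>. - X \<omega>) E (\<lambda>\<omega>. - Y \<omega>)"
  unfolding ident_distr_def
proof
  fix \<phi> :: "real \<Rightarrow> real" assume "\<phi> \<in> Cb_Lip"
  then have "(\<lambda>x. \<phi> (- x)) \<in> Cb_Lip" by (rule Cb_Lip_compose[of _ _ 1]) (simp add: dist_minus)
  then show "E (\<lambda>\<omega>. \<phi> (- X \<omega>)) = E (\<lambda>\<omega>. \<phi> (- Y \<omega>))"
    using assms unfolding ident_distr_def by (rule bspec[rotated])
qed

lemma eq_of_abs_diff_le_divide:
  fixes u v M :: real
  assumes "\<And>N. 0 < N \<Longrightarrow> \<bar>u - v\<bar> \<le> M / N"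
  shows "u = v"
proof (rule ccontr)
  assume "u \<noteq> v"
  then have pos: "0 < \<bar>u - v\<bar>" by simp
  have "\<bar>u - v\<bar> \<le> M / ((\<bar>M\<bar> + 1) / \<bar>u - v\<bar>)" using pos by (intro assms) simp
  then have "\<bar>u - v\<bar> * (\<bar>M\<bar> + 1) \<le> M * \<bar>u - v\<bar>" by (simp add: pos_le_divide_eq)
  then show False using pos by (simp add: mult.commute)
qed

text \<open>Locally Lipschitz functions whose local constant grows polynomially: a class that
  contains \<open>Cb_Lip\<close> and all real polynomials and is stable under integrating out one
  variable.\<close>

definition poly_lipschitz :: "('b::real_normed_vector \<Rightarrow> real) \<Rightarrow> bool" where
  "poly_lipschitz g \<longleftrightarrow>
     (\<exists>C n. \<forall>x y. \<bar>g x - g y\<bar> \<le> C * (1 + norm x + norm y) ^ n * norm (x - y))"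

lemma poly_lipschitzI:
  "(\<And>x y. \<bar>g x - g y\<bar> \<le> C * (1 + norm x + norm y) ^ n * norm (x - y)) \<Longrightarrow> poly_lipschitz g"
  unfolding poly_lipschitz_def by blast

lemma poly_lipschitzE:
  assumes "poly_lipschitz g"
  obtains C n where "0 \<le> C"
    "\<And>x y. \<bar>g x - g y\<bar> \<le> C * (1 + norm x + norm y) ^ n * norm (x - y)"
proof -
  from assms obtain C n where
    *: "\<And>x y. \<bar>g x - g y\<bar> \<le> C * (1 + norm x + norm y) ^ n * norm (x - y)"
    unfolding poly_lipschitz_def by blast
  have "\<bar>g x - g y\<bar> \<le> \<bar>C\<bar> * (1 + norm x + norm y) ^ n * norm (x - y)" for x y
    by (rule order_trans[OF *]) (intro mult_right_mono; simp)
  then show ?thesis by (intro that[of "\<bar>C\<bar>" n]) auto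
qed

lemma poly_lipschitz_growth:
  fixes g :: "'b::real_normed_vector \<Rightarrow> real"
  assumes "poly_lipschitz g"
  obtains C n where "0 \<le> C" "\<And>x. \<bar>g x\<bar> \<le> C * (1 + norm x) ^ n"
proof -
  from assms obtain C n where C: "0 \<le> C"
    and *: "\<And>x y. \<bar>g x - g y\<bar> \<le> C * (1 + norm x + norm y) ^ n * norm (x - y)"
    by (rule poly_lipschitzE) blast
  show ?thesis
  proof (rule that[of "\<bar>g 0\<bar> + C" "Suc n"])
    fix x :: 'b
    have "\<bar>g x - g 0\<bar> \<le> C * (1 + norm x) ^ n * norm x" using *[of x 0] by simp
    also have "\<dots> \<le> C * (1 + norm x) ^ n * (1 + norm x)"
      using C by (intro mult_left_mono) auto
    finally have 1: "\<bar>g x - g 0\<bar> \<le> C * (1 + norm x) ^ Suc n" by (simp add: algebra_simps)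
    have "(1::real) \<le> (1 + norm x) ^ Suc n" by (rule one_le_power) simp
    then have "\<bar>g 0\<bar> * 1 \<le> \<bar>g 0\<bar> * (1 + norm x) ^ Suc n" by (rule mult_left_mono) simp
    with 1 show "\<bar>g x\<bar> \<le> (\<bar>g 0\<bar> + C) * (1 + norm x) ^ Suc n"
      unfolding distrib_right by linarith
  qed (use C in auto)
qed

text \<open>Sums, differences, absolute values and lattice operations have increments dominated by
  those of their arguments, so one criterion serves them all.\<close>

lemma poly_lipschitz_combine:
  fixes g h k :: "'b::real_normed_vector \<Rightarrow> real"
  assumes "poly_lipschitz g" "poly_lipschitz h"
    and le: "\<And>x y. \<bar>k x - k y\<bar> \<le> K * (\<bar>g x - g y\<bar> + \<bar>h x - h y\<bar>)"
  shows "poly_lipschitz k"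
proof -
  from assms(1) obtain C n where C: "0 \<le> C"
    and g: "\<And>x y. \<bar>g x - g y\<bar> \<le> C * (1 + norm x + norm y) ^ n * norm (x - y)"
    by (rule poly_lipschitzE) blast
  from assms(2) obtain D m where D: "0 \<le> D"
    and h: "\<And>x y. \<bar>h x - h y\<bar> \<le> D * (1 + norm x + norm y) ^ m * norm (x - y)"
    by (rule poly_lipschitzE) blast
  show ?thesis
  proof (rule poly_lipschitzI[of _ "\<bar>K\<bar> * (C + D)" "n + m"])
    fix x y :: 'b
    let ?s = "1 + norm x + norm y"
    have s: "?s ^ n \<le> ?s ^ (n + m)" "?s ^ m \<le> ?s ^ (n + m)"
      by (intro power_increasing; simp)+
    have "\<bar>g x - g y\<bar> \<le> C * ?s ^ (n + m) * norm (x - y)"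
      by (rule order_trans[OF g]) (intro mult_right_mono mult_left_mono s C; simp)
    moreover have "\<bar>h x - h y\<bar> \<le> D * ?s ^ (n + m) * norm (x - y)"
      by (rule order_trans[OF h]) (intro mult_right_mono mult_left_mono s D; simp)
    ultimately have 1: "\<bar>g x - g y\<bar> + \<bar>h x - h y\<bar> \<le> (C + D) * ?s ^ (n + m) * norm (x - y)"
      by (simp add: distrib_right)
    have "\<bar>k x - k y\<bar> \<le> \<bar>K\<bar> * (\<bar>g x - g y\<bar> + \<bar>h x - h y\<bar>)"
      by (rule order_trans[OF le]) (intro mult_right_mono; simp)
    also have "\<dots> \<le> \<bar>K\<bar> * ((C + D) * ?s ^ (n + m) * norm (x - y))"
      by (intro mult_left_mono 1) simp
    finally show "\<bar>k x - k y\<bar> \<le> \<bar>K\<bar> * (C + D) * ?s ^ (n + m) * norm (x - y)"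
      by (simp add: mult.assoc)
  qed
qed

lemma poly_lipschitz_bounded_slope:
  "(\<And>x y. \<bar>g x - g y\<bar> \<le> C * norm (x - y)) \<Longrightarrow> poly_lipschitz g"
  by (rule poly_lipschitzI[of g C 0]) simp

lemma poly_lipschitz_const [intro]: "poly_lipschitz (\<lambda>_. c)"
  by (rule poly_lipschitz_bounded_slope[of _ 0]) simp

lemma poly_lipschitz_id [intro]: "poly_lipschitz (\<lambda>x::real. x)"
  by (rule poly_lipschitz_bounded_slope[of _ 1]) simp

lemma poly_lipschitz_fst [intro]: "poly_lipschitz (fst :: real \<times> real \<Rightarrow> real)"
  by (rule poly_lipschitz_bounded_slope[of _ 1]) (metis dist_fst_le dist_norm mult_1 real_norm_def)

lemma poly_lipschitz_snd [intro]: "poly_lipschitz (snd :: real \<times> real \<Rightarrow> real)"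
  by (rule poly_lipschitz_bounded_slope[of _ 1]) (metis dist_snd_le dist_norm mult_1 real_norm_def)

lemma poly_lipschitz_norm [intro]: "poly_lipschitz norm"
  by (rule poly_lipschitz_bounded_slope[of _ 1]) (simp add: norm_triangle_ineq3)

lemma poly_lipschitz_add [intro]:
  "poly_lipschitz g \<Longrightarrow> poly_lipschitz h \<Longrightarrow> poly_lipschitz (\<lambda>x. g x + h x)"
  by (erule (1) poly_lipschitz_combine[where K = 1]) (simp add: abs_if)

lemma poly_lipschitz_diff [intro]:
  "poly_lipschitz g \<Longrightarrow> poly_lipschitz h \<Longrightarrow> poly_lipschitz (\<lambda>x. g x - h x)"
  by (erule (1) poly_lipschitz_combine[where K = 1]) (simp add: abs_if)

lemma poly_lipschitz_minus [intro]:
  "poly_lipschitz g \<Longrightarrow> poly_lipschitz (\<lambda>x. - g x)"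
  by (rule poly_lipschitz_combine[where K = 1 and g = g and h = g]) (auto simp: abs_if)

lemma poly_lipschitz_abs [intro]:
  "poly_lipschitz g \<Longrightarrow> poly_lipschitz (\<lambda>x. \<bar>g x\<bar>)"
  by (rule poly_lipschitz_combine[where K = 1 and g = g and h = g]) (auto simp: abs_if)

lemma poly_lipschitz_max [intro]:
  "poly_lipschitz g \<Longrightarrow> poly_lipschitz h \<Longrightarrow> poly_lipschitz (\<lambda>x. max (g x) (h x))"
  by (erule (1) poly_lipschitz_combine[where K = 1]) (simp add: abs_if max_def)

lemma poly_lipschitz_min [intro]:
  "poly_lipschitz g \<Longrightarrow> poly_lipschitz h \<Longrightarrow> poly_lipschitz (\<lambda>x. min (g x) (h x))"
  by (erule (1) poly_lipschitz_combine[where K = 1]) (simp add: abs_if min_def)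

lemma poly_lipschitz_mult [intro]:
  fixes g h :: "'b::real_normed_vector \<Rightarrow> real"
  assumes "poly_lipschitz g" "poly_lipschitz h"
  shows "poly_lipschitz (\<lambda>x. g x * h x)"
proof -
  from assms(1) obtain C n where C: "0 \<le> C"
    and g: "\<And>x y. \<bar>g x - g y\<bar> \<le> C * (1 + norm x + norm y) ^ n * norm (x - y)"
    by (rule poly_lipschitzE) blast
  from assms(2) obtain D m where D: "0 \<le> D"
    and h: "\<And>x y. \<bar>h x - h y\<bar> \<le> D * (1 + norm x + norm y) ^ m * norm (x - y)"
    by (rule poly_lipschitzE) blast
  from assms(1) obtain C' n' where C': "0 \<le> C'" and g': "\<And>x. \<bar>g x\<bar> \<le> C' * (1 + norm x) ^ n'"
    by (rule poly_lipschitz_growth) blast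
  from assms(2) obtain D' m' where D': "0 \<le> D'" and h': "\<And>x. \<bar>h x\<bar> \<le> D' * (1 + norm x) ^ m'"
    by (rule poly_lipschitz_growth) blast
  show ?thesis
  proof (rule poly_lipschitzI[of _ "C * D' + C' * D" "n + m' + (n' + m)"])
    fix x y :: 'b
    let ?s = "1 + norm x + norm y" and ?N = "n + m' + (n' + m)"
    have gx: "\<bar>g x\<bar> \<le> C' * ?s ^ n'"
      by (rule order_trans[OF g']) (intro mult_left_mono power_mono C'; simp)
    have hy: "\<bar>h y\<bar> \<le> D' * ?s ^ m'"
      by (rule order_trans[OF h']) (intro mult_left_mono power_mono D'; simp)
    have "g x * h x - g y * h y = (g x - g y) * h y + g x * (h x - h y)" by (simp add: algebra_simps)
    then have "\<bar>g x * h x - g y * h y\<bar> \<le> \<bar>g x - g y\<bar> * \<bar>h y\<bar> + \<bar>g x\<bar> * \<bar>h x - h y\<bar>"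
      by (metis abs_mult abs_triangle_ineq)
    also have "\<dots> \<le> (C * ?s ^ n * norm (x - y)) * (D' * ?s ^ m') + (C' * ?s ^ n') * (D * ?s ^ m * norm (x - y))"
      using C C' D D' by (intro add_mono mult_mono g h gx hy) auto
    also have "\<dots> = (C * D' * ?s ^ (n + m') + C' * D * ?s ^ (n' + m)) * norm (x - y)"
      by (simp add: algebra_simps power_add)
    also have "\<dots> \<le> (C * D' * ?s ^ ?N + C' * D * ?s ^ ?N) * norm (x - y)"
      using C C' D D'
      by (intro mult_right_mono add_mono[where 'a = real] mult_left_mono power_increasing) auto
    finally show "\<bar>g x * h x - g y * h y\<bar> \<le> (C * D' + C' * D) * ?s ^ ?N * norm (x - y)"
      by (simp only: distrib_right)
  qed
qed

lemma poly_lipschitz_power [intro]: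
  "poly_lipschitz g \<Longrightarrow> poly_lipschitz (\<lambda>x. g x ^ n)"
  by (induction n) auto

lemma poly_lipschitz_Cb_Lip [intro]: "\<phi> \<in> Cb_Lip \<Longrightarrow> poly_lipschitz \<phi>"
  by (erule Cb_LipE) (rule poly_lipschitz_bounded_slope, simp add: dist_norm)

lemma poly_lipschitz_Cb_Lip_compose2:
  fixes \<phi> :: "real \<times> real \<Rightarrow> real"
  assumes "\<phi> \<in> Cb_Lip" "poly_lipschitz g" "poly_lipschitz h"
  shows "poly_lipschitz (\<lambda>x. \<phi> (g x, h x))"
proof -
  from assms(1) obtain B L where
    BL: "\<And>x y. \<bar>\<phi> x - \<phi> y\<bar> \<le> L * dist x y" "0 \<le> L"
    by (rule Cb_LipE) blast
  show ?thesis
  proof (rule poly_lipschitz_combine[OF assms(2,3)])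
    fix x y
    have "dist (g x, h x) (g y, h y) \<le> \<bar>g x - g y\<bar> + \<bar>h x - h y\<bar>"
      unfolding dist_Pair_Pair dist_real_def
      using sqrt_sum_squares_le_sum_abs[of "\<bar>g x - g y\<bar>" "\<bar>h x - h y\<bar>"] by simp
    then show "\<bar>\<phi> (g x, h x) - \<phi> (g y, h y)\<bar> \<le> L * (\<bar>g x - g y\<bar> + \<bar>h x - h y\<bar>)"
      by (intro order_trans[OF BL(1)] mult_left_mono BL(2))
  qed
qed

text \<open>A high power of 1 + |x|^2 outweighs both the growth of g and that of its local Lipschitz
  constant. Since \<open>H\<close> contains the weights, g(X) is recovered as an element of
  \<open>H\<close> by multiplying back.\<close>

lemma poly_lipschitz_weighted:
  fixes g :: "'b::real_normed_vector \<Rightarrow> real"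
  assumes "poly_lipschitz g"
  obtains k where "(\<lambda>x. g x / (1 + (norm x)\<^sup>2) ^ k) \<in> Cb_Lip"
proof -
  from assms obtain C n where C: "0 \<le> C"
    and g: "\<And>x y. \<bar>g x - g y\<bar> \<le> C * (1 + norm x + norm y) ^ n * norm (x - y)"
    by (rule poly_lipschitzE) blast
  from assms obtain C' n' where C': "0 \<le> C'" and g': "\<And>x. \<bar>g x\<bar> \<le> C' * (1 + norm x) ^ n'"
    by (rule poly_lipschitz_growth) blast
  define k where "k = n + n'"
  define v where "v x = 1 + (norm x)\<^sup>2" for x :: 'b
  have v1: "1 \<le> v x" for x by (simp add: v_def)
  have sq: "1 + 2 * r \<le> 2 * (1 + r\<^sup>2)" for r :: real
  proof -
    have "2 * (1 + r\<^sup>2) - (1 + 2 * r) = (r - 1)\<^sup>2 + r\<^sup>2"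
      by (simp add: power2_eq_square algebra_simps)
    then show ?thesis by (metis diff_ge_0_iff_ge sum_power2_ge_zero)
  qed
  have le2: "1 + 2 * norm x \<le> 2 * v x" for x
    using sq[of "norm x"] by (simp only: v_def)
  define B where "B = C' * 2 ^ n'"
  have B: "\<bar>g x\<bar> / v x ^ k \<le> B" for x
  proof -
    have "(1 + norm x) ^ n' \<le> (2 * v x) ^ n'"
      using le2[of x] norm_ge_zero[of x] by (intro power_mono) linarith+
    also have "\<dots> \<le> 2 ^ n' * v x ^ k"
      using v1[of x] by (simp add: power_mult_distrib k_def power_increasing)
    finally have "C' * (1 + norm x) ^ n' \<le> C' * (2 ^ n' * v x ^ k)"
      using C' by (rule mult_left_mono)
    with g'[of x] have "\<bar>g x\<bar> \<le> B * v x ^ k" by (simp add: B_def mult.assoc)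
    then show ?thesis using v1[of x] by (simp add: divide_le_eq)
  qed
  have B0: "0 \<le> B" using C' by (simp add: B_def)
  \<comment> \<open>With x the point of larger norm, the ratio q of the weights is at most 1.
    Bernoulli's inequality bounds 1 - q^k linearly, and |x| + |y| \<le> v(x) turns this into a
    Lipschitz bound free of polynomial factors.\<close>
  have main: "\<bar>g x / v x ^ k - g y / v y ^ k\<bar> \<le> (C * 2 ^ n + B * real k) * dist x y"
    if "norm y \<le> norm x" for x y
  proof -
    define q where "q = v y / v x"
    have vv: "v y \<le> v x" using that by (simp add: v_def power_mono)
    have q: "0 \<le> q" "q \<le> 1" using v1[of x] v1[of y] vv by (auto simp: q_def divide_le_eq)
    have "1 + real k * (q - 1) \<le> (1 + (q - 1)) ^ k"
      by (rule Bernoulli_inequality) (use q in simp)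
    then have "1 - q ^ k \<le> real k * (1 - q)" by (simp add: algebra_simps)
    also have "1 - q = (v x - v y) / v x" using v1[of x] by (simp add: q_def field_simps)
    also have "v x - v y = (norm x - norm y) * (norm x + norm y)"
      by (simp add: v_def power2_eq_square algebra_simps)
    also have "\<dots> / v x \<le> dist x y"
    proof -
      have "2 * norm x \<le> 1 + (norm x)\<^sup>2"
        using zero_le_power2[of "norm x - 1"] by (simp add: power2_diff)
      with that have 0: "norm x + norm y \<le> v x" by (simp add: v_def)
      have "(norm x - norm y) * (norm x + norm y) \<le> dist x y * v x"
        using that 0 by (intro mult_mono) (auto simp: dist_norm norm_triangle_ineq2)
      then show ?thesis using v1[of x] by (simp add: divide_le_eq)
    qed
    finally have 1: "1 - q ^ k \<le> real k * dist x y" by (simp add: mult_left_mono)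
    have "(1 + norm x + norm y) ^ n \<le> (2 * v x) ^ n"
      using le2[of x] that norm_ge_zero[of x] norm_ge_zero[of y] by (intro power_mono) linarith+
    also have "\<dots> \<le> 2 ^ n * v x ^ k"
      using v1[of x] by (simp add: power_mult_distrib k_def power_increasing)
    finally have "C * (1 + norm x + norm y) ^ n * norm (x - y) \<le> C * (2 ^ n * v x ^ k) * norm (x - y)"
      using C by (intro mult_right_mono mult_left_mono) auto
    with g[of x y] have "\<bar>g x - g y\<bar> \<le> C * 2 ^ n * dist x y * v x ^ k"
      by (simp add: dist_norm algebra_simps)
    then have 2: "\<bar>g x - g y\<bar> / v x ^ k \<le> C * 2 ^ n * dist x y"
      using v1[of x] by (simp add: divide_le_eq)
    have "g x / v x ^ k - g y / v y ^ k = (g x - g y) / v x ^ k - g y / v y ^ k * (1 - q ^ k)"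
      using v1[of x] v1[of y] by (simp add: q_def power_divide field_simps)
    also have "\<bar>\<dots>\<bar> \<le> \<bar>g x - g y\<bar> / v x ^ k + \<bar>g y\<bar> / v y ^ k * (1 - q ^ k)"
    proof -
      have "0 \<le> 1 - q ^ k" using q by (simp add: power_le_one)
      then have "\<bar>g y / v y ^ k * (1 - q ^ k)\<bar> = \<bar>g y\<bar> / v y ^ k * (1 - q ^ k)"
        using v1[of y] by (simp add: abs_mult)
      moreover have "\<bar>(g x - g y) / v x ^ k\<bar> = \<bar>g x - g y\<bar> / v x ^ k"
        using v1[of x] by simp
      ultimately show ?thesis by linarith
    qed
    also have "\<dots> \<le> C * 2 ^ n * dist x y + B * (real k * dist x y)"
    proof (intro add_mono 2 mult_mono B 1 B0)
      show "0 \<le> 1 - q ^ k" using q by (simp add: power_le_one)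
    qed
    finally show ?thesis by (simp add: algebra_simps)
  qed
  have "(\<lambda>x. g x / v x ^ k) \<in> Cb_Lip"
  proof (rule Cb_LipI[of _ B "C * 2 ^ n + B * real k"])
    show "\<bar>g x / v x ^ k\<bar> \<le> B" for x using B[of x] v1[of x] by simp
    show "\<bar>g x / v x ^ k - g y / v y ^ k\<bar> \<le> (C * 2 ^ n + B * real k) * dist x y" for x y
      using main[of y x] main[of x y] by (metis abs_minus_commute dist_commute le_cases)
  qed (use C B0 in auto)
  then show ?thesis using that by (simp add: v_def)
qed

text \<open>Both coordinates are clamped to [-N, N]; the error of clamping t is at most t^2 / N,
  which trades a factor 1/N for two more powers in the weight. The weight has finite expectation, so
  identities survive the limit of large N.\<close>

lemma poly_lipschitz_truncate:
  fixes g :: "real \<times> real \<Rightarrow> real"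
  assumes "poly_lipschitz g"
  obtains D m where "0 \<le> D"
    "\<And>N::real. 0 < N \<Longrightarrow> \<exists>\<phi>\<in>Cb_Lip. \<forall>p. \<bar>g p - \<phi> p\<bar> \<le> D * (1 + norm p) ^ m / N"
proof -
  from assms obtain C n where C: "0 \<le> C"
    and g: "\<And>x y. \<bar>g x - g y\<bar> \<le> C * (1 + norm x + norm y) ^ n * norm (x - y)"
    by (rule poly_lipschitzE) blast
  show ?thesis
  proof (rule that[of "C * 2 ^ n" "n + 2"])
    fix N :: real assume N: "0 < N"
    define cl where "cl x = max (- N) (min N x)" for x :: real
    define cl2 where "cl2 p = (cl (fst p), cl (snd p))" for p
    have cl_le: "\<bar>cl x\<bar> \<le> \<bar>x\<bar>" "\<bar>cl x\<bar> \<le> N" "\<bar>cl x - cl y\<bar> \<le> \<bar>x - y\<bar>" for x y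
      using N by (auto simp: cl_def max_def min_def abs_if)
    have cl_diff: "\<bar>x - cl x\<bar> \<le> x\<^sup>2 / N" for x
    proof (cases "\<bar>x\<bar> \<le> N")
      case True
      then have "cl x = x" using N by (auto simp: cl_def max_def min_def abs_if split: if_splits)
      then show ?thesis using N by simp
    next
      case False
      then have "\<bar>x - cl x\<bar> \<le> \<bar>x\<bar>" using N by (auto simp: cl_def max_def min_def abs_if)
      also have "\<bar>x\<bar> * N \<le> \<bar>x\<bar> * \<bar>x\<bar>" using False by (intro mult_left_mono) auto
      then have "\<bar>x\<bar> \<le> x\<^sup>2 / N" using N by (simp add: pos_le_divide_eq power2_eq_square)
      finally show ?thesis .
    qed
    have n1: "norm (cl2 p) \<le> norm p" for p
      unfolding cl2_def norm_prod_def using cl_le(1)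
      by (simp add: power_mono abs_le_square_iff add_mono)
    have n2: "norm (cl2 p) \<le> 2 * N" for p
      using norm_Pair_le[of "cl (fst p)" "cl (snd p)"] cl_le(2)[of "fst p"] cl_le(2)[of "snd p"]
      by (simp add: cl2_def)
    have n3: "norm (cl2 p - cl2 q) \<le> norm (p - q)" for p q
      unfolding cl2_def norm_prod_def using cl_le(3)
      by (simp add: abs_le_square_iff add_mono)
    have n4: "norm (p - cl2 p) \<le> (norm p)\<^sup>2 / N" for p
    proof -
      have "norm (p - cl2 p) \<le> \<bar>fst p - cl (fst p)\<bar> + \<bar>snd p - cl (snd p)\<bar>"
        using norm_Pair_le[of "fst p - cl (fst p)" "snd p - cl (snd p)"]
        by (simp add: cl2_def minus_prod_def)
      also have "\<dots> \<le> (fst p)\<^sup>2 / N + (snd p)\<^sup>2 / N" by (intro add_mono cl_diff)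
      also have "\<dots> = (norm p)\<^sup>2 / N" by (simp add: norm_prod_def add_divide_distrib)
      finally show ?thesis .
    qed
    have "(\<lambda>p. g (cl2 p)) \<in> Cb_Lip"
    proof (rule Cb_LipI[of _ "\<bar>g 0\<bar> + C * (1 + 2 * N) ^ n * (2 * N)" "C * (1 + 4 * N) ^ n"])
      fix p q
      have "\<bar>g (cl2 p) - g 0\<bar> \<le> C * (1 + norm (cl2 p)) ^ n * norm (cl2 p)"
        using g[of "cl2 p" 0] by simp
      also have "\<dots> \<le> C * (1 + 2 * N) ^ n * (2 * N)"
        using n2[of p] N C by (intro mult_mono mult_left_mono power_mono) auto
      finally show "\<bar>g (cl2 p)\<bar> \<le> \<bar>g 0\<bar> + C * (1 + 2 * N) ^ n * (2 * N)" by linarith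
      have "C * (1 + norm (cl2 p) + norm (cl2 q)) ^ n * norm (cl2 p - cl2 q) \<le> C * (1 + 4 * N) ^ n * norm (p - q)"
        using n2[of p] n2[of q] n3[of p q] N C by (intro mult_mono mult_left_mono power_mono) auto
      with g[of "cl2 p" "cl2 q"]
      show "\<bar>g (cl2 p) - g (cl2 q)\<bar> \<le> C * (1 + 4 * N) ^ n * dist p q"
        by (simp add: dist_norm)
    qed (use C N in auto)
    moreover have "\<bar>g p - g (cl2 p)\<bar> \<le> C * 2 ^ n * (1 + norm p) ^ (n + 2) / N" for p
    proof -
      have "\<bar>g p - g (cl2 p)\<bar> \<le> C * (1 + norm p + norm (cl2 p)) ^ n * norm (p - cl2 p)" by (rule g)
      also have "\<dots> \<le> C * (2 * (1 + norm p)) ^ n * ((1 + norm p)\<^sup>2 / N)"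
      proof (intro mult_mono mult_left_mono power_mono)
        show "norm (p - cl2 p) \<le> (1 + norm p)\<^sup>2 / N"
          by (rule order_trans[OF n4]) (use N in \<open>auto intro!: divide_right_mono power_mono\<close>)
      qed (use n1[of p] C in auto)
      also have "\<dots> = C * 2 ^ n * (1 + norm p) ^ (n + 2) / N"
        by (simp only: power_mult_distrib power_add) simp
      finally show ?thesis .
    qed
    ultimately show "\<exists>\<phi>\<in>Cb_Lip. \<forall>p. \<bar>g p - \<phi> p\<bar> \<le> C * 2 ^ n * (1 + norm p) ^ (n + 2) / N"
      by (intro bexI[of _ "\<lambda>p. g (cl2 p)"]) auto
  qed (use C in auto)
qed

section \<open>Moments and independence\<close>

context sublinear_expectation_space
begin

lemma minus_mem: "X \<in> H \<Longrightarrow> (\<lambda>\<omega>. - X \<omega>) \<in> H"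
  using scale_mem[of X "-1"] by simp

lemma diff_mem: "X \<in> H \<Longrightarrow> Y \<in> H \<Longrightarrow> (\<lambda>\<omega>. X \<omega> - Y \<omega>) \<in> H"
  using add_mem[OF _ minus_mem, of X Y] by simp

lemma mult_mem:
  assumes "X \<in> H" "Y \<in> H"
  shows "(\<lambda>\<omega>. X \<omega> * Y \<omega>) \<in> H"
proof -
  have "(\<lambda>\<omega>. (1/2) * ((X \<omega> + Y \<omega>)\<^sup>2 - ((X \<omega>)\<^sup>2 + (Y \<omega>)\<^sup>2))) \<in> H"
    by (intro scale_mem diff_mem add_mem square_mem assms)
  then show ?thesis by (simp add: power2_eq_square algebra_simps)
qed

lemma power_mem: "X \<in> H \<Longrightarrow> (\<lambda>\<omega>. X \<omega> ^ n) \<in> H"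
  by (induction n) (auto intro: const_mem mult_mem)

lemmas mem_intros = const_mem add_mem scale_mem minus_mem diff_mem mult_mem power_mem abs_mem

lemma poly_lipschitz_mem:
  fixes g :: "real \<times> real \<Rightarrow> real"
  assumes "poly_lipschitz g" "X \<in> H" "Y \<in> H"
  shows "(\<lambda>\<omega>. g (X \<omega>, Y \<omega>)) \<in> H"
proof -
  obtain k where k: "(\<lambda>p. g p / (1 + (norm p)\<^sup>2) ^ k) \<in> Cb_Lip"
    using assms(1) by (rule poly_lipschitz_weighted)
  let ?v = "\<lambda>\<omega>. 1 + (norm (X \<omega>, Y \<omega>))\<^sup>2"
  have "?v = (\<lambda>\<omega>. 1 + ((X \<omega>)\<^sup>2 + (Y \<omega>)\<^sup>2))" by (simp add: norm_prod_def)
  moreover have "\<dots> \<in> H" by (intro add_mem const_mem square_mem assms)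
  ultimately have "?v \<in> H" by (simp only:)
  then have "(\<lambda>\<omega>. g (X \<omega>, Y \<omega>) / ?v \<omega> ^ k * ?v \<omega> ^ k) \<in> H"
    using Cb_Lip_mem[OF assms(2,3) k] by (intro mult_mem power_mem)
  moreover have "?v \<omega> \<noteq> 0" for \<omega>
    using zero_le_power2[of "norm (X \<omega>, Y \<omega>)"] by linarith
  ultimately show ?thesis by simp
qed

lemma poly_lipschitz_mem1:
  assumes "poly_lipschitz g" "X \<in> H"
  shows "(\<lambda>\<omega>. g (X \<omega>)) \<in> H"
proof -
  obtain k where k: "(\<lambda>p. g p / (1 + (norm p)\<^sup>2) ^ k) \<in> Cb_Lip"
    using assms(1) by (rule poly_lipschitz_weighted)
  have "(\<lambda>\<omega>. g (X \<omega>) / (1 + (X \<omega>)\<^sup>2) ^ k * (1 + (X \<omega>)\<^sup>2) ^ k) \<in> H"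
    using Cb_Lip_mem1[OF assms(2) k]
    by (intro mult_mem power_mem add_mem const_mem square_mem assms) simp
  moreover have "1 + (X \<omega>)\<^sup>2 \<noteq> 0" for \<omega>
    using zero_le_power2[of "X \<omega>"] by linarith
  ultimately show ?thesis by simp
qed

lemma expectation_add_const:
  assumes "X \<in> H"
  shows "E (\<lambda>\<omega>. X \<omega> + c) = E X + c"
proof -
  have "E (\<lambda>\<omega>. X \<omega> + c) \<le> E X + c"
    using subadditive[OF assms const_mem[of c]] by (simp add: const)
  moreover have "E X \<le> E (\<lambda>\<omega>. X \<omega> + c) + - c"
    using subadditive[OF add_mem[OF assms const_mem[of c]] const_mem[of "- c"]] by (simp add: const)
  ultimately show ?thesis by simp
qed

lemma expectation_diff:
  assumes "X \<in> H" "Y \<in> H"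
  shows "E X - E Y \<le> E (\<lambda>\<omega>. X \<omega> - Y \<omega>)"
  using subadditive[OF diff_mem[OF assms] assms(2)] by simp

lemma expectation_abs_diff:
  assumes "X \<in> H" "Y \<in> H" "Z \<in> H" "\<And>\<omega>. \<bar>X \<omega> - Y \<omega>\<bar> \<le> Z \<omega>"
  shows "\<bar>E X - E Y\<bar> \<le> E Z"
proof -
  have le: "X \<omega> - Y \<omega> \<le> Z \<omega>" "Y \<omega> - X \<omega> \<le> Z \<omega>" for \<omega>
    using assms(4)[of \<omega>] by auto
  have "E X - E Y \<le> E Z"
    using expectation_diff[OF assms(1,2)] monotone[OF assms(3) diff_mem[OF assms(1,2)] le(1)] by linarith
  moreover have "E Y - E X \<le> E Z"
    using expectation_diff[OF assms(2,1)] monotone[OF assms(3) diff_mem[OF assms(2,1)] le(2)] by linarith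
  ultimately show ?thesis by linarith
qed

lemma expectation_nonneg: "X \<in> H \<Longrightarrow> (\<And>\<omega>. 0 \<le> X \<omega>) \<Longrightarrow> 0 \<le> E X"
  using monotone[of X "\<lambda>_. 0"] const[of 0] const_mem[of 0] by simp

lemma expectation_minus: "X \<in> H \<Longrightarrow> - E X \<le> E (\<lambda>\<omega>. - X \<omega>)"
  using expectation_diff[of "\<lambda>_. 0" X] const[of 0] const_mem[of 0] by simp

text \<open>Such a \<open>Y\<close> has no mean uncertainty: each multiple of it has expectation 0,
  and subadditivity, used forwards and backwards, lets multiples be added or dropped exactly. This
  stands in for linearity.\<close>

lemma expectation_add_certain:
  assumes "X \<in> H" "Y \<in> H" "E Y = 0" "E (\<lambda>\<omega>. - Y \<omega>) = 0"
  shows "E (\<lambda>\<omega>. X \<omega> + c * Y \<omega>) = E X"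
proof -
  have z: "E (\<lambda>\<omega>. c * Y \<omega>) = 0" for c
  proof (cases "0 \<le> c")
    case True
    then show ?thesis using pos_homogeneous[OF assms(2)] assms(3) by simp
  next
    case False
    then show ?thesis using pos_homogeneous[OF minus_mem[OF assms(2)], of "- c"] assms(4) by simp
  qed
  have cY: "(\<lambda>\<omega>. c * Y \<omega>) \<in> H" for c using assms(2) by (rule scale_mem)
  have "E (\<lambda>\<omega>. X \<omega> + c * Y \<omega>) \<le> E X"
    using subadditive[OF assms(1) cY] z by simp
  moreover have "E X \<le> E (\<lambda>\<omega>. X \<omega> + c * Y \<omega>)"
    using subadditive[OF add_mem[OF assms(1) cY[of c]] cY[of "- c"]] z[of "- c"] by simp
  ultimately show ?thesis by simp
qed

text \<open>The weight factorises, 1 + |x| + |y| + 2|Y| \<le> (1 + |x| + |y|)(1 + 2|Y|), so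
  integrating out \<open>Y\<close> only costs a moment of \<open>Y\<close>. Hence iterated
  expectations stay within \<open>H\<close>.\<close>

lemma poly_lipschitz_inner:
  fixes g :: "real \<times> real \<Rightarrow> real"
  assumes "poly_lipschitz g" "Y \<in> H"
  shows "poly_lipschitz (\<lambda>x. E (\<lambda>\<omega>. g (x, Y \<omega>)))"
proof -
  from assms(1) obtain C n where C: "0 \<le> C"
    and g: "\<And>p q. \<bar>g p - g q\<bar> \<le> C * (1 + norm p + norm q) ^ n * norm (p - q)"
    by (rule poly_lipschitzE) blast
  have mem: "(\<lambda>\<omega>. g (x, Y \<omega>)) \<in> H" for x
    using poly_lipschitz_mem[OF assms(1) const_mem[of x] assms(2)] .
  let ?W = "\<lambda>\<omega>. (1 + 2 * \<bar>Y \<omega>\<bar>) ^ n"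
  have W: "?W \<in> H" by (intro mem_intros assms)
  show ?thesis
  proof (rule poly_lipschitzI[of _ "C * E ?W" n])
    fix x y :: real
    let ?c = "C * (1 + \<bar>x\<bar> + \<bar>y\<bar>) ^ n * \<bar>x - y\<bar>"
    have "\<bar>E (\<lambda>\<omega>. g (x, Y \<omega>)) - E (\<lambda>\<omega>. g (y, Y \<omega>))\<bar> \<le> E (\<lambda>\<omega>. ?c * ?W \<omega>)"
    proof (intro expectation_abs_diff mem scale_mem W)
      fix \<omega>
      have N: "norm (u, Y \<omega>) \<le> \<bar>u\<bar> + \<bar>Y \<omega>\<bar>" for u
        using norm_Pair_le[of u "Y \<omega>"] by simp
      have "1 + norm (x, Y \<omega>) + norm (y, Y \<omega>) \<le> 1 + \<bar>x\<bar> + \<bar>y\<bar> + 2 * \<bar>Y \<omega>\<bar>"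
        using N[of x] N[of y] by simp
      also have "\<dots> \<le> (1 + \<bar>x\<bar> + \<bar>y\<bar>) * (1 + 2 * \<bar>Y \<omega>\<bar>)" by (simp add: algebra_simps)
      finally have "(1 + norm (x, Y \<omega>) + norm (y, Y \<omega>)) ^ n \<le> ((1 + \<bar>x\<bar> + \<bar>y\<bar>) * (1 + 2 * \<bar>Y \<omega>\<bar>)) ^ n"
        by (intro power_mono) auto
      then have "C * (1 + norm (x, Y \<omega>) + norm (y, Y \<omega>)) ^ n * \<bar>x - y\<bar>
          \<le> C * ((1 + \<bar>x\<bar> + \<bar>y\<bar>) * (1 + 2 * \<bar>Y \<omega>\<bar>)) ^ n * \<bar>x - y\<bar>"
        using C by (intro mult_right_mono mult_left_mono) auto
      with g[of "(x, Y \<omega>)" "(y, Y \<omega>)"]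
      show "\<bar>g (x, Y \<omega>) - g (y, Y \<omega>)\<bar> \<le> ?c * ?W \<omega>"
        unfolding power_mult_distrib by (simp add: ac_simps)
    qed
    also have "\<dots> = ?c * E ?W" using C by (intro pos_homogeneous W) simp
    finally show "\<bar>E (\<lambda>\<omega>. g (x, Y \<omega>)) - E (\<lambda>\<omega>. g (y, Y \<omega>))\<bar>
        \<le> C * E ?W * (1 + norm x + norm y) ^ n * norm (x - y)"
      by (simp add: algebra_simps)
  qed
qed

text \<open>Truncation changes each side by at most 1/N times the expectation of the weight, joint
  on the left and iterated on the right; \<open>M\<close> is their sum.\<close>

lemma indep_of_poly_lipschitz:
  fixes g :: "real \<times> real \<Rightarrow> real"
  assumes ind: "indep_of E Y X" and XY: "X \<in> H" "Y \<in> H" and g: "poly_lipschitz g"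
  shows "E (\<lambda>\<omega>. g (X \<omega>, Y \<omega>)) = E (\<lambda>\<omega>. E (\<lambda>\<omega>'. g (X \<omega>, Y \<omega>')))"
proof -
  obtain D m where D: "0 \<le> D"
    "\<And>N::real. 0 < N \<Longrightarrow> \<exists>\<phi>\<in>Cb_Lip. \<forall>p. \<bar>g p - \<phi> p\<bar> \<le> D * (1 + norm p) ^ m / N"
    using g by (rule poly_lipschitz_truncate) blast
  define W where "W p = D * (1 + norm p) ^ m" for p :: "real \<times> real"
  have W: "poly_lipschitz W" unfolding W_def[abs_def]
    by (intro poly_lipschitz_mult poly_lipschitz_power poly_lipschitz_add poly_lipschitz_const poly_lipschitz_norm)
  have outer: "(\<lambda>\<omega>. h (X \<omega>, Y \<omega>)) \<in> H" if "poly_lipschitz h" for h :: "real \<times> real \<Rightarrow> real"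
    using poly_lipschitz_mem[OF that XY] .
  have inner: "(\<lambda>\<omega>. h (x, Y \<omega>)) \<in> H" if "poly_lipschitz h" for h :: "real \<times> real \<Rightarrow> real" and x
    using poly_lipschitz_mem[OF that const_mem[of x] XY(2)] .
  have iter: "(\<lambda>\<omega>. E (\<lambda>\<omega>'. h (X \<omega>, Y \<omega>'))) \<in> H" if "poly_lipschitz h" for h :: "real \<times> real \<Rightarrow> real"
    using poly_lipschitz_mem1[OF poly_lipschitz_inner[OF that XY(2)] XY(1)] .
  let ?L = "E (\<lambda>\<omega>. g (X \<omega>, Y \<omega>))" and ?R = "E (\<lambda>\<omega>. E (\<lambda>\<omega>'. g (X \<omega>, Y \<omega>')))"
  define M where "M = E (\<lambda>\<omega>. W (X \<omega>, Y \<omega>)) + E (\<lambda>\<omega>. E (\<lambda>\<omega>'. W (X \<omega>, Y \<omega>')))"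
  have "\<bar>?L - ?R\<bar> \<le> M / N" if N: "0 < N" for N
  proof -
    from D(2)[OF N] obtain \<phi> where \<phi>: "\<phi> \<in> Cb_Lip"
      and le: "\<And>p. \<bar>g p - \<phi> p\<bar> \<le> (1 / N) * W p" by (auto simp: W_def)
    note p\<phi> = poly_lipschitz_Cb_Lip[OF \<phi>]
    have "\<bar>?L - E (\<lambda>\<omega>. \<phi> (X \<omega>, Y \<omega>))\<bar> \<le> E (\<lambda>\<omega>. (1 / N) * W (X \<omega>, Y \<omega>))"
      by (intro expectation_abs_diff outer[OF g] outer[OF p\<phi>] scale_mem outer[OF W] le)
    also have "\<dots> = (1 / N) * E (\<lambda>\<omega>. W (X \<omega>, Y \<omega>))"
      using N by (intro pos_homogeneous outer[OF W]) auto
    finally have 1: "\<bar>?L - E (\<lambda>\<omega>. \<phi> (X \<omega>, Y \<omega>))\<bar> \<le> (1 / N) * E (\<lambda>\<omega>. W (X \<omega>, Y \<omega>))" .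
    have in1: "\<bar>E (\<lambda>\<omega>'. g (x, Y \<omega>')) - E (\<lambda>\<omega>'. \<phi> (x, Y \<omega>'))\<bar> \<le> (1 / N) * E (\<lambda>\<omega>'. W (x, Y \<omega>'))" for x
    proof -
      have "\<bar>E (\<lambda>\<omega>'. g (x, Y \<omega>')) - E (\<lambda>\<omega>'. \<phi> (x, Y \<omega>'))\<bar> \<le> E (\<lambda>\<omega>'. (1 / N) * W (x, Y \<omega>'))"
        by (intro expectation_abs_diff inner[OF g] inner[OF p\<phi>] scale_mem inner[OF W] le)
      also have "\<dots> = (1 / N) * E (\<lambda>\<omega>'. W (x, Y \<omega>'))"
        using N by (intro pos_homogeneous inner[OF W]) auto
      finally show ?thesis .
    qed
    have "\<bar>?R - E (\<lambda>\<omega>. E (\<lambda>\<omega>'. \<phi> (X \<omega>, Y \<omega>')))\<bar> \<le> E (\<lambda>\<omega>. (1 / N) * E (\<lambda>\<omega>'. W (X \<omega>, Y \<omega>')))"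
      by (intro expectation_abs_diff iter[OF g] iter[OF p\<phi>] scale_mem iter[OF W] in1)
    also have "\<dots> = (1 / N) * E (\<lambda>\<omega>. E (\<lambda>\<omega>'. W (X \<omega>, Y \<omega>')))"
      using N by (intro pos_homogeneous iter[OF W]) auto
    finally have 2: "\<bar>?R - E (\<lambda>\<omega>. E (\<lambda>\<omega>'. \<phi> (X \<omega>, Y \<omega>')))\<bar>
        \<le> (1 / N) * E (\<lambda>\<omega>. E (\<lambda>\<omega>'. W (X \<omega>, Y \<omega>')))" .
    have 3: "E (\<lambda>\<omega>. \<phi> (X \<omega>, Y \<omega>)) = E (\<lambda>\<omega>. E (\<lambda>\<omega>'. \<phi> (X \<omega>, Y \<omega>')))"
      using ind \<phi> by (simp add: indep_of_def)
    have "(1 / N) * M = (1 / N) * E (\<lambda>\<omega>. W (X \<omega>, Y \<omega>)) + (1 / N) * E (\<lambda>\<omega>. E (\<lambda>\<omega>'. W (X \<omega>, Y \<omega>')))"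
      by (simp add: M_def distrib_left)
    with 1 2 3 show ?thesis by simp
  qed
  then show ?thesis by (rule eq_of_abs_diff_le_divide)
qed

lemma ident_distr_poly_lipschitz:
  fixes g :: "real \<Rightarrow> real"
  assumes id: "ident_distr E X E Y" and XY: "X \<in> H" "Y \<in> H" and g: "poly_lipschitz g"
  shows "E (\<lambda>\<omega>. g (X \<omega>)) = E (\<lambda>\<omega>. g (Y \<omega>))"
proof -
  \<comment> \<open>Truncation is formulated on the plane, so g is read as a function of the first
    coordinate and restricted to the axis afterwards.\<close>
  have "poly_lipschitz (\<lambda>p::real \<times> real. g (fst p))"
  proof -
    from g obtain C n where C: "0 \<le> C"
      and g: "\<And>x y. \<bar>g x - g y\<bar> \<le> C * (1 + norm x + norm y) ^ n * norm (x - y)"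
      by (rule poly_lipschitzE) blast
    show ?thesis
    proof (rule poly_lipschitzI[of _ C n])
      fix p q :: "real \<times> real"
      have "norm (fst p) \<le> norm p" "norm (fst q) \<le> norm q" "norm (fst p - fst q) \<le> norm (p - q)"
        using norm_fst_le[of "fst p" "snd p"] norm_fst_le[of "fst q" "snd q"]
          dist_fst_le[of p q] by (simp_all add: dist_norm)
      then have "C * (1 + norm (fst p) + norm (fst q)) ^ n * norm (fst p - fst q)
          \<le> C * (1 + norm p + norm q) ^ n * norm (p - q)"
        using C by (intro mult_mono mult_left_mono power_mono) auto
      with g[of "fst p" "fst q"]
      show "\<bar>g (fst p) - g (fst q)\<bar> \<le> C * (1 + norm p + norm q) ^ n * norm (p - q)" by linarith
    qed
  qed
  then obtain D m where D: "0 \<le> D"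
    "\<And>N::real. 0 < N \<Longrightarrow> \<exists>\<phi>\<in>Cb_Lip. \<forall>p::real \<times> real. \<bar>g (fst p) - \<phi> p\<bar> \<le> D * (1 + norm p) ^ m / N"
    by (rule poly_lipschitz_truncate) blast
  define W where "W x = D * (1 + \<bar>x\<bar>) ^ m" for x :: real
  have W: "(\<lambda>\<omega>. W (Z \<omega>)) \<in> H" if "Z \<in> H" for Z
    unfolding W_def by (intro mem_intros that)
  have gm: "(\<lambda>\<omega>. g (Z \<omega>)) \<in> H" if "Z \<in> H" for Z using g that by (rule poly_lipschitz_mem1)
  let ?L = "E (\<lambda>\<omega>. g (X \<omega>))" and ?R = "E (\<lambda>\<omega>. g (Y \<omega>))"
  define M where "M = E (\<lambda>\<omega>. W (X \<omega>)) + E (\<lambda>\<omega>. W (Y \<omega>))"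
  have "\<bar>?L - ?R\<bar> \<le> M / N" if N: "0 < N" for N
  proof -
    from D(2)[OF N] obtain \<phi> where \<phi>: "\<phi> \<in> Cb_Lip"
      and le: "\<And>p::real\<times>real. \<bar>g (fst p) - \<phi> p\<bar> \<le> D * (1 + norm p) ^ m / N" by blast
    define \<psi> where "\<psi> x = \<phi> (x, 0)" for x
    have \<psi>: "\<psi> \<in> Cb_Lip" unfolding \<psi>_def[abs_def]
      by (rule Cb_Lip_compose[OF \<phi>, of _ 1]) (simp add: dist_Pair_Pair)
    have le': "\<bar>g x - \<psi> x\<bar> \<le> (1 / N) * W x" for x
      using le[of "(x, 0)"] by (simp add: \<psi>_def W_def norm_Pair)
    have 1: "\<bar>E (\<lambda>\<omega>. g (Z \<omega>)) - E (\<lambda>\<omega>. \<psi> (Z \<omega>))\<bar> \<le> (1 / N) * E (\<lambda>\<omega>. W (Z \<omega>))" if Z: "Z \<in> H" for Z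
    proof -
      have "\<bar>E (\<lambda>\<omega>. g (Z \<omega>)) - E (\<lambda>\<omega>. \<psi> (Z \<omega>))\<bar> \<le> E (\<lambda>\<omega>. (1 / N) * W (Z \<omega>))"
        by (intro expectation_abs_diff gm Z scale_mem W le' Cb_Lip_mem1[OF Z \<psi>])
      also have "\<dots> = (1 / N) * E (\<lambda>\<omega>. W (Z \<omega>))" using N by (intro pos_homogeneous W Z) auto
      finally show ?thesis .
    qed
    have 3: "E (\<lambda>\<omega>. \<psi> (X \<omega>)) = E (\<lambda>\<omega>. \<psi> (Y \<omega>))" using id \<psi> by (simp add: ident_distr_def)
    have "(1 / N) * M = (1 / N) * E (\<lambda>\<omega>. W (X \<omega>)) + (1 / N) * E (\<lambda>\<omega>. W (Y \<omega>))"
      by (simp add: M_def distrib_left)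
    with 1[OF XY(1)] 1[OF XY(2)] 3 show ?thesis by simp
  qed
  then show ?thesis by (rule eq_of_abs_diff_le_divide)
qed

end

section \<open>The means vanish\<close>

text \<open>Convexity puts every left difference quotient at 0 below every right one, so the infimum
  of the right ones is a subgradient.\<close>

lemma convex_on_subgradient_at_0:
  fixes h :: "real \<Rightarrow> real"
  assumes "convex_on UNIV h"
  obtains d where "\<And>x. h 0 + d * x \<le> h x"
proof -
  have slope: "(h 0 - h (- x)) / x \<le> (h y - h 0) / y" if "0 < x" "0 < y" for x y
  proof -
    have "h ((1 - x / (x + y)) *\<^sub>R (- x) + (x / (x + y)) *\<^sub>R y) \<le> (1 - x / (x + y)) * h (- x) + (x / (x + y)) * h y"
      using that by (intro convex_onD[OF assms]) auto
    moreover have "(1 - x / (x + y)) *\<^sub>R (- x) + (x / (x + y)) *\<^sub>R y = 0"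
      using that by (simp add: field_simps)
    moreover have "1 - x / (x + y) = y / (x + y)" using that by (simp add: field_simps)
    ultimately have "h 0 \<le> (y * h (- x) + x * h y) / (x + y)"
      by (simp add: add_divide_distrib)
    then have "h 0 * (x + y) \<le> y * h (- x) + x * h y"
      using that by (simp add: pos_le_divide_eq)
    then show ?thesis using that by (simp add: field_simps)
  qed
  define d where "d = (INF y\<in>{0<..}. (h y - h 0) / y)"
  have bdd: "bdd_below ((\<lambda>y. (h y - h 0) / y) ` {0<..})"
    using slope[of 1] by (intro bdd_belowI2[of _ "(h 0 - h (-1)) / 1"]) auto
  show ?thesis
  proof (rule that)
    fix x :: real
    consider "x = 0" | "0 < x" | "x < 0" by linarith
    then show "h 0 + d * x \<le> h x"
    proof cases
      case 2
      then have "d \<le> (h x - h 0) / x" unfolding d_def by (intro cINF_lower bdd) auto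
      with 2 show ?thesis by (simp add: field_simps)
    next
      case 3
      have "(h 0 - h x) / (- x) \<le> d" unfolding d_def
        using slope[of "- x"] 3 by (intro cINF_greatest) auto
      with 3 show ?thesis by (simp add: field_simps)
    qed simp
  qed
qed

context sublinear_expectation_space
begin

lemma nondegenerate_second_moment_pos: "nondegenerate E X \<Longrightarrow> 0 < E (\<lambda>\<omega>. (X \<omega>)\<^sup>2)"
  unfolding nondegenerate_def using zero_le_power2[of "E (\<lambda>\<omega>. \<bar>X \<omega>\<bar>)"] by linarith

lemmas poly_lipschitz_intros = poly_lipschitz_const poly_lipschitz_fst poly_lipschitz_snd
  poly_lipschitz_add poly_lipschitz_mult poly_lipschitz_diff poly_lipschitz_power poly_lipschitz_minus

lemma expectation_linear_indep:
  assumes ind: "indep_of E Y X" and XY: "X \<in> H" "Y \<in> H" and "0 \<le> k"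
  shows "E (\<lambda>\<omega>. l * X \<omega> + k * Y \<omega>) = E (\<lambda>\<omega>. l * X \<omega>) + k * E Y"
proof -
  have "poly_lipschitz (\<lambda>p::real \<times> real. l * fst p + k * snd p)" by (intro poly_lipschitz_intros)
  from indep_of_poly_lipschitz[OF ind XY this]
  have "E (\<lambda>\<omega>. l * X \<omega> + k * Y \<omega>) = E (\<lambda>\<omega>. E (\<lambda>\<omega>'. l * X \<omega> + k * Y \<omega>'))" by simp
  moreover have "E (\<lambda>\<omega>'. l * X \<omega> + k * Y \<omega>') = l * X \<omega> + k * E Y" for \<omega>
    using expectation_add_const[OF scale_mem[OF XY(2)], of k "l * X \<omega>"] pos_homogeneous[OF XY(2) assms(4)]
    by (simp add: add.commute)
  moreover have "E (\<lambda>\<omega>. l * X \<omega> + k * E Y) = E (\<lambda>\<omega>. l * X \<omega>) + k * E Y"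
    by (intro expectation_add_const scale_mem XY)
  ultimately show ?thesis by simp
qed

lemma indep_of_expectation_le:
  fixes g :: "real \<times> real \<Rightarrow> real"
  assumes ind: "indep_of E Y X" and XY: "X \<in> H" "Y \<in> H" and g: "poly_lipschitz g"
    and le: "\<And>x. E (\<lambda>\<omega>. g (x, Y \<omega>)) \<le> c"
  shows "E (\<lambda>\<omega>. g (X \<omega>, Y \<omega>)) \<le> c"
proof -
  have "E (\<lambda>\<omega>. E (\<lambda>\<omega>'. g (X \<omega>, Y \<omega>'))) \<le> E (\<lambda>_. c)"
    by (intro monotone const_mem le poly_lipschitz_mem1[OF poly_lipschitz_inner[OF g XY(2)] XY(1)])
  then show ?thesis by (simp add: const indep_of_poly_lipschitz[OF ind XY g])
qed

text \<open>If \<open>E Y \<noteq> 0\<close>, then the first moments force \<open>f l = f 0 - c * l\<close> with \<open>c = E X / E Y\<close>. When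
  \<open>c = 0\<close>, Jensen's inequality makes the second moment grow with \<open>l\<close>. When \<open>c \<noteq> 0\<close>, the second
  moment is both constant and convex along the line \<open>f 0 * Y + l * (X - c * Y)\<close>, so it would have to be
  attained where \<open>Y = X / c\<close>; as \<open>Y\<close> is independent of \<open>X\<close>, this contradicts the
  non-degeneracy of \<open>Y\<close>.\<close>

lemma mean_zero_of_ident_distr:
  assumes XY: "X \<in> H" "Y \<in> H" and ind: "indep_of E Y X"
    and nX: "nondegenerate E X" and nY: "nondegenerate E Y"
    and e: "0 < e" and f0: "0 < f 0" and f: "\<And>l. 0 \<le> l \<Longrightarrow> l \<le> e \<Longrightarrow> 0 \<le> f l"
    and id: "\<And>l. 0 \<le> l \<Longrightarrow> l \<le> e \<Longrightarrow> ident_distr E (\<lambda>\<omega>. l * X \<omega> + f l * Y \<omega>) E (\<lambda>\<omega>. f 0 * Y \<omega>)"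
  shows "E Y = 0"
proof (rule ccontr)
  assume EY: "E Y \<noteq> 0"
  let ?Z = "\<lambda>l \<omega>. l * X \<omega> + f l * Y \<omega>"
  have Z: "?Z l \<in> H" "(\<lambda>\<omega>. f 0 * Y \<omega>) \<in> H" for l by (intro add_mem scale_mem XY)+
  define s2 where "s2 = E (\<lambda>\<omega>. (Y \<omega>)\<^sup>2)"
  define m where "m = E (\<lambda>\<omega>. \<bar>Y \<omega>\<bar>)"
  have ms: "m\<^sup>2 < s2" using nY by (simp add: nondegenerate_def m_def s2_def)
  have first: "l * E X + f l * E Y = f 0 * E Y" if "0 \<le> l" "l \<le> e" for l
  proof -
    have "E (?Z l) = E (\<lambda>\<omega>. f 0 * Y \<omega>)"
      using ident_distr_poly_lipschitz[OF id[OF that] Z poly_lipschitz_id] .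
    then show ?thesis
      using expectation_linear_indep[OF ind XY f[OF that], of l] pos_homogeneous[OF XY(1) that(1)]
        pos_homogeneous[OF XY(2), of "f 0"] f0 by simp
  qed
  have second: "E (\<lambda>\<omega>. (?Z l \<omega>)\<^sup>2) = (f 0)\<^sup>2 * s2" if "0 \<le> l" "l \<le> e" for l
  proof -
    have "E (\<lambda>\<omega>. (?Z l \<omega>)\<^sup>2) = E (\<lambda>\<omega>. (f 0 * Y \<omega>)\<^sup>2)"
      using ident_distr_poly_lipschitz[OF id[OF that] Z poly_lipschitz_power[OF poly_lipschitz_id]] .
    also have "\<dots> = (f 0)\<^sup>2 * s2"
      using pos_homogeneous[OF square_mem[OF XY(2)], of "(f 0)\<^sup>2"] by (simp add: s2_def power_mult_distrib)
    finally show ?thesis .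
  qed
  define c where "c = E X / E Y"
  have fl: "f l = f 0 - c * l" if "0 \<le> l" "l \<le> e" for l
    using first[OF that] EY by (simp add: c_def field_simps)
  show False
  proof (cases "c = 0")
    case True
    then have EX: "E X = 0" using EY by (simp add: c_def)
    have fe: "f e = f 0" using fl[of e] e True by simp
    have "E (\<lambda>\<omega>. - ?Z e \<omega>) = E (\<lambda>\<omega>. - (f 0 * Y \<omega>))"
      using ident_distr_poly_lipschitz[OF id[of e] Z poly_lipschitz_minus[OF poly_lipschitz_id]] e by simp
    moreover have "E (\<lambda>\<omega>. e * - X \<omega> + f 0 * - Y \<omega>) = E (\<lambda>\<omega>. e * - X \<omega>) + f 0 * E (\<lambda>\<omega>. - Y \<omega>)"
      using f0 by (intro expectation_linear_indep indep_of_minus ind minus_mem XY) simp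
    moreover have "E (\<lambda>\<omega>. e * - X \<omega>) = e * E (\<lambda>\<omega>. - X \<omega>)"
      using e by (intro pos_homogeneous minus_mem XY) simp
    moreover have "E (\<lambda>\<omega>. - (f 0 * Y \<omega>)) = f 0 * E (\<lambda>\<omega>. - Y \<omega>)"
      using pos_homogeneous[OF minus_mem[OF XY(2)], of "f 0"] f0 by simp
    ultimately have EnX: "E (\<lambda>\<omega>. - X \<omega>) = 0" using e by (simp add: fe algebra_simps)
    \<comment> \<open>The second moment of e x + f(0) Y without its deterministic part (e x)^2. It
      is convex in x and lies above a line h(0) + d x. The term d X drops out, so the second moment
      at l = e exceeds h(0) by at least e^2 E[X^2] > 0.\<close>
    define h where "h x = E (\<lambda>\<omega>. (f 0 * Y \<omega>)\<^sup>2 + x * (2 * e * f 0 * Y \<omega>))" for x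
    have hm: "(\<lambda>\<omega>. (f 0 * Y \<omega>)\<^sup>2 + x * (2 * e * f 0 * Y \<omega>)) \<in> H" for x
      by (intro mem_intros square_mem XY)
    have "convex_on UNIV h"
    proof (rule convex_onI)
      fix t x y :: real assume t: "0 < t" "t < 1"
      have "h ((1 - t) *\<^sub>R x + t *\<^sub>R y) = E (\<lambda>\<omega>. (1 - t) * ((f 0 * Y \<omega>)\<^sup>2 + x * (2 * e * f 0 * Y \<omega>))
          + t * ((f 0 * Y \<omega>)\<^sup>2 + y * (2 * e * f 0 * Y \<omega>)))"
        unfolding h_def by (rule arg_cong[of _ _ E]) (auto simp: algebra_simps)
      also have "\<dots> \<le> E (\<lambda>\<omega>. (1 - t) * ((f 0 * Y \<omega>)\<^sup>2 + x * (2 * e * f 0 * Y \<omega>)))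
          + E (\<lambda>\<omega>. t * ((f 0 * Y \<omega>)\<^sup>2 + y * (2 * e * f 0 * Y \<omega>)))"
        by (intro subadditive scale_mem hm)
      also have "\<dots> = (1 - t) * h x + t * h y"
        using t pos_homogeneous[OF hm] by (simp add: h_def)
      finally show "h ((1 - t) *\<^sub>R x + t *\<^sub>R y) \<le> (1 - t) * h x + t * h y" .
    qed auto
    then obtain d where d: "\<And>x. h 0 + d * x \<le> h x" by (rule convex_on_subgradient_at_0) blast
    have h0: "h 0 = (f 0)\<^sup>2 * s2"
      using pos_homogeneous[OF square_mem[OF XY(2)], of "(f 0)\<^sup>2"]
      by (simp add: h_def s2_def power_mult_distrib)
    have pl: "poly_lipschitz (\<lambda>p::real \<times> real. (e * fst p + f 0 * snd p)\<^sup>2)" by (intro poly_lipschitz_intros)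
    have inner: "E (\<lambda>\<omega>. (e * x + f 0 * Y \<omega>)\<^sup>2) = h x + (e * x)\<^sup>2" for x
    proof -
      have "(\<lambda>\<omega>. (e * x + f 0 * Y \<omega>)\<^sup>2) = (\<lambda>\<omega>. ((f 0 * Y \<omega>)\<^sup>2 + x * (2 * e * f 0 * Y \<omega>)) + (e * x)\<^sup>2)"
        by (auto simp: power2_eq_square algebra_simps)
      then show ?thesis using expectation_add_const[OF hm] by (simp add: h_def)
    qed
    have "e\<^sup>2 * E (\<lambda>\<omega>. (X \<omega>)\<^sup>2) + h 0 = E (\<lambda>\<omega>. e\<^sup>2 * (X \<omega>)\<^sup>2 + h 0)"
      using expectation_add_const[OF scale_mem[OF square_mem[OF XY(1)]]]
        pos_homogeneous[OF square_mem[OF XY(1)], of "e\<^sup>2"] by simp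
    also have "\<dots> = E (\<lambda>\<omega>. (e\<^sup>2 * (X \<omega>)\<^sup>2 + h 0) + d * X \<omega>)"
      by (rule sym, intro expectation_add_certain mem_intros square_mem XY EX EnX)
    also have "\<dots> \<le> E (\<lambda>\<omega>. E (\<lambda>\<omega>'. (e * X \<omega> + f 0 * Y \<omega>')\<^sup>2))"
    proof (intro monotone)
      show "(\<lambda>\<omega>. E (\<lambda>\<omega>'. (e * X \<omega> + f 0 * Y \<omega>')\<^sup>2)) \<in> H"
        using poly_lipschitz_mem1[OF poly_lipschitz_inner[OF pl XY(2)] XY(1)] by simp
      show "e\<^sup>2 * (X \<omega>)\<^sup>2 + h 0 + d * X \<omega> \<le> E (\<lambda>\<omega>'. (e * X \<omega> + f 0 * Y \<omega>')\<^sup>2)" for \<omega>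
        using d[of "X \<omega>"] by (simp add: inner power_mult_distrib)
    qed (intro mem_intros square_mem XY)
    also have "\<dots> = E (\<lambda>\<omega>. (e * X \<omega> + f 0 * Y \<omega>)\<^sup>2)"
      using indep_of_poly_lipschitz[OF ind XY pl] by simp
    also have "\<dots> = h 0" using second[of e] e by (simp add: fe h0)
    finally show False using nondegenerate_second_moment_pos[OF nX] e
      by (simp add: mult_le_0_iff)
  next
    case False
    \<comment> \<open>The bound e^2 / 4 keeps r below the coefficient e^2 / 2 in the midpoint
      identity for the squares at 0, e / 2 and e. The other bound makes the coefficient (f 0)^2 - r
      c^2 of Y^2 non-negative, as positive homogeneity requires.\<close>
    define r where "r = min (e\<^sup>2 / 4) ((f 0)\<^sup>2 / c\<^sup>2)"
    have r: "0 < r" "r \<le> e\<^sup>2 / 4" "r * c\<^sup>2 \<le> (f 0)\<^sup>2"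
      using e f0 False by (auto simp: r_def min_def field_simps)
    let ?g = "\<lambda>p::real \<times> real. (f 0 * snd p)\<^sup>2 - r * (fst p - c * snd p)\<^sup>2"
    have g: "poly_lipschitz ?g" by (intro poly_lipschitz_intros)
    have lower: "(f 0)\<^sup>2 * s2 \<le> E (\<lambda>\<omega>. ?g (X \<omega>, Y \<omega>))"
    proof -
      have gm: "(\<lambda>\<omega>. ?g (X \<omega>, Y \<omega>)) \<in> H" using g XY by (rule poly_lipschitz_mem)
      have "(f 0)\<^sup>2 * s2 = E (\<lambda>\<omega>. (?Z (e / 2) \<omega>)\<^sup>2)" using second[of "e / 2"] e by simp
      also have "\<dots> \<le> E (\<lambda>\<omega>. (1/2) * ?g (X \<omega>, Y \<omega>) + (1/2) * (?Z e \<omega>)\<^sup>2)"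
      proof (intro monotone)
        fix \<omega>
        have fe: "f e = f 0 - c * e" "f (e / 2) = f 0 - c * (e / 2)" using fl[of e] fl[of "e/2"] e by auto
        have "(?Z (e / 2) \<omega>)\<^sup>2 = (1/2) * ((f 0 * Y \<omega>)\<^sup>2 - (e\<^sup>2 / 2) * (X \<omega> - c * Y \<omega>)\<^sup>2) + (1/2) * (?Z e \<omega>)\<^sup>2"
          unfolding fe by (simp add: power2_eq_square field_simps)
        moreover have "r * (X \<omega> - c * Y \<omega>)\<^sup>2 \<le> (e\<^sup>2 / 2) * (X \<omega> - c * Y \<omega>)\<^sup>2"
          using r by (intro mult_right_mono) auto
        ultimately show "(?Z (e / 2) \<omega>)\<^sup>2 \<le> (1/2) * ?g (X \<omega>, Y \<omega>) + (1/2) * (?Z e \<omega>)\<^sup>2"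
          by simp
      qed (intro mem_intros square_mem Z gm XY)+
      also have "\<dots> \<le> E (\<lambda>\<omega>. (1/2) * ?g (X \<omega>, Y \<omega>)) + E (\<lambda>\<omega>. (1/2) * (?Z e \<omega>)\<^sup>2)"
        by (intro subadditive scale_mem gm square_mem Z)
      also have "\<dots> = (1/2) * E (\<lambda>\<omega>. ?g (X \<omega>, Y \<omega>)) + (1/2) * E (\<lambda>\<omega>. (?Z e \<omega>)\<^sup>2)"
        by (intro arg_cong2[of _ _ _ _ plus] pos_homogeneous gm square_mem Z) auto
      finally show ?thesis using second[of e] e by simp
    qed
    have "E (\<lambda>\<omega>. ?g (X \<omega>, Y \<omega>)) \<le> (f 0)\<^sup>2 * s2 - r * c\<^sup>2 * (s2 - m\<^sup>2)"
    proof (rule indep_of_expectation_le[OF ind XY g])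
      fix x
      let ?A = "(f 0)\<^sup>2 - r * c\<^sup>2" and ?B = "2 * r * \<bar>x\<bar> * \<bar>c\<bar>"
      have "E (\<lambda>\<omega>. ?g (x, Y \<omega>)) \<le> E (\<lambda>\<omega>. (?A * (Y \<omega>)\<^sup>2 + ?B * \<bar>Y \<omega>\<bar>) + (- r * x\<^sup>2))"
      proof (intro monotone)
        show "(\<lambda>\<omega>. ?g (x, Y \<omega>)) \<in> H" by (rule poly_lipschitz_mem[OF g const_mem XY(2)])
        fix \<omega>
        have "x * (c * Y \<omega>) \<le> \<bar>x\<bar> * \<bar>c\<bar> * \<bar>Y \<omega>\<bar>"
          by (metis abs_ge_self abs_mult mult.assoc)
        then have "r * (x * (c * Y \<omega>)) \<le> r * (\<bar>x\<bar> * \<bar>c\<bar> * \<bar>Y \<omega>\<bar>)" using r by (intro mult_left_mono) auto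
        then show "?g (x, Y \<omega>) \<le> (?A * (Y \<omega>)\<^sup>2 + ?B * \<bar>Y \<omega>\<bar>) + (- r * x\<^sup>2)"
          by (simp add: power2_eq_square algebra_simps)
      qed (intro mem_intros square_mem XY)
      also have "\<dots> = E (\<lambda>\<omega>. ?A * (Y \<omega>)\<^sup>2 + ?B * \<bar>Y \<omega>\<bar>) + (- r * x\<^sup>2)"
        by (intro expectation_add_const mem_intros square_mem XY)
      also have "E (\<lambda>\<omega>. ?A * (Y \<omega>)\<^sup>2 + ?B * \<bar>Y \<omega>\<bar>) \<le> E (\<lambda>\<omega>. ?A * (Y \<omega>)\<^sup>2) + E (\<lambda>\<omega>. ?B * \<bar>Y \<omega>\<bar>)"
        by (intro subadditive mem_intros square_mem XY)
      also have "E (\<lambda>\<omega>. ?A * (Y \<omega>)\<^sup>2) = ?A * s2"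
        unfolding s2_def using r by (intro pos_homogeneous square_mem XY) auto
      also have "E (\<lambda>\<omega>. ?B * \<bar>Y \<omega>\<bar>) = ?B * m"
        unfolding m_def using r by (intro pos_homogeneous abs_mem XY) auto
      \<comment> \<open>Completing the square: even in the most favourable case |x| = |c| m the
        amount r c^2 (s2 - m^2) is lost, and it is positive because \<open>Y\<close> is
        non-degenerate.\<close>
      also have "?A * s2 + ?B * m + (- r * x\<^sup>2) = (f 0)\<^sup>2 * s2 - r * c\<^sup>2 * (s2 - m\<^sup>2) - r * (\<bar>x\<bar> - \<bar>c\<bar> * m)\<^sup>2"
        by (simp add: power2_eq_square algebra_simps flip: abs_mult)
      also have "\<dots> \<le> (f 0)\<^sup>2 * s2 - r * c\<^sup>2 * (s2 - m\<^sup>2)" using r by simp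
      finally show "E (\<lambda>\<omega>. ?g (x, Y \<omega>)) \<le> (f 0)\<^sup>2 * s2 - r * c\<^sup>2 * (s2 - m\<^sup>2)" by simp
    qed
    moreover have "0 < r * c\<^sup>2 * (s2 - m\<^sup>2)" using r False ms by simp
    ultimately show False using lower by linarith
  qed
qed

end

section \<open>The transition operators\<close>

context sublinear_expectation_space
begin

text \<open>One definition covers both families of operators, for \<open>Y\<close> with r = sqrt t
  and for \<open>X\<close> with any r; hence the parameter is a scale and not a time.\<close>

definition transition :: "('a \<Rightarrow> real) \<Rightarrow> real \<Rightarrow> (real \<Rightarrow> real) \<Rightarrow> real \<Rightarrow> real" where
  "transition Y r \<phi> x = E (\<lambda>\<omega>. \<phi> (x + r * Y \<omega>))"

lemma transition_mem: "Y \<in> H \<Longrightarrow> \<phi> \<in> Cb_Lip \<Longrightarrow> (\<lambda>\<omega>. \<phi> (x + r * Y \<omega>)) \<in> H"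
  by (rule Cb_Lip_mem1) (intro mem_intros)

lemma transition_Cb_Lip [intro]: "Y \<in> H \<Longrightarrow> \<phi> \<in> Cb_Lip \<Longrightarrow> transition Y r \<phi> \<in> Cb_Lip"
  using inner_Cb_Lip[of Y \<phi> 1 r] by (simp add: transition_def[abs_def])

lemma transition_diff_le:
  "Y \<in> H \<Longrightarrow> \<phi> \<in> Cb_Lip \<Longrightarrow> \<psi> \<in> Cb_Lip \<Longrightarrow> (\<And>x. \<bar>\<phi> x - \<psi> x\<bar> \<le> c) \<Longrightarrow>
    \<bar>transition Y r \<phi> x - transition Y r \<psi> x\<bar> \<le> c"
  unfolding transition_def by (intro expectation_diff_le transition_mem)

lemma transition_mono:
  "Y \<in> H \<Longrightarrow> \<phi> \<in> Cb_Lip \<Longrightarrow> \<psi> \<in> Cb_Lip \<Longrightarrow> (\<And>x. \<phi> x \<le> \<psi> x) \<Longrightarrow>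
    transition Y r \<phi> x \<le> transition Y r \<psi> x"
  unfolding transition_def by (intro monotone transition_mem)

lemma transition_add_const:
  "Y \<in> H \<Longrightarrow> \<phi> \<in> Cb_Lip \<Longrightarrow> transition Y r (\<lambda>x. \<phi> x + c) x = transition Y r \<phi> x + c"
  unfolding transition_def by (intro expectation_add_const transition_mem)

lemma transition_zero [simp]: "transition Y 0 \<phi> = \<phi>"
  by (auto simp: transition_def const)

lemma transition_step_diff_le:
  assumes "Y \<in> H" "\<phi> \<in> Cb_Lip" "\<And>x y. \<bar>\<phi> x - \<phi> y\<bar> \<le> L * \<bar>x - y\<bar>" "0 \<le> L"
  shows "\<bar>transition Y r \<phi> x - transition Y s \<phi> x\<bar> \<le> L * \<bar>r - s\<bar> * E (\<lambda>\<omega>. \<bar>Y \<omega>\<bar>)"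
proof -
  have "\<bar>transition Y r \<phi> x - transition Y s \<phi> x\<bar> \<le> E (\<lambda>\<omega>. (L * \<bar>r - s\<bar>) * \<bar>Y \<omega>\<bar>)"
    unfolding transition_def
  proof (intro expectation_abs_diff transition_mem assms mem_intros)
    show "\<bar>\<phi> (x + r * Y \<omega>) - \<phi> (x + s * Y \<omega>)\<bar> \<le> L * \<bar>r - s\<bar> * \<bar>Y \<omega>\<bar>" for \<omega>
      using assms(3)[of "x + r * Y \<omega>" "x + s * Y \<omega>"]
      by (simp add: mult.assoc flip: abs_mult left_diff_distrib)
  qed
  also have "\<dots> = L * \<bar>r - s\<bar> * E (\<lambda>\<omega>. \<bar>Y \<omega>\<bar>)"
    using assms(4) by (intro pos_homogeneous abs_mem assms) auto
  finally show ?thesis .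
qed

lemma Cb_Lip_shift: "\<phi> \<in> Cb_Lip \<Longrightarrow> (\<lambda>x. \<phi> (c + s * x)) \<in> Cb_Lip" for \<phi> :: "real \<Rightarrow> real"
  by (rule Cb_Lip_compose[where K = "\<bar>s\<bar>"]) (auto simp: dist_real_def simp flip: abs_mult right_diff_distrib)

lemma transition_ident_distr:
  assumes "ident_distr E X E Y" "\<phi> \<in> Cb_Lip"
  shows "transition X r \<phi> x = transition Y r \<phi> x"
  using assms(1) Cb_Lip_shift[OF assms(2), of x r] by (auto simp: ident_distr_def transition_def)

text \<open>Independence integrates \<open>Y\<close> first, with \<open>X\<close> frozen, so the
  operator of \<open>X\<close> is the outer one. The relation is not symmetric, which forces this
  order.\<close>

lemma transition_indep:
  assumes "indep_of E Y X" "\<phi> \<in> Cb_Lip"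
  shows "transition X r (transition Y s \<phi>) x = E (\<lambda>\<omega>. \<phi> (x + (r * X \<omega> + s * Y \<omega>)))"
proof -
  have "(\<lambda>u. \<phi> (x + u)) \<in> Cb_Lip" using Cb_Lip_shift[OF assms(2), of x 1] by simp
  from Cb_Lip_linear[OF this, of r s] assms(1) show ?thesis
    by (fastforce simp: indep_of_def transition_def add.assoc)
qed

lemma transition_funpow_Cb_Lip:
  "Y \<in> H \<Longrightarrow> \<phi> \<in> Cb_Lip \<Longrightarrow> (transition Y r ^^ n) \<phi> \<in> Cb_Lip"
  by (induction n) auto

lemma transition_funpow_diff_le:
  assumes "Y \<in> H" "\<phi> \<in> Cb_Lip" "\<psi> \<in> Cb_Lip" "\<And>x. \<bar>\<phi> x - \<psi> x\<bar> \<le> c"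
  shows "\<bar>(transition Y r ^^ n) \<phi> x - (transition Y r ^^ n) \<psi> x\<bar> \<le> c"
proof (induction n arbitrary: x)
  case (Suc n)
  then show ?case by (auto intro!: transition_diff_le transition_funpow_Cb_Lip assms)
qed (use assms in auto)

text \<open>Iterating the hypothesis gives \<open>T\<^bsub>t + s\<^esub> = Q\<^sup>n T\<^sub>t\<close>, where \<open>T\<^sub>t\<close> averages over \<open>sqrt t * Y\<close> and \<open>Q\<close>
  is one small step of \<open>X\<close> with \<open>n\<close> steps of total variance \<open>s\<close>. Applying this to \<open>\<phi>\<close> and, with an initial time that tends to
  \<open>0\<close>, to \<open>T\<^sub>t \<phi>\<close> identifies \<open>T\<^bsub>t + s\<^esub> \<phi>\<close> with \<open>T\<^sub>s (T\<^sub>t \<phi>)\<close>.\<close>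

lemma transition_semigroup:
  assumes XY: "X \<in> H" "Y \<in> H" and b: "0 < b" and e: "0 < e"
    and step: "\<And>\<phi> t r x. \<phi> \<in> Cb_Lip \<Longrightarrow> 0 < t \<Longrightarrow> 0 \<le> r \<Longrightarrow> r\<^sup>2 \<le> e * t \<Longrightarrow>
      transition X r (transition Y (sqrt t) \<phi>) x = transition Y (sqrt (t + b * r\<^sup>2)) \<phi> x"
    and \<phi>: "\<phi> \<in> Cb_Lip" and st: "0 \<le> s" "0 \<le> t"
  shows "transition Y (sqrt s) (transition Y (sqrt t) \<phi>) x = transition Y (sqrt (s + t)) \<phi> x"
proof (cases "s = 0 \<or> t = 0")
  case False
  then have s: "0 < s" and t: "0 < t" using st by auto
  have iter: "(transition X r ^^ n) (transition Y (sqrt t) \<phi>) x = transition Y (sqrt (t + real n * (b * r\<^sup>2))) \<phi> x"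
    if "\<phi> \<in> Cb_Lip" "0 < t" "0 \<le> r" "r\<^sup>2 \<le> e * t" for \<phi> t r n x
  proof (induction n arbitrary: x)
    case (Suc n)
    have "0 < t + real n * (b * r\<^sup>2)" using that b by (simp add: add_pos_nonneg)
    moreover have "e * t \<le> e * (t + real n * (b * r\<^sup>2))" using e b by (intro mult_left_mono) auto
    ultimately have "transition X r (transition Y (sqrt (t + real n * (b * r\<^sup>2))) \<phi>) x
        = transition Y (sqrt (t + real n * (b * r\<^sup>2) + b * r\<^sup>2)) \<phi> x"
      using that by (intro step) auto
    moreover have "(transition X r ^^ n) (transition Y (sqrt t) \<phi>) = transition Y (sqrt (t + real n * (b * r\<^sup>2))) \<phi>"
      using Suc by blast
    ultimately show ?case by (simp add: algebra_simps)
  qed simp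
  define \<psi> where "\<psi> = transition Y (sqrt t) \<phi>"
  have \<psi>: "\<psi> \<in> Cb_Lip" unfolding \<psi>_def by (intro transition_Cb_Lip XY \<phi>)
  then obtain L where L: "\<And>x y. \<bar>\<psi> x - \<psi> y\<bar> \<le> L * \<bar>x - y\<bar>" "0 \<le> L"
    by (rule Cb_LipE) (auto simp: dist_real_def)
  define M where "M = E (\<lambda>\<omega>. \<bar>Y \<omega>\<bar>)"
  have M: "0 \<le> M" unfolding M_def by (intro expectation_nonneg abs_mem XY) auto
  let ?D = "\<bar>transition Y (sqrt (s + t)) \<phi> x - transition Y (sqrt s) \<psi> x\<bar>"
  have bound: "?D \<le> 2 * L * M * sqrt (s / (b * e) / real n)"
    if n: "0 < n" "s / (b * e * t) \<le> real n" for n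
  proof -
    \<comment> \<open>In units of the variance of \<open>Y\<close>, n steps of \<open>X\<close> with
      b r^2 = s / n add up to s. The initial time u is the least one from which such a step is
      permitted, e u = r^2; the lower bound on n permits the same steps from time t.\<close>
    define r where "r = sqrt (s / real n / b)"
    define u where "u = s / (b * e) / real n"
    have u: "0 < u" using s b e n by (simp add: u_def)
    have r: "0 \<le> r" "r\<^sup>2 = s / real n / b" using s b by (auto simp: r_def)
    have br: "real n * (b * r\<^sup>2) = s" using n b by (simp add: r)
    have rt: "r\<^sup>2 \<le> e * t" using n s t b e by (simp add: r field_simps)
    have ru: "r\<^sup>2 \<le> e * u" using e b n by (simp add: r u_def mult.commute)
    have 1: "(transition X r ^^ n) \<psi> x = transition Y (sqrt (s + t)) \<phi> x"
      unfolding \<psi>_def using iter[OF \<phi> t r(1) rt, of n] by (simp add: br add.commute)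
    have 2: "(transition X r ^^ n) (transition Y (sqrt u) \<psi>) x = transition Y (sqrt (u + s)) \<psi> x"
      using iter[OF \<psi> u r(1) ru, of n] by (simp add: br)
    \<comment> \<open>The first of two errors of size L M sqrt u: \<psi> is replaced by its
      smoothing. It does not grow under iteration, since the operators contract the sup norm. The
      second error comes from replacing time u + s by s.\<close>
    have "\<bar>\<psi> z - transition Y (sqrt u) \<psi> z\<bar> \<le> L * sqrt u * M" for z
      using transition_step_diff_le[OF XY(2) \<psi> L, of 0 z "sqrt u"] u by (simp add: M_def)
    then have "\<bar>(transition X r ^^ n) \<psi> x - (transition X r ^^ n) (transition Y (sqrt u) \<psi>) x\<bar> \<le> L * sqrt u * M"
      by (intro transition_funpow_diff_le XY \<psi> transition_Cb_Lip)
    then have 3: "\<bar>transition Y (sqrt (s + t)) \<phi> x - transition Y (sqrt (u + s)) \<psi> x\<bar> \<le> L * sqrt u * M"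
      by (simp add: 1 2)
    have "\<bar>sqrt (u + s) - sqrt s\<bar> \<le> sqrt u"
      using sqrt_add_le_add_sqrt[of u s] u s by simp
    then have "L * \<bar>sqrt (u + s) - sqrt s\<bar> * M \<le> L * sqrt u * M"
      using L M by (intro mult_right_mono mult_left_mono) auto
    then have "\<bar>transition Y (sqrt (u + s)) \<psi> x - transition Y (sqrt s) \<psi> x\<bar> \<le> L * sqrt u * M"
      using transition_step_diff_le[OF XY(2) \<psi> L, of "sqrt (u + s)" x "sqrt s"] by (simp add: M_def)
    moreover have "2 * L * M * sqrt u = L * sqrt u * M + L * sqrt u * M" by (simp add: algebra_simps)
    ultimately show ?thesis using 3 unfolding u_def[symmetric] by linarith
  qed
  have "?D \<le> 0"
  proof (rule LIMSEQ_le_const)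
    have "(\<lambda>n. 2 * L * M * sqrt (s / (b * e) / real n)) \<longlonglongrightarrow> 2 * L * M * sqrt 0"
      by (intro tendsto_intros lim_const_over_n)
    then show "(\<lambda>n. 2 * L * M * sqrt (s / (b * e) / real n)) \<longlonglongrightarrow> 0" by simp
    obtain N :: nat where N: "s / (b * e * t) \<le> real N" using real_arch_simple by blast
    then show "\<exists>N. \<forall>n\<ge>N. ?D \<le> 2 * L * M * sqrt (s / (b * e) / real n)"
    proof (intro exI allI impI)
      fix n assume "Suc N \<le> n"
      then show "?D \<le> 2 * L * M * sqrt (s / (b * e) / real n)"
        by (intro bound order_trans[OF N]) auto
    qed
  qed
  then show ?thesis by (simp add: \<psi>_def)
qed auto

text \<open>On \<open>real \<times> real\<close> the iterated expectation \<open>E E F(Z, Z')\<close> makes the second coordinate an independent copy of the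
  first one.\<close>

lemma G_normalI:
  assumes Z: "Z \<in> H"
    and semigroup: "\<And>\<phi> s t. \<phi> \<in> Cb_Lip \<Longrightarrow> 0 \<le> s \<Longrightarrow> 0 \<le> t \<Longrightarrow>
      transition Z (sqrt s) (transition Z (sqrt t) \<phi>) 0 = transition Z (sqrt (s + t)) \<phi> 0"
  shows "G_normal H E Z"
proof -
  define H' where "H' = {F :: real \<times> real \<Rightarrow> real. poly_lipschitz F}"
  define E' where "E' F = E (\<lambda>\<omega>. E (\<lambda>\<omega>'. F (Z \<omega>, Z \<omega>')))" for F :: "real \<times> real \<Rightarrow> real"
  have inner: "(\<lambda>\<omega>. F (x, Z \<omega>)) \<in> H" if "F \<in> H'" for F x
    using that poly_lipschitz_mem[OF _ const_mem Z] by (auto simp: H'_def)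
  have outer: "(\<lambda>\<omega>. E (\<lambda>\<omega>'. F (Z \<omega>, Z \<omega>'))) \<in> H" if "F \<in> H'" for F
    using that poly_lipschitz_mem1[OF poly_lipschitz_inner[OF _ Z] Z] by (auto simp: H'_def)
  have S: "sublinear_expectation_space H' E'"
  proof
    show "(\<lambda>p. \<phi> (X p, Y p)) \<in> H'" if "X \<in> H'" "Y \<in> H'" "\<phi> \<in> Cb_Lip" for X Y \<phi>
      using that poly_lipschitz_Cb_Lip_compose2 by (auto simp: H'_def)
    show "E' Y \<le> E' X" if "X \<in> H'" "Y \<in> H'" "\<And>p. Y p \<le> X p" for X Y
      unfolding E'_def using that by (intro monotone outer inner)
    show "E' (\<lambda>_. c) = c" for c by (simp add: E'_def const)
    show "E' (\<lambda>p. X p + Y p) \<le> E' X + E' Y" if "X \<in> H'" "Y \<in> H'" for X Y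
    proof -
      have "E' (\<lambda>p. X p + Y p) \<le> E (\<lambda>\<omega>. E (\<lambda>\<omega>'. X (Z \<omega>, Z \<omega>')) + E (\<lambda>\<omega>'. Y (Z \<omega>, Z \<omega>')))"
        unfolding E'_def
      proof (rule monotone)
        show "(\<lambda>\<omega>. E (\<lambda>\<omega>'. X (Z \<omega>, Z \<omega>') + Y (Z \<omega>, Z \<omega>'))) \<in> H"
          using outer[of "\<lambda>p. X p + Y p"] that by (auto simp: H'_def)
      qed (intro add_mem outer subadditive inner that)+
      also have "\<dots> \<le> E' X + E' Y" unfolding E'_def by (intro subadditive outer that)
      finally show ?thesis .
    qed
    show "E' (\<lambda>p. c * X p) = c * E' X" if "X \<in> H'" "0 \<le> c" for X c
      unfolding E'_def using that by (simp add: pos_homogeneous inner outer)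
  qed (auto simp: H'_def)
  have pair: "E' (\<lambda>p. \<phi> (a * fst p + b * snd p)) = transition Z a (transition Z b \<phi>) 0" for \<phi> a b
    by (simp add: E'_def transition_def)
  have "indep_copy H' E' snd fst"
    unfolding indep_copy_def
  proof (intro conjI)
    show "snd \<in> H'" by (auto simp: H'_def)
    show "ident_distr E' snd E' fst" by (simp add: ident_distr_def E'_def const)
    show "indep_of E' snd fst" by (simp add: indep_of_def E'_def const)
  qed
  moreover have "ident_distr E' fst E Z" by (simp add: ident_distr_def E'_def const)
  moreover have "ident_distr E' (\<lambda>p. a * fst p + b * snd p) E' (\<lambda>p. sqrt (a\<^sup>2 + b\<^sup>2) * fst p)"
    if "0 \<le> a" "0 \<le> b" for a b
    unfolding ident_distr_def
  proof
    fix \<phi> :: "real \<Rightarrow> real" assume "\<phi> \<in> Cb_Lip"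
    with semigroup[of \<phi> "a\<^sup>2" "b\<^sup>2"] that pair[of \<phi> a b] pair[of \<phi> "sqrt (a\<^sup>2 + b\<^sup>2)" 0]
    show "E' (\<lambda>p. \<phi> (a * fst p + b * snd p)) = E' (\<lambda>p. \<phi> (sqrt (a\<^sup>2 + b\<^sup>2) * fst p))"
      by simp
  qed
  moreover have "fst \<in> H'" by (auto simp: H'_def)
  ultimately show ?thesis unfolding G_normal_def using Z S by blast
qed

end

section \<open>Twice differentiable test functions and oscillating patterns\<close>

lemma Cb_Lip_const [intro]: "(\<lambda>_. c) \<in> Cb_Lip"
  by (rule Cb_LipI[of _ "\<bar>c\<bar>" 0]) auto

lemma Cb_Lip_add [intro]:
  assumes "\<phi> \<in> Cb_Lip" "\<psi> \<in> Cb_Lip"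
  shows "(\<lambda>x. \<phi> x + \<psi> x) \<in> Cb_Lip"
proof -
  from assms(1) obtain B L where
    1: "\<And>x. \<bar>\<phi> x\<bar> \<le> B" "\<And>x y. \<bar>\<phi> x - \<phi> y\<bar> \<le> L * dist x y" "0 \<le> L" by (rule Cb_LipE) blast
  from assms(2) obtain B' L' where
    2: "\<And>x. \<bar>\<psi> x\<bar> \<le> B'" "\<And>x y. \<bar>\<psi> x - \<psi> y\<bar> \<le> L' * dist x y" "0 \<le> L'" by (rule Cb_LipE) blast
  show ?thesis
  proof (rule Cb_LipI[of _ "B + B'" "L + L'"])
    show "\<bar>\<phi> x + \<psi> x\<bar> \<le> B + B'" for x using 1(1)[of x] 2(1)[of x] by linarith
    show "\<bar>\<phi> x + \<psi> x - (\<phi> y + \<psi> y)\<bar> \<le> (L + L') * dist x y" for x y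
      using 1(2)[of x y] 2(2)[of x y] by (simp add: distrib_right)
  qed (use 1 2 in auto)
qed

lemma Cb_Lip_mult [intro]:
  assumes "\<phi> \<in> Cb_Lip" "\<psi> \<in> Cb_Lip"
  shows "(\<lambda>x. \<phi> x * \<psi> x) \<in> Cb_Lip"
proof -
  from assms(1) obtain B L where
    1: "\<And>x. \<bar>\<phi> x\<bar> \<le> B" "\<And>x y. \<bar>\<phi> x - \<phi> y\<bar> \<le> L * dist x y" "0 \<le> L" by (rule Cb_LipE) blast
  from assms(2) obtain B' L' where
    2: "\<And>x. \<bar>\<psi> x\<bar> \<le> B'" "\<And>x y. \<bar>\<psi> x - \<psi> y\<bar> \<le> L' * dist x y" "0 \<le> L'" by (rule Cb_LipE) blast
  have B: "0 \<le> B" "0 \<le> B'" using 1(1) 2(1) abs_ge_zero order_trans by blast+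
  show ?thesis
  proof (rule Cb_LipI[of _ "B * B'" "L * B' + B * L'"])
    show "\<bar>\<phi> x * \<psi> x\<bar> \<le> B * B'" for x
      using 1(1)[of x] 2(1)[of x] B by (simp add: abs_mult mult_mono)
    fix x y
    have "\<phi> x * \<psi> x - \<phi> y * \<psi> y = (\<phi> x - \<phi> y) * \<psi> x + \<phi> y * (\<psi> x - \<psi> y)" by (simp add: algebra_simps)
    then have "\<bar>\<phi> x * \<psi> x - \<phi> y * \<psi> y\<bar> \<le> \<bar>\<phi> x - \<phi> y\<bar> * \<bar>\<psi> x\<bar> + \<bar>\<phi> y\<bar> * \<bar>\<psi> x - \<psi> y\<bar>"
      by (metis abs_mult abs_triangle_ineq)
    also have "\<dots> \<le> (L * dist x y) * B' + B * (L' * dist x y)"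
      using 1 2 B by (intro add_mono mult_mono) auto
    finally show "\<bar>\<phi> x * \<psi> x - \<phi> y * \<psi> y\<bar> \<le> (L * B' + B * L') * dist x y" by (simp add: algebra_simps)
  qed (use 1 2 B in auto)
qed

lemma Cb_Lip_cmult [intro]: "\<phi> \<in> Cb_Lip \<Longrightarrow> (\<lambda>x. c * \<phi> x) \<in> Cb_Lip"
  by (intro Cb_Lip_mult Cb_Lip_const)

lemma Cb_Lip_minus [intro]: "\<phi> \<in> Cb_Lip \<Longrightarrow> (\<lambda>x. - \<phi> x) \<in> Cb_Lip"
  using Cb_Lip_cmult[of \<phi> "-1"] by simp

lemma Cb_Lip_diff [intro]: "\<phi> \<in> Cb_Lip \<Longrightarrow> \<psi> \<in> Cb_Lip \<Longrightarrow> (\<lambda>x. \<phi> x - \<psi> x) \<in> Cb_Lip"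
  using Cb_Lip_add[OF _ Cb_Lip_minus, of \<phi> \<psi>] by simp

lemma Cb_Lip_lipschitz_compose:
  fixes h :: "real \<Rightarrow> real"
  assumes "\<phi> \<in> Cb_Lip" "\<And>x y. \<bar>h x - h y\<bar> \<le> K * \<bar>x - y\<bar>" "0 \<le> K"
  shows "(\<lambda>x. h (\<phi> x)) \<in> Cb_Lip"
proof -
  from assms(1) obtain B L where
    1: "\<And>x. \<bar>\<phi> x\<bar> \<le> B" "\<And>x y. \<bar>\<phi> x - \<phi> y\<bar> \<le> L * dist x y" "0 \<le> L" by (rule Cb_LipE) blast
  show ?thesis
  proof (rule Cb_LipI[of _ "\<bar>h 0\<bar> + K * B" "K * L"])
    show "\<bar>h (\<phi> x)\<bar> \<le> \<bar>h 0\<bar> + K * B" for x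
      using assms(2)[of "\<phi> x" 0] mult_left_mono[OF 1(1)[of x] assms(3)] by simp
    show "\<bar>h (\<phi> x) - h (\<phi> y)\<bar> \<le> K * L * dist x y" for x y
      using assms(2)[of "\<phi> x" "\<phi> y"] mult_left_mono[OF 1(2)[of x y] assms(3)] by (simp add: mult.assoc)
  qed (use 1 assms in auto)
qed

lemma lipschitz_of_deriv_bound:
  fixes g :: "real \<Rightarrow> real"
  assumes "\<And>x. (g has_real_derivative g' x) (at x)" "\<And>x. \<bar>g' x\<bar> \<le> C"
  shows "\<bar>g x - g y\<bar> \<le> C * \<bar>x - y\<bar>"
  using field_differentiable_bound[of UNIV g g' C x y] assms by auto

lemma Cb_Lip_of_deriv_bound:
  assumes "\<And>x. (g has_real_derivative g' x) (at x)" "\<And>x. \<bar>g' x\<bar> \<le> C" "\<And>x. \<bar>g x\<bar> \<le> B"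
  shows "g \<in> Cb_Lip"
proof (rule Cb_LipI)
  show "\<bar>g x - g y\<bar> \<le> C * dist x y" for x y
    using lipschitz_of_deriv_bound[OF assms(1,2)] by (simp add: dist_real_def)
qed (use assms(3) order_trans[OF abs_ge_zero assms(2)] in auto)

text \<open>The derivatives are arguments, so that test functions are assembled together with
  formulas for them. A Lipschitz second derivative yields the cubic Taylor remainder of the
  small-time expansion.\<close>

definition C2_Lip :: "(real \<Rightarrow> real) \<Rightarrow> (real \<Rightarrow> real) \<Rightarrow> (real \<Rightarrow> real) \<Rightarrow> bool" where
  "C2_Lip g g1 g2 \<longleftrightarrow> (\<forall>x. (g has_real_derivative g1 x) (at x)) \<and> (\<forall>x. (g1 has_real_derivative g2 x) (at x)) \<and>
     g \<in> Cb_Lip \<and> g1 \<in> Cb_Lip \<and> g2 \<in> Cb_Lip"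

lemma C2_Lip_add:
  "C2_Lip g g1 g2 \<Longrightarrow> C2_Lip h h1 h2 \<Longrightarrow> C2_Lip (\<lambda>x. g x + h x) (\<lambda>x. g1 x + h1 x) (\<lambda>x. g2 x + h2 x)"
  by (auto simp: C2_Lip_def intro!: DERIV_add)

lemma C2_Lip_cmult:
  "C2_Lip g g1 g2 \<Longrightarrow> C2_Lip (\<lambda>x. c * g x) (\<lambda>x. c * g1 x) (\<lambda>x. c * g2 x)"
  by (auto simp: C2_Lip_def intro!: DERIV_cmult)

lemma C2_Lip_mult:
  "C2_Lip g g1 g2 \<Longrightarrow> C2_Lip h h1 h2 \<Longrightarrow>
    C2_Lip (\<lambda>x. g x * h x) (\<lambda>x. g1 x * h x + g x * h1 x) (\<lambda>x. g2 x * h x + 2 * (g1 x * h1 x) + g x * h2 x)"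
  unfolding C2_Lip_def
  by (intro conjI allI Cb_Lip_add Cb_Lip_mult Cb_Lip_cmult; (elim conjE, assumption)?)
     (auto intro!: derivative_eq_intros simp: algebra_simps)

lemma C2_Lip_affine:
  assumes "C2_Lip g g1 g2"
  shows "C2_Lip (\<lambda>x. g (m * x + d)) (\<lambda>x. m * g1 (m * x + d)) (\<lambda>x. m\<^sup>2 * g2 (m * x + d))"
proof -
  have "((\<lambda>x. h (m * x + d)) has_real_derivative m * h' (m * x + d)) (at x)"
    if "\<And>x. (h has_real_derivative h' x) (at x)" for h h' x
  proof -
    have "((\<lambda>x. m * x + d) has_real_derivative m) (at x)" by (auto intro!: derivative_eq_intros)
    from DERIV_chain2[OF that this] show ?thesis by (simp add: mult.commute)
  qed
  from this[of g g1] this[of g1 g2, THEN DERIV_cmult, of m]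
  show ?thesis using assms Cb_Lip_compose[of _ "\<lambda>x::real. m * x + d" "\<bar>m\<bar>"]
    by (auto simp: C2_Lip_def power2_eq_square dist_real_def mult.assoc
        intro!: Cb_Lip_cmult simp flip: abs_mult right_diff_distrib)
qed

lemma Cb_Lip_cos: "cos \<in> Cb_Lip"
  by (rule Cb_Lip_of_deriv_bound[of cos "\<lambda>x. - sin x" 1 1]) (auto intro!: derivative_eq_intros)

lemma Cb_Lip_sin: "sin \<in> Cb_Lip"
  by (rule Cb_Lip_of_deriv_bound[of sin cos 1 1]) (auto intro!: derivative_eq_intros)

lemma C2_Lip_cos: "C2_Lip cos (\<lambda>x. - sin x) (\<lambda>x. - cos x)"
  unfolding C2_Lip_def using Cb_Lip_cos Cb_Lip_sin
  by (auto intro!: derivative_eq_intros Cb_Lip_minus)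

lemma C2_Lip_taylor:
  assumes "C2_Lip g g1 g2"
  obtains C where "0 \<le> C" "\<And>x y. \<bar>g (x + y) - g x - g1 x * y - g2 x * y\<^sup>2 / 2\<bar> \<le> C * \<bar>y\<bar> ^ 3"
proof -
  have d: "(g has_real_derivative g1 x) (at x)" "(g1 has_real_derivative g2 x) (at x)" for x
    using assms by (auto simp: C2_Lip_def)
  have "g2 \<in> Cb_Lip" using assms by (simp add: C2_Lip_def)
  then obtain B L where "\<And>x y. \<bar>g2 x - g2 y\<bar> \<le> L * dist x y" "0 \<le> L"
    by (rule Cb_LipE) blast
  then have L: "\<And>x y. \<bar>g2 x - g2 y\<bar> \<le> L * \<bar>x - y\<bar>" "0 \<le> L"
    by (simp_all add: dist_real_def)
  have "\<bar>g (x + y) - g x - g1 x * y - g2 x * y\<^sup>2 / 2\<bar> \<le> L * \<bar>y\<bar> ^ 3" for x y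
  proof -
    have 1: "\<bar>g1 (x + z) - g1 x - g2 x * z\<bar> \<le> L * \<bar>y\<bar> * \<bar>y\<bar>" if "\<bar>z\<bar> \<le> \<bar>y\<bar>" for z
    proof -
      have "norm ((g1 (x + z) - g2 x * z) - (g1 (x + 0) - g2 x * 0)) \<le> (L * \<bar>y\<bar>) * norm (z - 0)"
      proof (rule field_differentiable_bound[of "{- \<bar>y\<bar>..\<bar>y\<bar>}" "\<lambda>z. g1 (x + z) - g2 x * z" "\<lambda>z. g2 (x + z) - g2 x"])
        fix u :: real assume u: "u \<in> {- \<bar>y\<bar>..\<bar>y\<bar>}"
        show "((\<lambda>z. g1 (x + z) - g2 x * z) has_real_derivative g2 (x + u) - g2 x) (at u within {- \<bar>y\<bar>..\<bar>y\<bar>})"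
          by (rule has_field_derivative_at_within)
             (auto intro!: derivative_eq_intros DERIV_chain2[OF d(2)])
        have "\<bar>u\<bar> \<le> \<bar>y\<bar>" using u by auto
        then have "L * \<bar>u\<bar> \<le> L * \<bar>y\<bar>" using L(2) by (rule mult_left_mono)
        then show "norm (g2 (x + u) - g2 x) \<le> L * \<bar>y\<bar>" using L(1)[of "x + u" x] by simp
      qed (use that in auto)
      also have "\<dots> \<le> L * \<bar>y\<bar> * \<bar>y\<bar>" using that L by (auto intro!: mult_left_mono)
      finally show ?thesis by (simp add: algebra_simps)
    qed
    have "norm ((g (x + y) - g1 x * y - g2 x * y\<^sup>2 / 2) - (g (x + 0) - g1 x * 0 - g2 x * 0\<^sup>2 / 2)) \<le> (L * \<bar>y\<bar> * \<bar>y\<bar>) * norm (y - 0)"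
    proof (rule field_differentiable_bound[of "{- \<bar>y\<bar>..\<bar>y\<bar>}" "\<lambda>z. g (x + z) - g1 x * z - g2 x * z\<^sup>2 / 2"
          "\<lambda>z. g1 (x + z) - g1 x - g2 x * z"])
      fix u :: real assume u: "u \<in> {- \<bar>y\<bar>..\<bar>y\<bar>}"
      show "((\<lambda>z. g (x + z) - g1 x * z - g2 x * z\<^sup>2 / 2) has_real_derivative g1 (x + u) - g1 x - g2 x * u)
          (at u within {- \<bar>y\<bar>..\<bar>y\<bar>})"
        by (rule has_field_derivative_at_within)
           (auto intro!: derivative_eq_intros DERIV_chain2[OF d(1)])
      show "norm (g1 (x + u) - g1 x - g2 x * u) \<le> L * \<bar>y\<bar> * \<bar>y\<bar>" using 1[of u] u by auto
    qed auto
    then show ?thesis by (simp add: power3_eq_cube algebra_simps)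
  qed
  with L(2) show ?thesis by (rule that)
qed

section \<open>Periodic functions and the cell problem\<close>

lemma periodic_shift_int:
  fixes F :: "real \<Rightarrow> 'b"
  assumes "\<And>x. F (x + P) = F x"
  shows "F (x + of_int k * P) = F x"
proof -
  have *: "F (x + of_nat n * P) = F x" for n x
  proof (induction n)
    case (Suc n)
    have "F (x + of_nat (Suc n) * P) = F ((x + of_nat n * P) + P)" by (simp add: algebra_simps)
    then show ?case by (simp only: assms Suc)
  qed simp
  show ?thesis
  proof (cases "0 \<le> k")
    case True
    then show ?thesis using *[of x "nat k"] by simp
  next
    case False
    then show ?thesis using *[of "x + of_int k * P" "nat (- k)"] by (simp add: algebra_simps)
  qed
qed

lemma periodic_representative:
  fixes x y P :: real
  assumes "0 < P"
  obtains k where "x \<le> y + of_int k * P" "y + of_int k * P \<le> x + P"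
proof -
  define k where "k = - \<lfloor>(y - x) / P\<rfloor>"
  have "of_int (- k) \<le> (y - x) / P" "(y - x) / P < of_int (- k) + 1"
    unfolding k_def by (simp_all add: floor_correct)
  then have "of_int (- k) * P \<le> y - x" "y - x < (of_int (- k) + 1) * P"
    using assms by (simp_all add: pos_le_divide_eq pos_divide_less_eq)
  then show ?thesis by (intro that[of k]) (simp_all add: algebra_simps)
qed

text \<open>\<open>c\<close> is the mean of f over a period. The mean value theorem supplies a point
  where it is attained, so bounds on f pass to c without integration.\<close>

lemma periodic_antiderivative:
  fixes f :: "real \<Rightarrow> real"
  assumes cont: "\<And>x. isCont f x" and per: "\<And>x. f (x + P) = f x" and P: "0 < P"
  obtains c F \<xi> where "\<And>x. (F has_real_derivative f x - c) (at x)" "\<And>x. F (x + P) = F x" "f \<xi> = c"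
proof -
  obtain F0 where F0: "\<And>x. (F0 has_real_derivative f x) (at x)"
    using einterval_antiderivative[of "-\<infinity>" "\<infinity>" f] cont
    by (auto simp: has_real_derivative_iff_has_vector_derivative)
  define c where "c = (F0 P - F0 0) / P"
  define F where "F x = F0 x - c * x" for x
  have dF: "(F has_real_derivative f x - c) (at x)" for x
    unfolding F_def[abs_def] by (auto intro!: derivative_eq_intros F0)
  have "((\<lambda>x. F (x + P) - F x) has_real_derivative (f (x + P) - c) - (f x - c)) (at x)" for x
    by (auto intro!: derivative_eq_intros dF DERIV_chain2[OF dF])
  then have "((\<lambda>x. F (x + P) - F x) has_real_derivative 0) (at x)" for x
    using per by simp
  then have "F (x + P) - F x = F (0 + P) - F 0" for x
    using DERIV_isconst_all[of "\<lambda>x. F (x + P) - F x" x 0] by blast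
  also have "F (0 + P) - F 0 = 0" using P by (simp add: F_def c_def field_simps)
  finally have perF: "F (x + P) = F x" for x by simp
  have "\<exists>z. 0 < z \<and> z < P \<and> F P - F 0 = (P - 0) * (f z - c)"
    by (intro MVT2 P dF)
  then obtain z where "f z = c" using perF[of 0] P by auto
  with dF perF that show ?thesis by blast
qed

text \<open>Solves the cell problem \<eta>'' = f - c of homogenization. As f is non-negative, the
  primitive of f - c never falls faster than with slope c, so its oscillation is at most c P however
  large f is. This matters when f is a tall narrow bump.\<close>

lemma periodic_second_antiderivative:
  fixes f :: "real \<Rightarrow> real"
  assumes f: "f \<in> Cb_Lip" and nonneg: "\<And>x. 0 \<le> f x" and per: "\<And>x. f (x + P) = f x" and P: "0 < P"
  obtains c \<eta> \<eta>1 \<xi> where "C2_Lip \<eta> \<eta>1 (\<lambda>x. f x - c)" "\<And>x y. \<bar>\<eta>1 x - \<eta>1 y\<bar> \<le> c * P"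
    "\<And>x. \<bar>\<eta>1 x\<bar> \<le> c * P" "\<And>x. \<bar>\<eta> x\<bar> \<le> c * P\<^sup>2" "f \<xi> = c"
proof -
  from f obtain B L where BL: "\<And>x. \<bar>f x\<bar> \<le> B" "\<And>x y. \<bar>f x - f y\<bar> \<le> L * dist x y" "0 \<le> L"
    by (rule Cb_LipE) blast
  have "isCont f x" for x
  proof -
    have "continuous_on UNIV f"
      using BL by (intro lipschitz_on_continuous_on[of L] lipschitz_onI) (auto simp: dist_real_def)
    then show ?thesis by (simp add: continuous_on_eq_continuous_at)
  qed
  then obtain c F \<xi> where dF: "\<And>x. (F has_real_derivative f x - c) (at x)"
    and perF: "\<And>x. F (x + P) = F x" and \<xi>: "f \<xi> = c"
    using periodic_antiderivative[of f P] per P by metis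
  have c: "0 \<le> c" using nonneg \<xi> by auto
  have low: "F x - c * (y - x) \<le> F y" if "x \<le> y" for x y
  proof -
    have "(\<lambda>x. F x + c * x) x \<le> (\<lambda>x. F x + c * x) y"
    proof (rule DERIV_nonneg_imp_nondecreasing[OF that])
      show "\<exists>d. ((\<lambda>x. F x + c * x) has_real_derivative d) (at z) \<and> 0 \<le> d" for z
        by (rule exI[of _ "f z"]) (auto intro!: derivative_eq_intros dF nonneg)
    qed
    then show ?thesis by (simp add: algebra_simps)
  qed
  have osc: "\<bar>F y - F x\<bar> \<le> c * P" for x y
  proof -
    obtain k where k: "x \<le> y + of_int k * P" "y + of_int k * P \<le> x + P"
      using P by (rule periodic_representative)
    define z where "z = y + of_int k * P"
    have Fz: "F z = F y" unfolding z_def by (rule periodic_shift_int[where F = F, OF perF])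
    have "c * (z - x) \<le> c * P" "c * (x + P - z) \<le> c * P"
      using k c by (auto simp: z_def intro!: mult_left_mono)
    then show ?thesis using low[of x z] low[of z "x + P"] k perF[of x] Fz by (auto simp: z_def abs_if)
  qed
  have "isCont F x" for x using dF by (rule DERIV_isCont)
  then obtain c' G \<zeta> where dG: "\<And>x. (G has_real_derivative F x - c') (at x)"
    and perG: "\<And>x. G (x + P) = G x" and \<zeta>: "F \<zeta> = c'"
    using periodic_antiderivative[of F P] perF P by metis
  have F1: "\<bar>F x - c'\<bar> \<le> c * P" for x using osc[of x \<zeta>] \<zeta> by simp
  have G1: "\<bar>G x - G 0\<bar> \<le> c * P\<^sup>2" for x
  proof -
    obtain k where k: "0 \<le> x + of_int k * P" "x + of_int k * P \<le> 0 + P"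
      using P by (rule periodic_representative)
    have "\<bar>G (x + of_int k * P) - G 0\<bar> \<le> c * P * \<bar>(x + of_int k * P) - 0\<bar>"
      by (rule lipschitz_of_deriv_bound[OF dG F1])
    also have "\<dots> \<le> c * P * P" using k c P by (intro mult_left_mono) auto
    finally show ?thesis using periodic_shift_int[where F = G, OF perG, of x k] by (simp add: power2_eq_square mult.assoc)
  qed
  show ?thesis
  proof (rule that[of "\<lambda>x. G x - G 0" "\<lambda>x. F x - c'" c \<xi>])
    have fc: "\<bar>f x - c\<bar> \<le> B + c" for x using BL(1)[of x] c by (simp add: abs_le_iff)
    have dG': "((\<lambda>x. G x - G 0) has_real_derivative F x - c') (at x)"
      and dF': "((\<lambda>x. F x - c') has_real_derivative f x - c) (at x)" for x
      by (auto intro!: derivative_eq_intros dG dF)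
    show "C2_Lip (\<lambda>x. G x - G 0) (\<lambda>x. F x - c') (\<lambda>x. f x - c)"
      unfolding C2_Lip_def
      using Cb_Lip_of_deriv_bound[OF dG' F1 G1] Cb_Lip_of_deriv_bound[OF dF' fc F1] dG' dF' f
      by (auto intro!: Cb_Lip_diff)
    show "\<bar>(F x - c') - (F y - c')\<bar> \<le> c * P" for x y using osc[of x y] by simp
  qed (use F1 G1 \<xi> in auto)
qed

section \<open>Gluing sine arcs to a periodic pattern\<close>

lemma DERIV_If_0:
  fixes p q :: "real \<Rightarrow> real"
  assumes "\<And>x. (p has_real_derivative p' x) (at x)" "\<And>x. (q has_real_derivative q' x) (at x)"
    "p 0 = q 0" "p' 0 = q' 0"
  shows "((\<lambda>x. if x \<le> 0 then p x else q x) has_real_derivative (if x \<le> 0 then p' x else q' x)) (at x)"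
proof -
  let ?f = "\<lambda>x. if x \<le> 0 then p x else q x"
  consider "x < 0" | "0 < x" | "x = 0" by linarith
  then show ?thesis
  proof cases
    case 1
    have "(?f has_real_derivative p' x) (at x)"
      by (rule has_field_derivative_transform_within_open[OF assms(1), of "{..<0}"]) (use 1 in auto)
    with 1 show ?thesis by simp
  next
    case 2
    have "(?f has_real_derivative q' x) (at x)"
      by (rule has_field_derivative_transform_within_open[OF assms(2), of "{0<..}"]) (use 2 in auto)
    with 2 show ?thesis by simp
  next
    case 3
    have "((\<lambda>y. (p y - p 0) / (y - 0)) \<longlongrightarrow> p' 0) (at_left 0)"
      using has_field_derivative_at_within[OF assms(1)[of 0], of "{..<0}"] unfolding has_field_derivative_iff .
    then have L: "((\<lambda>y. (?f y - ?f 0) / (y - 0)) \<longlongrightarrow> p' 0) (at_left 0)"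
      by (rule Lim_transform_eventually) (auto simp: eventually_at_filter)
    have "((\<lambda>y. (q y - q 0) / (y - 0)) \<longlongrightarrow> p' 0) (at_right 0)"
      using has_field_derivative_at_within[OF assms(2)[of 0], of "{0<..}"] unfolding has_field_derivative_iff assms(4) .
    then have R: "((\<lambda>y. (?f y - ?f 0) / (y - 0)) \<longlongrightarrow> p' 0) (at_right 0)"
      by (rule Lim_transform_eventually) (auto simp: eventually_at_filter assms(3))
    have "((\<lambda>y. (?f y - ?f 0) / (y - 0)) \<longlongrightarrow> p' 0) (at 0)"
      using L R by (rule filterlim_split_at)
    then show ?thesis unfolding has_field_derivative_iff using 3 by simp
  qed
qed

text \<open>The half waves \<open>a * sin (x / a)\<close> and \<open>- b * sin (x / b)\<close> alternate and have the same slope at their common zeros.\<close>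

lemma half_wave_pattern:
  fixes a b :: real
  assumes ab: "0 < a" "0 < b"
  defines "P \<equiv> pi * (a + b)"
  obtains \<Phi> \<Phi>1 where
    "C2_Lip \<Phi> \<Phi>1 (\<lambda>x. max 0 (- \<Phi> x) / b\<^sup>2 - max 0 (\<Phi> x) / a\<^sup>2)"
    "\<And>x. \<Phi> (x + P) = \<Phi> x" "\<And>x. - b \<le> \<Phi> x" "\<And>x. \<Phi> x \<le> a"
    "\<And>x. (\<Phi>1 x)\<^sup>2 + (max 0 (- \<Phi> x) / b)\<^sup>2 + (max 0 (\<Phi> x) / a)\<^sup>2 = 1"
    "\<Phi>1 0 = 1" "\<Phi>1 (pi * a) = - 1"
proof -
  define g where "g x = (if x \<le> 0 then b * sin (x / b) else a * sin (x / a))" for x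
  define g1 where "g1 x = (if x \<le> 0 then cos (x / b) else cos (x / a))" for x
  define g2 where "g2 x = (if x \<le> 0 then - sin (x / b) / b else - sin (x / a) / a)" for x
  have dg: "(g has_real_derivative g1 x) (at x)" for x
    unfolding g_def[abs_def] g1_def
    by (rule DERIV_If_0) (use ab in \<open>auto intro!: derivative_eq_intros\<close>)
  have dg1: "(g1 has_real_derivative g2 x) (at x)" for x
    unfolding g1_def[abs_def] g2_def
    by (rule DERIV_If_0) (use ab in \<open>auto intro!: derivative_eq_intros\<close>)
  have P: "0 < P" using ab by (simp add: P_def)
  \<comment> \<open>Index of the period cell [-pi b, pi a) that contains x; \<open>y x\<close> is
    the representative of x in the cell around 0.\<close>
  define k where "k x = \<lfloor>(x + pi * b) / P\<rfloor>" for x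
  define y where "y x = x - of_int (k x) * P" for x
  have y: "- (pi * b) \<le> y x" "y x < pi * a" for x
  proof -
    have "of_int (k x) \<le> (x + pi * b) / P" "(x + pi * b) / P < of_int (k x) + 1"
      unfolding k_def by (simp_all add: floor_correct)
    then have "of_int (k x) * P \<le> x + pi * b" "x + pi * b < (of_int (k x) + 1) * P"
      using P by (simp_all add: pos_le_divide_eq pos_divide_less_eq)
    then show "- (pi * b) \<le> y x" "y x < pi * a" by (simp_all add: y_def P_def algebra_simps)
  qed
  have k_eq: "k z = j" if "- (pi * b) \<le> z - of_int j * P" "z - of_int j * P < pi * a" for z j
  proof -
    have "of_int j * P \<le> z + pi * b" "z + pi * b < (of_int j + 1) * P"
      using that by (simp_all add: P_def algebra_simps)
    then show ?thesis unfolding k_def using P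
      by (intro floor_unique) (simp_all add: pos_le_divide_eq pos_divide_less_eq)
  qed
  define \<Phi> where "\<Phi> x = g (y x)" for x
  define \<Phi>1 where "\<Phi>1 x = g1 (y x)" for x
  have g_sign: "g2 z = max 0 (- g z) / b\<^sup>2 - max 0 (g z) / a\<^sup>2"
    "(g1 z)\<^sup>2 + (max 0 (- g z) / b)\<^sup>2 + (max 0 (g z) / a)\<^sup>2 = 1" "- b \<le> g z" "g z \<le> a"
    if "- (pi * b) \<le> z" "z \<le> pi * a" for z
  proof -
    have "g2 z = max 0 (- g z) / b\<^sup>2 - max 0 (g z) / a\<^sup>2 \<and>
        (g1 z)\<^sup>2 + (max 0 (- g z) / b)\<^sup>2 + (max 0 (g z) / a)\<^sup>2 = 1 \<and> - b \<le> g z \<and> g z \<le> a"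
    proof (cases "z \<le> 0")
      case True
      have "0 \<le> sin (- z / b)" using that(1) True ab by (intro sin_ge_zero) (auto simp: field_simps)
      then have s: "sin (z / b) \<le> 0" by simp
      then have "b * sin (z / b) \<le> 0" using ab by (simp add: mult_le_0_iff)
      moreover have "- b \<le> b * sin (z / b)" using mult_left_mono[of "-1" "sin (z / b)" b] ab by simp
      ultimately show ?thesis using True ab
        by (simp add: g_def g1_def g2_def max_def power2_eq_square sin_cos_squared_add3)
    next
      case False
      have s: "0 \<le> sin (z / a)" using that(2) False ab by (intro sin_ge_zero) (auto simp: field_simps)
      then have "0 \<le> a * sin (z / a)" using ab by simp
      moreover have "a * sin (z / a) \<le> a" using mult_left_mono[of "sin (z / a)" 1 a] ab by simp
      ultimately show ?thesis using False ab
        by (simp add: g_def g1_def g2_def max_def power2_eq_square sin_cos_squared_add3)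
           (metis add_0_right mult_zero_left sin_cos_squared_add3)
    qed
    then show "g2 z = max 0 (- g z) / b\<^sup>2 - max 0 (g z) / a\<^sup>2"
      "(g1 z)\<^sup>2 + (max 0 (- g z) / b)\<^sup>2 + (max 0 (g z) / a)\<^sup>2 = 1" "- b \<le> g z" "g z \<le> a" by blast+
  qed
  have d: "(\<Phi> has_real_derivative \<Phi>1 x) (at x)" "(\<Phi>1 has_real_derivative g2 (y x)) (at x)" for x
  proof -
    have "(\<Phi> has_real_derivative \<Phi>1 x) (at x) \<and> (\<Phi>1 has_real_derivative g2 (y x)) (at x)"
    proof (cases "y x = - (pi * b)")
      case False
      define S where "S = {z. - (pi * b) < z - of_int (k x) * P} \<inter> {z. z - of_int (k x) * P < pi * a}"
      have S: "open S" unfolding S_def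
        by (intro open_Int open_Collect_less continuous_intros)
      have x: "x \<in> S" using y[of x] False by (simp add: S_def y_def)
      have yz: "y z = z - of_int (k x) * P" if "z \<in> S" for z
        unfolding y_def using k_eq[of z "k x"] that by (simp add: S_def)
      have "((\<lambda>z. z - of_int (k x) * P) has_real_derivative 1) (at x)"
        by (auto intro!: derivative_eq_intros)
      from DERIV_chain2[OF dg this] DERIV_chain2[OF dg1 this]
      have "((\<lambda>z. g (z - of_int (k x) * P)) has_real_derivative \<Phi>1 x) (at x)"
        "((\<lambda>z. g1 (z - of_int (k x) * P)) has_real_derivative g2 (y x)) (at x)"
        by (simp_all add: \<Phi>1_def y_def)
      from has_field_derivative_transform_within_open[OF this(1) S x, of \<Phi>]
        has_field_derivative_transform_within_open[OF this(2) S x, of \<Phi>1]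
      show ?thesis by (simp add: \<Phi>_def \<Phi>1_def yz)
    next
      case True
      \<comment> \<open>Where two cells meet, the pattern is the mirror image of g at 0. The
        reflection w reduces differentiability there to the gluing of g at 0.\<close>
      define w where "w z = x - z" for z
      define S where "S = {z. - (pi * b) < w z} \<inter> {z. w z < pi * a}"
      have S: "open S" unfolding S_def w_def
        by (intro open_Int open_Collect_less continuous_intros)
      have x: "x \<in> S" using ab by (simp add: S_def w_def)
      have eq: "\<Phi> z = g (w z) \<and> \<Phi>1 z = - g1 (w z)" if z: "z \<in> S" for z
      proof (cases "w z \<le> 0")
        case wz: True
        have e: "z - of_int (k x) * P = - (pi * b) - w z" using True by (simp add: y_def w_def)
        have "0 < pi * a" using ab by simp
        then have "k z = k x" using k_eq[of z "k x"] z wz e by (simp add: S_def)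
        with e have "y z = - (pi * b) - w z" by (simp add: y_def)
        moreover have "sin ((- (pi * b) - w z) / b) = sin (w z / b)" "cos ((- (pi * b) - w z) / b) = - cos (w z / b)"
        proof -
          have "(- (pi * b) - w z) / b = - (w z / b + pi)" using ab by (simp add: field_simps)
          then show "sin ((- (pi * b) - w z) / b) = sin (w z / b)" "cos ((- (pi * b) - w z) / b) = - cos (w z / b)"
            by (simp_all only: sin_minus cos_minus sin_periodic_pi cos_periodic_pi minus_minus)
        qed
        ultimately show ?thesis using z wz by (simp add: \<Phi>_def \<Phi>1_def g_def g1_def S_def)
      next
        case wz: False
        have e: "z - of_int (k x - 1) * P = pi * a - w z"
          using True by (simp add: y_def w_def P_def algebra_simps)
        have "0 < pi * b" using ab by simp
        with e have "y z = pi * a - w z"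
          unfolding y_def using k_eq[of z "k x - 1"] z wz by (simp add: S_def)
        moreover have "sin ((pi * a - w z) / a) = sin (w z / a)" "cos ((pi * a - w z) / a) = - cos (w z / a)"
        proof -
          have "(pi * a - w z) / a = pi - w z / a" using ab by (simp add: field_simps)
          then show "sin ((pi * a - w z) / a) = sin (w z / a)" "cos ((pi * a - w z) / a) = - cos (w z / a)"
            by (simp_all only: sin_pi_minus cos_pi_minus)
        qed
        ultimately show ?thesis using z wz by (simp add: \<Phi>_def \<Phi>1_def g_def g1_def S_def)
      qed
      have "((\<lambda>z. g (w z)) has_real_derivative g1 (w x) * (- 1)) (at x)"
        unfolding w_def by (rule DERIV_chain2[OF dg]) (auto intro!: derivative_eq_intros)
      moreover have "((\<lambda>z. - g1 (w z)) has_real_derivative - (g2 (w x) * (- 1))) (at x)"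
        unfolding w_def by (intro DERIV_minus DERIV_chain2[OF dg1]) (auto intro!: derivative_eq_intros)
      moreover have "\<Phi>1 x = g1 (w x) * (- 1)" using eq[OF x] by simp
      moreover have "g2 (y x) = - (g2 (w x) * (- 1))"
        using True ab by (simp add: g2_def w_def)
      ultimately show ?thesis
        using has_field_derivative_transform_within_open[OF _ S x, of "\<lambda>z. g (w z)" _ \<Phi>]
          has_field_derivative_transform_within_open[OF _ S x, of "\<lambda>z. - g1 (w z)" _ \<Phi>1] eq
        by simp
    qed
    then show "(\<Phi> has_real_derivative \<Phi>1 x) (at x)" "(\<Phi>1 has_real_derivative g2 (y x)) (at x)" by blast+
  qed
  have yr: "- (pi * b) \<le> y x" "y x \<le> pi * a" for x using y[of x] by auto
  have g2y: "g2 (y x) = max 0 (- \<Phi> x) / b\<^sup>2 - max 0 (\<Phi> x) / a\<^sup>2" for x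
    unfolding \<Phi>_def by (rule g_sign(1)[OF yr])
  have bd: "\<bar>\<Phi> x\<bar> \<le> a + b" "\<bar>\<Phi>1 x\<bar> \<le> 1" "\<bar>g2 (y x)\<bar> \<le> 1 / b + 1 / a" for x
  proof -
    show "\<bar>\<Phi> x\<bar> \<le> a + b" unfolding \<Phi>_def using g_sign(3,4)[OF yr, of x] ab by linarith
    show "\<bar>\<Phi>1 x\<bar> \<le> 1" by (simp add: \<Phi>1_def g1_def)
    have "\<bar>sin (u::real) / c\<bar> \<le> 1 / c" if "0 < c" for u c
      using that abs_sin_le_one[of u] by (simp add: divide_right_mono)
    from this[OF ab(2), of "y x / b"] this[OF ab(1), of "y x / a"] ab
    show "\<bar>g2 (y x)\<bar> \<le> 1 / b + 1 / a"
      by (auto simp: g2_def intro: add_increasing add_increasing2)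
  qed
  have C: "\<Phi> \<in> Cb_Lip" "\<Phi>1 \<in> Cb_Lip"
    using Cb_Lip_of_deriv_bound[OF d(1) bd(2,1)] Cb_Lip_of_deriv_bound[OF d(2) bd(3,2)] by auto
  have C2: "(\<lambda>x. max 0 (- \<Phi> x) / b\<^sup>2 - max 0 (\<Phi> x) / a\<^sup>2) \<in> Cb_Lip"
  proof -
    have m: "(\<lambda>x. max 0 (h x)) \<in> Cb_Lip" if "h \<in> Cb_Lip" for h :: "real \<Rightarrow> real"
      by (rule Cb_Lip_lipschitz_compose[OF that, of "max 0" 1]) auto
    show ?thesis unfolding divide_inverse mult.commute[of _ "inverse _"]
      by (intro Cb_Lip_diff Cb_Lip_cmult m Cb_Lip_minus C)
  qed
  show ?thesis
  proof (rule that[of \<Phi> \<Phi>1])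
    show "C2_Lip \<Phi> \<Phi>1 (\<lambda>x. max 0 (- \<Phi> x) / b\<^sup>2 - max 0 (\<Phi> x) / a\<^sup>2)"
      using d C C2 by (simp add: C2_Lip_def g2y)
    show "\<Phi> (x + P) = \<Phi> x" for x
    proof -
      have "k (x + P) = k x + 1"
        by (rule k_eq) (use y[of x] in \<open>simp_all add: y_def algebra_simps\<close>)
      then show ?thesis by (simp add: \<Phi>_def y_def algebra_simps)
    qed
    show "- b \<le> \<Phi> x" "\<Phi> x \<le> a" for x unfolding \<Phi>_def by (intro g_sign yr)+
    show "(\<Phi>1 x)\<^sup>2 + (max 0 (- \<Phi> x) / b)\<^sup>2 + (max 0 (\<Phi> x) / a)\<^sup>2 = 1" for x
      unfolding \<Phi>_def \<Phi>1_def by (intro g_sign yr)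
    have "k 0 = 0" by (rule k_eq) (use ab in auto)
    then show "\<Phi>1 0 = 1" by (simp add: \<Phi>1_def y_def g1_def)
    have "0 < pi * a" "0 < pi * b" using ab by simp_all
    then have "k (pi * a) = 1" by (intro k_eq) (simp_all add: P_def algebra_simps)
    then have "y (pi * a) = - (pi * b)" by (simp add: y_def P_def algebra_simps)
    then show "\<Phi>1 (pi * a) = - 1" using ab by (simp add: \<Phi>1_def g1_def)
  qed
qed

section \<open>Comparison with sub- and supersolutions\<close>

text \<open>With p and q the lower and upper variance of \<open>Y\<close> this is G(v) = E[v Y^2] /
  2, see \<open>expectation_square\<close>. It is kept free of \<open>E\<close> because its
  estimates concern real numbers only.\<close>

definition generator :: "real \<Rightarrow> real \<Rightarrow> real \<Rightarrow> real" where
  "generator p q v = (q * max 0 v - p * max 0 (- v)) / 2"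

lemma generator_subadditive:
  assumes "0 \<le> p" "p \<le> q"
  shows "generator p q (u + v) \<le> generator p q u + generator p q v"
proof -
  have *: "generator p q w = p * w / 2 + (q - p) * max 0 w / 2" for w
    by (simp add: generator_def max_def field_simps)
  have "(q - p) * max 0 (u + v) \<le> (q - p) * (max 0 u + max 0 v)"
    using assms by (intro mult_left_mono) auto
  then have "(q - p) * max 0 (u + v) / 2 \<le> (q - p) * max 0 u / 2 + (q - p) * max 0 v / 2"
    by (simp add: distrib_left)
  then show ?thesis unfolding * by (simp add: distrib_left add_divide_distrib)
qed

lemma generator_le:
  assumes "0 \<le> p" "0 \<le> q"
  shows "generator p q v \<le> q / 2 * \<bar>v\<bar>"
proof -
  have "q * max 0 v \<le> q * \<bar>v\<bar>" "0 \<le> p * max 0 (- v)" using assms by (auto intro: mult_left_mono)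
  then show ?thesis by (simp add: generator_def)
qed

text \<open>Finite sums of terms \<open>exp (k * t) * g x\<close> and \<open>e * t\<close>. The functions \<open>V\<close> and \<open>W\<close> stand for the time derivative and the second
  space derivative of \<open>U\<close>, with error bounds that are uniform in time.\<close>

definition evolution :: "real \<Rightarrow> (real \<Rightarrow> real \<Rightarrow> real) \<Rightarrow> (real \<Rightarrow> real \<Rightarrow> real) \<Rightarrow> (real \<Rightarrow> real \<Rightarrow> real) \<Rightarrow> bool" where
  "evolution T U V W \<longleftrightarrow> (\<forall>t. U t \<in> Cb_Lip) \<and>
     (\<exists>C U1. 0 \<le> C \<and> (\<forall>t\<in>{0..T}. \<forall>x.
        (\<forall>h\<in>{0..1}. \<bar>U (t + h) x - U t x - h * V t x\<bar> \<le> C * h\<^sup>2) \<and>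
        (\<forall>y. \<bar>U t (x + y) - U t x - U1 t x * y - W t x * y\<^sup>2 / 2\<bar> \<le> C * \<bar>y\<bar> ^ 3)))"

lemma evolutionE:
  assumes "evolution T U V W"
  obtains C U1 where "0 \<le> C" "\<And>t. U t \<in> Cb_Lip"
    "\<And>t h x. t \<in> {0..T} \<Longrightarrow> h \<in> {0..1} \<Longrightarrow> \<bar>U (t + h) x - U t x - h * V t x\<bar> \<le> C * h\<^sup>2"
    "\<And>t x y. t \<in> {0..T} \<Longrightarrow> \<bar>U t (x + y) - U t x - U1 t x * y - W t x * y\<^sup>2 / 2\<bar> \<le> C * \<bar>y\<bar> ^ 3"
  using assms unfolding evolution_def by blast

lemma evolution_add:
  assumes "evolution T U V W" "evolution T U' V' W'"
  shows "evolution T (\<lambda>t x. U t x + U' t x) (\<lambda>t x. V t x + V' t x) (\<lambda>t x. W t x + W' t x)"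
proof -
  from assms(1) obtain C U1 where 1: "0 \<le> C" "\<And>t. U t \<in> Cb_Lip"
    "\<And>t h x. t \<in> {0..T} \<Longrightarrow> h \<in> {0..1} \<Longrightarrow> \<bar>U (t + h) x - U t x - h * V t x\<bar> \<le> C * h\<^sup>2"
    "\<And>t x y. t \<in> {0..T} \<Longrightarrow> \<bar>U t (x + y) - U t x - U1 t x * y - W t x * y\<^sup>2 / 2\<bar> \<le> C * \<bar>y\<bar> ^ 3"
    by (rule evolutionE) blast
  from assms(2) obtain C' U1' where 2: "0 \<le> C'" "\<And>t. U' t \<in> Cb_Lip"
    "\<And>t h x. t \<in> {0..T} \<Longrightarrow> h \<in> {0..1} \<Longrightarrow> \<bar>U' (t + h) x - U' t x - h * V' t x\<bar> \<le> C' * h\<^sup>2"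
    "\<And>t x y. t \<in> {0..T} \<Longrightarrow> \<bar>U' t (x + y) - U' t x - U1' t x * y - W' t x * y\<^sup>2 / 2\<bar> \<le> C' * \<bar>y\<bar> ^ 3"
    by (rule evolutionE) blast
  show ?thesis unfolding evolution_def
  proof (intro conjI exI[of _ "C + C'"] exI[of _ "\<lambda>t x. U1 t x + U1' t x"] allI ballI)
    show "(\<lambda>x. U t x + U' t x) \<in> Cb_Lip" for t using 1 2 by auto
    fix t x assume t: "t \<in> {0..T}"
    show "\<bar>U (t + h) x + U' (t + h) x - (U t x + U' t x) - h * (V t x + V' t x)\<bar> \<le> (C + C') * h\<^sup>2"
      if "h \<in> {0..1}" for h
      using 1(3)[OF t that, of x] 2(3)[OF t that, of x] by (simp add: algebra_simps)
    fix y
    have "U t (x + y) + U' t (x + y) - (U t x + U' t x) - (U1 t x + U1' t x) * y - (W t x + W' t x) * y\<^sup>2 / 2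
        = (U t (x + y) - U t x - U1 t x * y - W t x * y\<^sup>2 / 2)
          + (U' t (x + y) - U' t x - U1' t x * y - W' t x * y\<^sup>2 / 2)" by (simp add: algebra_simps)
    then show "\<bar>U t (x + y) + U' t (x + y) - (U t x + U' t x) - (U1 t x + U1' t x) * y
        - (W t x + W' t x) * y\<^sup>2 / 2\<bar> \<le> (C + C') * \<bar>y\<bar> ^ 3"
      using 1(4)[OF t, of x y] 2(4)[OF t, of x y] unfolding distrib_right by linarith
  qed (use 1 2 in auto)
qed

lemma evolution_exp:
  assumes g: "C2_Lip g g1 g2"
  shows "evolution T (\<lambda>t x. exp (k * t) * g x) (\<lambda>t x. k * exp (k * t) * g x) (\<lambda>t x. exp (k * t) * g2 x)"
proof -
  from g have "g \<in> Cb_Lip" by (simp add: C2_Lip_def)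
  then obtain B where B: "\<And>x. \<bar>g x\<bar> \<le> B" by (rule Cb_LipE) blast
  have B0: "0 \<le> B" using B[of 0] by linarith
  from g obtain C where C: "0 \<le> C" "\<And>x y. \<bar>g (x + y) - g x - g1 x * y - g2 x * y\<^sup>2 / 2\<bar> \<le> C * \<bar>y\<bar> ^ 3"
    by (rule C2_Lip_taylor) blast
  let ?M = "exp (\<bar>k\<bar> * T)"
  let ?K = "?M * exp \<bar>k\<bar> * k\<^sup>2 * B"
  have ek: "exp (k * t) \<le> ?M" if "t \<in> {0..T}" for t
  proof -
    have "k * t \<le> \<bar>k\<bar> * t" using that by (intro mult_right_mono) auto
    also have "\<dots> \<le> \<bar>k\<bar> * T" using that by (intro mult_left_mono) auto
    finally show ?thesis by simp
  qed
  show ?thesis unfolding evolution_def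
  proof (intro conjI exI[of _ "max ?K (?M * C)"] exI[of _ "\<lambda>t x. exp (k * t) * g1 x"] allI ballI)
    show "(\<lambda>x. exp (k * t) * g x) \<in> Cb_Lip" for t using g by (auto simp: C2_Lip_def)
    show "0 \<le> max ?K (?M * C)" using C by (simp add: le_max_iff_disj)
    fix t x assume t: "t \<in> {0..T}"
    {
      fix h :: real assume h: "h \<in> {0..1}"
      obtain z where z: "\<bar>z\<bar> \<le> \<bar>k * h\<bar>" "exp (k * h) = (\<Sum>m<2. (k * h) ^ m / fact m) + exp z / fact 2 * (k * h)\<^sup>2"
        using Maclaurin_exp_le by blast
      then have e: "exp (k * h) - 1 - k * h = exp z / 2 * (k * h)\<^sup>2"
        by (simp add: numeral_2_eq_2)
      have "\<bar>k * h\<bar> \<le> \<bar>k\<bar> * 1" unfolding abs_mult using h by (intro mult_left_mono) auto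
      then have "exp z \<le> exp \<bar>k\<bar>" using z(1) by simp
      then have "exp z / 2 \<le> exp \<bar>k\<bar>" using exp_gt_zero[of z] by linarith
      then have e': "\<bar>exp (k * h) - 1 - k * h\<bar> \<le> exp \<bar>k\<bar> * (k * h)\<^sup>2"
        unfolding e abs_mult by (intro mult_mono) auto
      have "exp (k * (t + h)) * g x - exp (k * t) * g x - h * (k * exp (k * t) * g x)
          = exp (k * t) * (exp (k * h) - 1 - k * h) * g x"
        by (simp add: distrib_left exp_add algebra_simps)
      also have "\<bar>\<dots>\<bar> \<le> ?M * (exp \<bar>k\<bar> * (k * h)\<^sup>2) * B"
        unfolding abs_mult using ek[OF t] e' B[of x] B0 by (intro mult_mono) auto
      also have "\<dots> = ?K * h\<^sup>2" by (simp add: power_mult_distrib)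
      also have "\<dots> \<le> max ?K (?M * C) * h\<^sup>2" by (intro mult_right_mono) auto
      finally show "\<bar>exp (k * (t + h)) * g x - exp (k * t) * g x - h * (k * exp (k * t) * g x)\<bar>
          \<le> max ?K (?M * C) * h\<^sup>2" .
    }
    fix y
    have "exp (k * t) * g (x + y) - exp (k * t) * g x - exp (k * t) * g1 x * y - exp (k * t) * g2 x * y\<^sup>2 / 2
        = exp (k * t) * (g (x + y) - g x - g1 x * y - g2 x * y\<^sup>2 / 2)" by (simp add: algebra_simps)
    also have "\<bar>\<dots>\<bar> \<le> ?M * (C * \<bar>y\<bar> ^ 3)"
      unfolding abs_mult using ek[OF t] C by (intro mult_mono) auto
    also have "\<dots> \<le> max ?K (?M * C) * \<bar>y\<bar> ^ 3"
      unfolding mult.assoc[symmetric] by (intro mult_right_mono) auto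
    finally show "\<bar>exp (k * t) * g (x + y) - exp (k * t) * g x - exp (k * t) * g1 x * y
        - exp (k * t) * g2 x * y\<^sup>2 / 2\<bar> \<le> max ?K (?M * C) * \<bar>y\<bar> ^ 3" .
  qed
qed

lemma evolution_space: "C2_Lip g g1 g2 \<Longrightarrow> evolution T (\<lambda>t. g) (\<lambda>t x. 0) (\<lambda>t. g2)"
  using evolution_exp[of g g1 g2 T 0] by simp

lemma evolution_time: "evolution T (\<lambda>t x. e * t) (\<lambda>t x. e) (\<lambda>t x. 0)"
  unfolding evolution_def
  by (intro conjI exI[of _ 0] exI[of _ "\<lambda>t x. 0"]) (auto simp: algebra_simps)

lemma evolution_sum_list:
  assumes "\<And>i. i \<in> set l \<Longrightarrow> evolution T (U i) (V i) (W i)"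
  shows "evolution T (\<lambda>t x. \<Sum>i\<leftarrow>l. U i t x) (\<lambda>t x. \<Sum>i\<leftarrow>l. V i t x) (\<lambda>t x. \<Sum>i\<leftarrow>l. W i t x)"
  using assms
proof (induction l)
  case Nil
  show ?case using evolution_time[of T 0] by simp
next
  case (Cons i l)
  then show ?case by (auto intro!: evolution_add)
qed

locale centered_variable = sublinear_expectation_space H E
  for H :: "('a \<Rightarrow> real) set" and E +
  fixes Y :: "'a \<Rightarrow> real"
  assumes Y_mem: "Y \<in> H" and mean: "E Y = 0" "E (\<lambda>\<omega>. - Y \<omega>) = 0"
begin

lemma var_bounds: "0 \<le> lower_var E Y" "lower_var E Y \<le> upper_var E Y"
proof -
  have "E (\<lambda>\<omega>. - (Y \<omega>)\<^sup>2) \<le> E (\<lambda>_. 0)" by (intro monotone mem_intros square_mem Y_mem) auto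
  then show "0 \<le> lower_var E Y" by (simp add: lower_var_def const)
  show "lower_var E Y \<le> upper_var E Y"
    using expectation_minus[OF square_mem[OF Y_mem]] by (simp add: lower_var_def upper_var_def)
qed

lemma expectation_square:
  "E (\<lambda>\<omega>. v * (Y \<omega>)\<^sup>2) = 2 * generator (lower_var E Y) (upper_var E Y) v"
proof (cases "0 \<le> v")
  case True
  then show ?thesis using pos_homogeneous[OF square_mem[OF Y_mem], of v]
    by (simp add: generator_def upper_var_def)
next
  case False
  then show ?thesis using pos_homogeneous[OF minus_mem[OF square_mem[OF Y_mem]], of "- v"]
    by (simp add: generator_def lower_var_def)
qed

abbreviation G :: "real \<Rightarrow> real" where "G \<equiv> generator (lower_var E Y) (upper_var E Y)"

text \<open>The linear Taylor term drops out because \<open>Y\<close> has no mean uncertainty, the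
  quadratic one contributes h G(W), and the cubic remainder h sqrt h times the third absolute
  moment.\<close>

lemma transition_expansion:
  assumes "evolution T U V W"
  obtains D where "0 \<le> D"
    "\<And>t h x. t \<in> {0..T} \<Longrightarrow> 0 \<le> h \<Longrightarrow>
      \<bar>transition Y (sqrt h) (U t) x - U t x - h * G (W t x)\<bar> \<le> D * (h * sqrt h)"
proof -
  obtain C U1 where C: "0 \<le> C" and U: "\<And>t. U t \<in> Cb_Lip"
    and time: "\<And>t h x. t \<in> {0..T} \<Longrightarrow> h \<in> {0..1} \<Longrightarrow> \<bar>U (t + h) x - U t x - h * V t x\<bar> \<le> C * h\<^sup>2"
    and taylor: "\<And>t x y. t \<in> {0..T} \<Longrightarrow>
      \<bar>U t (x + y) - U t x - U1 t x * y - W t x * y\<^sup>2 / 2\<bar> \<le> C * \<bar>y\<bar> ^ 3"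
    by (rule evolutionE[OF assms]) blast
  define M where "M = E (\<lambda>\<omega>. \<bar>Y \<omega>\<bar> ^ 3)"
  have M: "0 \<le> M" unfolding M_def by (intro expectation_nonneg mem_intros Y_mem) simp
  show ?thesis
  proof (rule that[of "C * M"])
    fix t h x assume t: "t \<in> {0..T}" and h: "0 \<le> (h::real)"
    let ?q = "\<lambda>\<omega>. (h * W t x / 2) * (Y \<omega>)\<^sup>2 + U t x"
    have q: "?q \<in> H" by (intro mem_intros Y_mem)
    have "E (\<lambda>\<omega>. ?q \<omega> + (U1 t x * sqrt h) * Y \<omega>) = E ?q"
      by (intro expectation_add_certain q Y_mem mean)
    also have "E ?q = U t x + h * G (W t x)"
    proof -
      have "E ?q = E (\<lambda>\<omega>. (h * W t x / 2) * (Y \<omega>)\<^sup>2) + U t x"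
        by (intro expectation_add_const mem_intros Y_mem)
      also have "E (\<lambda>\<omega>. (h * W t x / 2) * (Y \<omega>)\<^sup>2) = E (\<lambda>\<omega>. h / 2 * (W t x * (Y \<omega>)\<^sup>2))"
        by (rule arg_cong[of _ _ E]) (auto simp: algebra_simps)
      also have "\<dots> = h / 2 * E (\<lambda>\<omega>. W t x * (Y \<omega>)\<^sup>2)"
        using h by (intro pos_homogeneous mem_intros Y_mem) auto
      finally show ?thesis by (simp add: expectation_square)
    qed
    finally have *: "E (\<lambda>\<omega>. ?q \<omega> + (U1 t x * sqrt h) * Y \<omega>) = U t x + h * G (W t x)" .
    have "\<bar>E (\<lambda>\<omega>. U t (x + sqrt h * Y \<omega>)) - E (\<lambda>\<omega>. ?q \<omega> + (U1 t x * sqrt h) * Y \<omega>)\<bar>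
        \<le> E (\<lambda>\<omega>. (C * (h * sqrt h)) * \<bar>Y \<omega>\<bar> ^ 3)"
    proof (rule expectation_abs_diff)
      fix \<omega>
      have "sqrt h ^ 3 = h * sqrt h" using h by (simp add: power3_eq_cube)
      then have s: "(sqrt h * Y \<omega>)\<^sup>2 = h * (Y \<omega>)\<^sup>2" "\<bar>sqrt h * Y \<omega>\<bar> ^ 3 = h * sqrt h * \<bar>Y \<omega>\<bar> ^ 3"
        using h by (simp_all add: power_mult_distrib abs_mult)
      from taylor[OF t, of x "sqrt h * Y \<omega>"]
      show "\<bar>U t (x + sqrt h * Y \<omega>) - (?q \<omega> + (U1 t x * sqrt h) * Y \<omega>)\<bar> \<le> (C * (h * sqrt h)) * \<bar>Y \<omega>\<bar> ^ 3"
        unfolding s by (simp add: algebra_simps)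
    qed (intro transition_mem U mem_intros Y_mem)+
    also have "\<dots> = C * (h * sqrt h) * M" unfolding M_def
      using C h by (intro pos_homogeneous mem_intros Y_mem) auto
    finally show "\<bar>transition Y (sqrt h) (U t) x - U t x - h * G (W t x)\<bar> \<le> C * M * (h * sqrt h)"
      unfolding transition_def * by (simp add: algebra_simps)
  qed (use C M in auto)
qed

end

locale centered_semigroup = centered_variable +
  assumes semigroup: "\<phi> \<in> Cb_Lip \<Longrightarrow> 0 \<le> s \<Longrightarrow> 0 \<le> t \<Longrightarrow>
    transition Y (sqrt s) (transition Y (sqrt t) \<phi>) x = transition Y (sqrt (s + t)) \<phi> x"
begin

text \<open>Super- and subsolutions of \<open>\<partial>\<^sub>t u = G (\<partial>\<^sub>x\<^sub>x u)\<close> are treated together by the sign \<open>s\<close>.\<close>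

lemma transition_comparison:
  assumes evo: "evolution T U V W" and T: "0 \<le> T" and s: "s = 1 \<or> s = - 1"
    and le: "\<And>t x. t \<in> {0..T} \<Longrightarrow> s * G (W t x) \<le> s * V t x"
  shows "s * transition Y (sqrt T) (U 0) x \<le> s * U T x"
proof -
  obtain C U1 where C: "0 \<le> C" and U: "\<And>t. U t \<in> Cb_Lip"
    and time: "\<And>t h x. t \<in> {0..T} \<Longrightarrow> h \<in> {0..1} \<Longrightarrow> \<bar>U (t + h) x - U t x - h * V t x\<bar> \<le> C * h\<^sup>2"
    and "\<And>t x y. t \<in> {0..T} \<Longrightarrow> \<bar>U t (x + y) - U t x - U1 t x * y - W t x * y\<^sup>2 / 2\<bar> \<le> C * \<bar>y\<bar> ^ 3"
    by (rule evolutionE[OF evo]) blast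
  from evo obtain D where D: "0 \<le> D" and space:
    "\<And>t h x. t \<in> {0..T} \<Longrightarrow> 0 \<le> h \<Longrightarrow>
      \<bar>transition Y (sqrt h) (U t) x - U t x - h * G (W t x)\<bar> \<le> D * (h * sqrt h)"
    by (rule transition_expansion) blast
  have mono: "s * transition Y r \<phi> x \<le> s * transition Y r \<psi> x + c"
    if "\<phi> \<in> Cb_Lip" "\<psi> \<in> Cb_Lip" "\<And>x. s * \<phi> x \<le> s * \<psi> x + c" for r \<phi> \<psi> c x
  proof -
    have "transition Y r \<phi> x \<le> transition Y r (\<lambda>x. \<psi> x + c) x" if "s = 1"
      using that \<open>\<And>x. s * \<phi> x \<le> s * \<psi> x + c\<close> by (intro transition_mono Y_mem Cb_Lip_add Cb_Lip_const \<open>\<phi> \<in> _\<close> \<open>\<psi> \<in> _\<close>) simp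
    moreover have "transition Y r (\<lambda>x. \<psi> x + (- c)) x \<le> transition Y r \<phi> x" if "s = - 1"
    proof (intro transition_mono Y_mem Cb_Lip_add Cb_Lip_const \<open>\<phi> \<in> _\<close> \<open>\<psi> \<in> _\<close>)
      show "\<psi> x + - c \<le> \<phi> x" for x using that \<open>\<And>x. s * \<phi> x \<le> s * \<psi> x + c\<close>[of x] by simp
    qed
    ultimately show ?thesis using s transition_add_const[OF Y_mem that(2), of r c x]
      transition_add_const[OF Y_mem that(2), of r "- c" x] by auto
  qed
  \<comment> \<open>Time steps of length h = T / n, where T \<le> n keeps h in [0, 1]. One step has
    consistency error at most (C + D) h sqrt h, monotonicity passes it on without growth, and n
    steps accumulate T (C + D) sqrt h.\<close>
  have bound: "s * transition Y (sqrt T) (U 0) x \<le> s * U T x + T * (C + D) * sqrt (T / real n)"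
    if n: "0 < n" "T \<le> real n" for n :: nat
  proof -
    define h where "h = T / real n"
    have h: "0 \<le> h" "h \<le> 1" using n T by (auto simp: h_def)
    have "s * transition Y (sqrt (real k * h)) (U 0) x \<le> s * U (real k * h) x + real k * ((C + D) * (h * sqrt h))"
      if "k \<le> n" for k x
      using that
    proof (induction k arbitrary: x)
      case (Suc k)
      let ?t = "real k * h" and ?e = "(C + D) * (h * sqrt h)"
      have "real k * T \<le> real n * T" using Suc.prems T by (intro mult_right_mono) auto
      then have t: "?t \<in> {0..T}" using h T n by (auto simp: h_def field_simps)
      have hh: "C * h\<^sup>2 \<le> C * (h * sqrt h)"
      proof -
        have "h \<le> sqrt h" using h by (metis real_sqrt_ge_0_iff real_sqrt_le_1_iff mult_left_le real_sqrt_mult_self abs_of_nonneg)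
        then show ?thesis using C h by (auto simp: power2_eq_square intro!: mult_left_mono)
      qed
      have "s * transition Y (sqrt (real (Suc k) * h)) (U 0) x
          = s * transition Y (sqrt h) (transition Y (sqrt ?t) (U 0)) x"
        using semigroup[OF U, of h ?t] h by (simp add: algebra_simps)
      also have "\<dots> \<le> s * transition Y (sqrt h) (U ?t) x + real k * ?e"
        using Suc by (intro mono transition_Cb_Lip Y_mem U) simp
      also have "s * transition Y (sqrt h) (U ?t) x \<le> s * U ?t x + h * (s * G (W ?t x)) + D * (h * sqrt h)"
        using space[OF t h(1), of x] s by (auto simp: abs_le_iff algebra_simps)
      also have "h * (s * G (W ?t x)) \<le> h * (s * V ?t x)" by (rule mult_left_mono[OF le[OF t] h(1)])
      also have "s * U ?t x + h * (s * V ?t x) \<le> s * U (?t + h) x + C * h\<^sup>2"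
        using time[OF t, of h x] h s by (auto simp: abs_le_iff algebra_simps)
      finally have "s * transition Y (sqrt (real (Suc k) * h)) (U 0) x
          \<le> s * U (?t + h) x + C * h\<^sup>2 + D * (h * sqrt h) + real k * ?e" by simp
      moreover have "s * U (?t + h) x = s * U (real (Suc k) * h) x" by (simp add: algebra_simps)
      ultimately have "s * transition Y (sqrt (real (Suc k) * h)) (U 0) x
          \<le> s * U (real (Suc k) * h) x + (C * (h * sqrt h) + D * (h * sqrt h) + real k * ?e)"
        using hh by linarith
      also have "C * (h * sqrt h) + D * (h * sqrt h) + real k * ?e = real (Suc k) * ?e"
        by (simp add: algebra_simps)
      finally show ?case .
    qed simp
    from this[of n x] n show ?thesis by (simp add: h_def mult.assoc mult.left_commute)
  qed
  have "s * transition Y (sqrt T) (U 0) x \<le> s * U T x + T * (C + D) * sqrt 0"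
  proof (rule LIMSEQ_le_const)
    show "(\<lambda>n. s * U T x + T * (C + D) * sqrt (T / real n)) \<longlonglongrightarrow> s * U T x + T * (C + D) * sqrt 0"
      by (intro tendsto_intros lim_const_over_n)
    obtain N :: nat where N: "T \<le> real N" using real_arch_simple by blast
    show "\<exists>N. \<forall>n\<ge>N. s * transition Y (sqrt T) (U 0) x \<le> s * U T x + T * (C + D) * sqrt (T / real n)"
    proof (intro exI allI impI)
      fix n assume "Suc N \<le> n"
      then show "s * transition Y (sqrt T) (U 0) x \<le> s * U T x + T * (C + D) * sqrt (T / real n)"
        by (intro bound order_trans[OF N]) auto
    qed
  qed
  then show ?thesis by simp
qed

end

section \<open>The range of the transition operators is dense\<close>

lemma sum_list_abs_le:
  fixes f g :: "'a \<Rightarrow> real"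
  assumes "\<And>i. i \<in> set l \<Longrightarrow> \<bar>f i\<bar> \<le> g i"
  shows "\<bar>\<Sum>i\<leftarrow>l. f i\<bar> \<le> (\<Sum>i\<leftarrow>l. g i)"
  using assms by (induction l) (auto intro!: order_trans[OF abs_triangle_ineq] add_mono)

lemma sum_list_linear:
  fixes f g :: "'a \<Rightarrow> real"
  shows "(\<Sum>i\<leftarrow>l. a * f i + g i) = a * (\<Sum>i\<leftarrow>l. f i) + (\<Sum>i\<leftarrow>l. g i)"
  by (induction l) (auto simp: algebra_simps)

text \<open>Amplitude, frequency and phase, in this order.\<close>

type_synonym mode = "real \<times> real \<times> real"

definition wave :: "mode \<Rightarrow> real \<Rightarrow> real" where
  "wave i x = fst i * cos (fst (snd i) * x + snd (snd i))"

abbreviation freq :: "mode \<Rightarrow> real" where "freq i \<equiv> fst (snd i)"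

text \<open>Dominates a wave continued backwards by the heat equation, with up to four frequency
  factors: two from the coefficient of the corrector and two from differentiating it once in time or
  twice in space. It is used with q / 2 * T in place of T, since the diffusivity h is at most q /
  2.\<close>

definition wave_bound :: "real \<Rightarrow> mode \<Rightarrow> real" where
  "wave_bound T i = \<bar>fst i\<bar> * (1 + \<bar>freq i\<bar>) ^ 4 * exp ((freq i)\<^sup>2 * T)"

context centered_semigroup
begin

text \<open>The slow waves are carried by a large and rapidly oscillating pattern \<open>\<Phi> (m * x)\<close> which dominates the second
  derivative, so that the sign of \<open>\<Phi>2\<close> selects the variance and the nonlinear equation acts on the waves as the linear
  equation with a rapidly oscillating coefficient. Its homogenized equation is \<open>\<partial>\<^sub>t u = h * \<partial>\<^sub>x\<^sub>x u\<close>, with the corrector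
  \<open>\<eta> (m * x) / m\<^sup>2\<close>. The amplitude of the pattern at the final time is only \<open>A / m\<^sup>2\<close>. The term with \<open>\<theta>\<close> absorbs the
  error made where \<open>\<Phi>2\<close> is close to \<open>0\<close>.\<close>

lemma transition_approximates_waves:
  fixes l :: "mode list" and \<epsilon> R B B' A T m h :: real
  defines "q \<equiv> upper_var E Y"
  defines "K \<equiv> (\<Sum>i\<leftarrow>l. wave_bound (q / 2 * T) i)"
  assumes \<Phi>: "C2_Lip \<Phi> \<Phi>1 \<Phi>2" "\<And>x. \<bar>\<Phi> x\<bar> \<le> R"
    and \<eta>: "C2_Lip \<eta> \<eta>1 \<eta>2" "\<And>x. \<bar>\<eta> x\<bar> \<le> B" "\<And>x. \<bar>\<eta>1 x\<bar> \<le> B"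
    and \<theta>: "C2_Lip \<theta> \<theta>1 \<theta>2" "\<And>x. \<bar>\<theta> x\<bar> \<le> B'"
    and pars: "1 \<le> m" "0 \<le> A" "0 \<le> T" "0 \<le> h" "h \<le> q / 2" "0 \<le> \<epsilon>"
    and dominated: "\<And>y M n. A \<le> M \<Longrightarrow> M \<le> A * exp (m\<^sup>2 / 2 * T) \<Longrightarrow> \<bar>n\<bar> \<le> K \<Longrightarrow>
      \<bar>G (M * \<Phi>2 y + (1 + \<eta>2 y) * n) + M / 2 * \<Phi> y - h * n\<bar> + G (\<theta>2 y) \<le> \<epsilon>"
  shows "\<exists>\<psi>\<in>Cb_Lip. \<forall>x. \<bar>transition Y (sqrt T) \<psi> x - (\<Sum>i\<leftarrow>l. wave i x)\<bar>
    \<le> (A * R + B * K + 3 * B') / m\<^sup>2 + (\<epsilon> + 2 * q * B * K / m) * T"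
proof -
  have q: "0 \<le> q" using var_bounds by (simp add: q_def)
  have B: "0 \<le> B" using \<eta>(2)[of 0] by linarith
  have m0: "m \<noteq> 0" "0 < m" using pars by auto
  define e where "e = \<epsilon> + 2 * q * B * K / m"
  \<comment> \<open>Amplification from running the heat equation of diffusivity h backwards from
    time T to 0; at time T the wave has its own amplitude again.\<close>
  define a where "a i = exp (h * (freq i)\<^sup>2 * T)" for i :: mode
  define S where "S i x = fst i * sin (freq i * x + snd (snd i))" for i :: mode and x
  define k2 where "k2 i = (freq i)\<^sup>2" for i :: mode
  \<comment> \<open>Wave plus corrector: - k^2 times the wave is its second derivative, multiplied
    by \<eta>(m x) / m^2. The second derivative of the sum is (1 + \<eta>2) times that of the wave,
    up to terms of order 1/m.\<close>
  define g where "g i x = a i * (wave i x + (- k2 i / m\<^sup>2) * (\<eta> (m * x) * wave i x))" for i x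
  define g1 where "g1 i x = a i * (- freq i * S i x + (- k2 i / m\<^sup>2) * ((m * \<eta>1 (m * x)) * wave i x + \<eta> (m * x) * (- freq i * S i x)))" for i x
  define g2 where "g2 i x = a i * (- k2 i * wave i x + (- k2 i / m\<^sup>2) * ((m\<^sup>2 * \<eta>2 (m * x)) * wave i x
      + 2 * ((m * \<eta>1 (m * x)) * (- freq i * S i x)) + \<eta> (m * x) * (- k2 i * wave i x)))" for i x
  \<comment> \<open>Amplitude of the curvature of the pattern, m^2 times that of the pattern itself;
    it decreases from A exp(m^2 T / 2) at time 0 to A at time T.\<close>
  define M where "M t = A * exp (m\<^sup>2 / 2 * T) * exp (- (m\<^sup>2 / 2) * t)" for t
  \<comment> \<open>A supersolution for s = 1 and a subsolution for s = -1. The drift s e t pays for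
    the uniform errors, the barrier s \<theta> / m^2 for the local one near the zeros of
    \<Phi>2.\<close>
  define U where "U s t x = exp (- (m\<^sup>2 / 2) * t) * (A * exp (m\<^sup>2 / 2 * T) / m\<^sup>2 * \<Phi> (m * x))
      + (\<Sum>i\<leftarrow>l. exp (- (h * k2 i) * t) * g i x) + (s / m\<^sup>2 * \<theta> (m * x) + s * e * t)" for s t x
  define V where "V s t x = - (m\<^sup>2 / 2) * exp (- (m\<^sup>2 / 2) * t) * (A * exp (m\<^sup>2 / 2 * T) / m\<^sup>2 * \<Phi> (m * x))
      + (\<Sum>i\<leftarrow>l. - (h * k2 i) * exp (- (h * k2 i) * t) * g i x) + (0 + s * e)" for s and t x :: real
  define W where "W s t x = exp (- (m\<^sup>2 / 2) * t) * (A * exp (m\<^sup>2 / 2 * T) / m\<^sup>2 * (m\<^sup>2 * \<Phi>2 (m * x)))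
      + (\<Sum>i\<leftarrow>l. exp (- (h * k2 i) * t) * g2 i x) + (s / m\<^sup>2 * (m\<^sup>2 * \<theta>2 (m * x)) + 0)" for s t x :: real
  have wave: "C2_Lip (wave i) (\<lambda>x. - freq i * S i x) (\<lambda>x. - k2 i * wave i x)" for i
  proof -
    have "C2_Lip (wave i) (\<lambda>x. fst i * (freq i * - sin (freq i * x + snd (snd i))))
        (\<lambda>x. fst i * ((freq i)\<^sup>2 * - cos (freq i * x + snd (snd i))))"
      unfolding wave_def[abs_def] by (intro C2_Lip_cmult C2_Lip_affine C2_Lip_cos)
    then show ?thesis by (simp add: wave_def[abs_def] S_def[abs_def] k2_def algebra_simps)
  qed
  have scaled: "C2_Lip (\<lambda>x. f (m * x)) (\<lambda>x. m * f1 (m * x)) (\<lambda>x. m\<^sup>2 * f2 (m * x))" if "C2_Lip f f1 f2" for f f1 f2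
    using C2_Lip_affine[OF that, of m 0] by simp
  have g: "C2_Lip (g i) (g1 i) (g2 i)" for i
    unfolding g_def[abs_def] g1_def[abs_def] g2_def[abs_def]
    by (intro C2_Lip_cmult C2_Lip_add wave C2_Lip_mult scaled \<eta>(1))
  have evo: "evolution T (U s) (V s) (W s)" for s
    unfolding U_def[abs_def] V_def[abs_def] W_def[abs_def]
    by (intro evolution_add evolution_sum_list evolution_time evolution_exp[OF g]
        evolution_exp[OF C2_Lip_cmult[OF scaled[OF \<Phi>(1)]]] evolution_space[OF C2_Lip_cmult[OF scaled[OF \<theta>(1)]]])
  have wave_le: "\<bar>wave i x\<bar> \<le> \<bar>fst i\<bar>" "\<bar>S i x\<bar> \<le> \<bar>fst i\<bar>" for i x
    unfolding wave_def S_def abs_mult by (auto intro!: mult_left_le)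
  have KK: "\<bar>r\<bar> * \<bar>freq i\<bar> ^ j * (exp (- (h * k2 i) * t) * a i) \<le> wave_bound (q / 2 * T) i"
    if "\<bar>r\<bar> \<le> \<bar>fst i\<bar>" "j \<le> 4" "0 \<le> t" for r i j t
  proof -
    have "h * (freq i)\<^sup>2 * T \<le> q / 2 * (freq i)\<^sup>2 * T" using pars by (intro mult_right_mono) auto
    moreover have "0 \<le> h * k2 i * t" using pars that by (simp add: k2_def)
    ultimately have "exp (- (h * k2 i) * t) * a i \<le> exp ((freq i)\<^sup>2 * (q / 2 * T))"
      unfolding a_def exp_add[symmetric] by (simp add: algebra_simps)
    moreover have "\<bar>freq i\<bar> ^ j \<le> (1 + \<bar>freq i\<bar>) ^ 4"
      by (rule order_trans[OF power_mono[of _ "1 + \<bar>freq i\<bar>"] power_increasing]) (use that in auto)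
    ultimately show ?thesis unfolding wave_bound_def using that
      by (intro mult_mono) (auto simp: a_def)
  qed
  have le: "s * G (W s t x) \<le> s * V s t x" if s: "s = 1 \<or> s = - 1" and t: "t \<in> {0..T}" for s t x
  proof -
    define w where "w i = exp (- (h * k2 i) * t) * a i" for i
    define n where "n = (\<Sum>i\<leftarrow>l. - k2 i * w i * wave i x)"
    \<comment> \<open>What the corrector leaves over: r1 in the time derivative, r2 in the second
      space derivative, each with at least one factor 1/m.\<close>
    define r1 where "r1 i = w i * (h * (k2 i)\<^sup>2 / m\<^sup>2 * (\<eta> (m * x) * wave i x))" for i
    define r2 where "r2 i = w i * (2 * k2 i * freq i / m * (\<eta>1 (m * x) * S i x) + (k2 i)\<^sup>2 / m\<^sup>2 * (\<eta> (m * x) * wave i x))" for i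
    have V_eq: "V s t x = - (M t / 2 * \<Phi> (m * x)) + h * n + (\<Sum>i\<leftarrow>l. r1 i) + s * e"
    proof -
      have "(\<Sum>i\<leftarrow>l. - (h * k2 i) * exp (- (h * k2 i) * t) * g i x) = (\<Sum>i\<leftarrow>l. h * (- k2 i * w i * wave i x) + r1 i)"
        by (rule arg_cong[of _ _ sum_list], rule map_cong)
           (auto simp: g_def w_def r1_def power2_eq_square field_simps)
      then show ?thesis using m0 unfolding sum_list_linear by (simp add: V_def M_def n_def)
    qed
    have W_eq: "W s t x = (M t * \<Phi>2 (m * x) + (1 + \<eta>2 (m * x)) * n) + (\<Sum>i\<leftarrow>l. r2 i) + s * \<theta>2 (m * x)"
    proof -
      have "(\<Sum>i\<leftarrow>l. exp (- (h * k2 i) * t) * g2 i x) = (\<Sum>i\<leftarrow>l. (1 + \<eta>2 (m * x)) * (- k2 i * w i * wave i x) + r2 i)"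
        using m0 by (intro arg_cong[of _ _ sum_list] map_cong)
           (auto simp: g2_def w_def r2_def power2_eq_square field_simps)
      then show ?thesis using m0 unfolding sum_list_linear by (simp add: W_def M_def n_def)
    qed
    have n: "\<bar>n\<bar> \<le> K"
      unfolding n_def K_def
    proof (rule sum_list_abs_le)
      fix i
      show "\<bar>- k2 i * w i * wave i x\<bar> \<le> wave_bound (q / 2 * T) i"
        using KK[OF wave_le(1), of 2 t i x] t by (simp add: abs_mult k2_def w_def a_def algebra_simps)
    qed
    have r1: "\<bar>\<Sum>i\<leftarrow>l. r1 i\<bar> \<le> q / 2 * (B / m * K)"
    proof -
      have "\<bar>\<Sum>i\<leftarrow>l. r1 i\<bar> \<le> (\<Sum>i\<leftarrow>l. q / 2 * B / m * wave_bound (q / 2 * T) i)"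
      proof (rule sum_list_abs_le)
        fix i
        have "\<bar>r1 i\<bar> = h * \<bar>\<eta> (m * x)\<bar> / m\<^sup>2 * (\<bar>wave i x\<bar> * \<bar>freq i\<bar> ^ 4 * w i)"
          using pars by (simp add: r1_def abs_mult w_def a_def k2_def power_mult[symmetric] algebra_simps)
        also have "\<dots> \<le> (q / 2 * B / m) * wave_bound (q / 2 * T) i"
        proof (rule mult_mono)
          have "m * 1 \<le> m * m" using pars by (intro mult_left_mono) auto
          then have "h * \<bar>\<eta> (m * x)\<bar> / m\<^sup>2 \<le> h * \<bar>\<eta> (m * x)\<bar> / m"
            using pars by (intro divide_left_mono) (auto simp: power2_eq_square)
          also have "\<dots> \<le> q / 2 * B / m"
            using pars \<eta>(2)[of "m * x"] B q by (intro divide_right_mono mult_mono) auto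
          finally show "h * \<bar>\<eta> (m * x)\<bar> / m\<^sup>2 \<le> q / 2 * B / m" .
          show "\<bar>wave i x\<bar> * \<bar>freq i\<bar> ^ 4 * w i \<le> wave_bound (q / 2 * T) i"
            using KK[OF wave_le(1), of 4 t i x] t by (simp add: w_def)
        qed (use pars q B in \<open>auto simp: w_def a_def\<close>)
        finally show "\<bar>r1 i\<bar> \<le> q / 2 * B / m * wave_bound (q / 2 * T) i" .
      qed
      then show ?thesis unfolding sum_list_const_mult K_def[symmetric] by simp
    qed
    have r2: "\<bar>\<Sum>i\<leftarrow>l. r2 i\<bar> \<le> 3 * (B / m * K)"
    proof -
      have "\<bar>\<Sum>i\<leftarrow>l. r2 i\<bar> \<le> (\<Sum>i\<leftarrow>l. 3 * B / m * wave_bound (q / 2 * T) i)"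
      proof (rule sum_list_abs_le)
        fix i
        let ?b = "wave_bound (q / 2 * T) i"
        have "\<bar>r2 i\<bar> \<le> 2 * (\<bar>\<eta>1 (m * x)\<bar> / m * (\<bar>S i x\<bar> * \<bar>freq i\<bar> ^ 3 * w i))
            + \<bar>\<eta> (m * x)\<bar> / m\<^sup>2 * (\<bar>wave i x\<bar> * \<bar>freq i\<bar> ^ 4 * w i)"
        proof -
          have "r2 i = w i * (2 * k2 i * freq i / m * (\<eta>1 (m * x) * S i x)) + w i * ((k2 i)\<^sup>2 / m\<^sup>2 * (\<eta> (m * x) * wave i x))"
            by (simp add: r2_def distrib_left)
          moreover have "\<bar>w i * (2 * k2 i * freq i / m * (\<eta>1 (m * x) * S i x))\<bar> = 2 * (\<bar>\<eta>1 (m * x)\<bar> / m * (\<bar>S i x\<bar> * \<bar>freq i\<bar> ^ 3 * w i))"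
            using m0 by (simp add: abs_mult w_def a_def k2_def power2_eq_square power3_eq_cube algebra_simps)
          moreover have "\<bar>w i * ((k2 i)\<^sup>2 / m\<^sup>2 * (\<eta> (m * x) * wave i x))\<bar> = \<bar>\<eta> (m * x)\<bar> / m\<^sup>2 * (\<bar>wave i x\<bar> * \<bar>freq i\<bar> ^ 4 * w i)"
            by (simp add: abs_mult w_def a_def k2_def power_mult[symmetric] algebra_simps)
          ultimately show ?thesis by (metis abs_triangle_ineq)
        qed
        also have "\<dots> \<le> 2 * (B / m * ?b) + B / m * ?b"
        proof (intro add_mono mult_left_mono mult_mono)
          show "\<bar>\<eta>1 (m * x)\<bar> / m \<le> B / m" using \<eta>(3) m0 by (intro divide_right_mono) auto
          have "m * 1 \<le> m * m" using pars by (intro mult_left_mono) auto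
          then have "\<bar>\<eta> (m * x)\<bar> / m\<^sup>2 \<le> \<bar>\<eta> (m * x)\<bar> / m"
            using pars by (intro divide_left_mono) (auto simp: power2_eq_square)
          also have "\<dots> \<le> B / m" using \<eta>(2) m0 by (intro divide_right_mono) auto
          finally show "\<bar>\<eta> (m * x)\<bar> / m\<^sup>2 \<le> B / m" .
          show "\<bar>S i x\<bar> * \<bar>freq i\<bar> ^ 3 * w i \<le> ?b" using KK[OF wave_le(2), of 3 t i x] t by (simp add: w_def)
          show "\<bar>wave i x\<bar> * \<bar>freq i\<bar> ^ 4 * w i \<le> ?b" using KK[OF wave_le(1), of 4 t i x] t by (simp add: w_def)
        qed (use m0 B in \<open>auto simp: w_def a_def\<close>)
        finally show "\<bar>r2 i\<bar> \<le> 3 * B / m * ?b" by simp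
      qed
      then show ?thesis unfolding sum_list_const_mult K_def[symmetric] by simp
    qed
    have Mt: "A \<le> M t" "M t \<le> A * exp (m\<^sup>2 / 2 * T)"
    proof -
      have "- (m\<^sup>2 / 2) * t + m\<^sup>2 / 2 * T = m\<^sup>2 / 2 * (T - t)" by (simp add: right_diff_distrib)
      then have "exp (m\<^sup>2 / 2 * T) * exp (- (m\<^sup>2 / 2) * t) = exp (m\<^sup>2 / 2 * (T - t))"
        by (metis exp_add mult.commute)
      then have M: "M t = A * exp (m\<^sup>2 / 2 * (T - t))" unfolding M_def by (simp only: mult.assoc)
      have le: "0 \<le> m\<^sup>2 / 2 * (T - t)" "m\<^sup>2 / 2 * (T - t) \<le> m\<^sup>2 / 2 * T"
        using t by (auto intro!: mult_left_mono)
      then have "1 \<le> exp (m\<^sup>2 / 2 * (T - t))" "exp (m\<^sup>2 / 2 * (T - t)) \<le> exp (m\<^sup>2 / 2 * T)"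
        by (simp_all only: one_le_exp_iff exp_le_cancel_iff)
      from mult_left_mono[OF this(1) pars(2)] mult_left_mono[OF this(2) pars(2)]
      show "A \<le> M t" "M t \<le> A * exp (m\<^sup>2 / 2 * T)" unfolding M by simp_all
    qed
    let ?p = "M t * \<Phi>2 (m * x) + (1 + \<eta>2 (m * x)) * n" and ?R2 = "\<Sum>i\<leftarrow>l. r2 i"
    note dom = dominated[OF Mt n, of "m * x"]
    have sub: "G (u + v) \<le> G u + G v" for u v using var_bounds by (rule generator_subadditive)
    have gR: "G z \<le> q / 2 * (3 * (B / m * K))" if "\<bar>z\<bar> = \<bar>?R2\<bar>" for z
    proof -
      have "G z \<le> q / 2 * \<bar>z\<bar>" unfolding q_def using var_bounds by (intro generator_le) auto
      also have "\<dots> \<le> q / 2 * (3 * (B / m * K))" using r2 that q by (intro mult_left_mono) auto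
      finally show ?thesis .
    qed
    \<comment> \<open>The term 2 q B K / m of e is shared out: three quarters for G of the remainder
      r2 and one quarter for r1.\<close>
    have e2: "e = \<epsilon> + q / 2 * (3 * (B / m * K)) + q / 2 * (B / m * K)"
      by (simp add: e_def algebra_simps)
    from s show ?thesis
    proof
      assume s: "s = 1"
      have w: "W s t x = ?p + ?R2 + \<theta>2 (m * x)" using W_eq s by simp
      have v: "V s t x = - (M t / 2 * \<Phi> (m * x)) + h * n + (\<Sum>i\<leftarrow>l. r1 i) + e" using V_eq s by simp
      have "G (W s t x) \<le> G ?p + G ?R2 + G (\<theta>2 (m * x))"
        unfolding w using sub[of "?p + ?R2" "\<theta>2 (m * x)"] sub[of ?p ?R2] by linarith
      then have "G (W s t x) \<le> V s t x"
        using gR[of ?R2] dom r1 e2 unfolding v by linarith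
      then show ?thesis using s by simp
    next
      assume s: "s = - 1"
      \<comment> \<open>Subadditivity only bounds from above, so the lower bound for G(W) comes from
        splitting \<open>?p\<close>. With s = -1 the barrier again enters as + \<theta>2, and the
        same inequality for G(\<theta>2) serves both signs.\<close>
      have w: "?p = W s t x + (- ?R2) + \<theta>2 (m * x)" using W_eq s by simp
      have v: "V s t x = - (M t / 2 * \<Phi> (m * x)) + h * n + (\<Sum>i\<leftarrow>l. r1 i) - e" using V_eq s by simp
      have "G ?p \<le> G (W s t x) + G (- ?R2) + G (\<theta>2 (m * x))"
        unfolding w using sub[of "W s t x + (- ?R2)" "\<theta>2 (m * x)"] sub[of "W s t x" "- ?R2"] by linarith
      moreover have "G (- ?R2) \<le> q / 2 * (3 * (B / m * K))" by (rule gR) simp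
      ultimately have "V s t x \<le> G (W s t x)"
        using dom r1 e2 unfolding v by linarith
      then show ?thesis using s by simp
    qed
  qed
  have final: "\<bar>U s T x - (\<Sum>i\<leftarrow>l. wave i x)\<bar> \<le> (A * R + B * K + B') / m\<^sup>2 + e * T"
    if s: "s = 1 \<or> s = - 1" and e: "0 \<le> e" for s x
  proof -
    define r where "r i = (exp (- (h * k2 i) * T) * a i) * (- k2 i / m\<^sup>2 * (\<eta> (m * x) * wave i x))" for i
    have one: "exp (- (h * k2 i) * T) * a i = 1" for i
      by (simp add: a_def k2_def exp_minus)
    have "(\<Sum>i\<leftarrow>l. exp (- (h * k2 i) * T) * g i x) = (\<Sum>i\<leftarrow>l. 1 * wave i x + r i)"
      unfolding g_def r_def mult.assoc[symmetric] one by (simp add: distrib_left)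
    then have eq: "U s T x - (\<Sum>i\<leftarrow>l. wave i x) = A / m\<^sup>2 * \<Phi> (m * x) + (\<Sum>i\<leftarrow>l. r i) + s / m\<^sup>2 * \<theta> (m * x) + s * e * T"
      unfolding sum_list_linear by (simp add: U_def exp_minus)
    have "\<bar>\<Sum>i\<leftarrow>l. r i\<bar> \<le> (\<Sum>i\<leftarrow>l. B / m\<^sup>2 * wave_bound (q / 2 * T) i)"
    proof (rule sum_list_abs_le)
      fix i
      have "\<bar>r i\<bar> = \<bar>\<eta> (m * x)\<bar> / m\<^sup>2 * (\<bar>wave i x\<bar> * \<bar>freq i\<bar> ^ 2 * (exp (- (h * k2 i) * T) * a i))"
        unfolding r_def one by (simp add: abs_mult k2_def algebra_simps)
      also have "\<dots> \<le> B / m\<^sup>2 * wave_bound (q / 2 * T) i"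
        using \<eta>(2) m0 B pars by (intro mult_mono KK wave_le divide_right_mono) (auto simp: a_def)
      finally show "\<bar>r i\<bar> \<le> B / m\<^sup>2 * wave_bound (q / 2 * T) i" .
    qed
    then have 1: "\<bar>\<Sum>i\<leftarrow>l. r i\<bar> \<le> B * K / m\<^sup>2"
      unfolding sum_list_const_mult K_def[symmetric] by simp
    have 2: "\<bar>A / m\<^sup>2 * \<Phi> (m * x)\<bar> \<le> A * R / m\<^sup>2"
      using \<Phi>(2)[of "m * x"] pars by (simp add: abs_mult divide_right_mono mult_left_mono)
    have 3: "\<bar>s / m\<^sup>2 * \<theta> (m * x)\<bar> \<le> B' / m\<^sup>2"
      using \<theta>(2)[of "m * x"] s by (auto simp: abs_mult divide_right_mono)
    have 4: "\<bar>s * e * T\<bar> \<le> e * T" using s e pars by (auto simp: abs_mult)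
    show ?thesis unfolding eq add_divide_distrib using 1 2 3 4 by linarith
  qed
  have e: "0 \<le> e"
  proof -
    have K: "0 \<le> K" unfolding K_def by (rule sum_list_nonneg) (auto simp: wave_bound_def)
    then show ?thesis using pars q B by (simp add: e_def)
  qed
  have U0: "U s t \<in> Cb_Lip" for s t using evo by (auto simp: evolution_def)
  show ?thesis
  \<comment> \<open>The initial value of the supersolution is the witness. That of the subsolution
    lies within 2 B' / m^2 of it, and contraction transfers its lower bound; this accounts for the 3
    in 3 B'.\<close>
  proof (intro bexI[of _ "U 1 0"] allI U0)
    fix x
    let ?w = "\<Sum>i\<leftarrow>l. wave i x" and ?b = "(A * R + B * K + B') / m\<^sup>2 + e * T"
    have up: "transition Y (sqrt T) (U 1 0) x \<le> U 1 T x"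
      using transition_comparison[OF evo pars(3) _ le[of 1], of x] by simp
    have low: "U (- 1) T x \<le> transition Y (sqrt T) (U (- 1) 0) x"
      using transition_comparison[OF evo pars(3) _ le[of "- 1"], of x] by simp
    have "\<bar>U (- 1) 0 z - U 1 0 z\<bar> \<le> 2 * B' / m\<^sup>2" for z
    proof -
      have "U (- 1) 0 z - U 1 0 z = - (2 / m\<^sup>2) * \<theta> (m * z)" by (simp add: U_def)
      also have "\<bar>\<dots>\<bar> \<le> 2 * B' / m\<^sup>2"
        using \<theta>(2)[of "m * z"] by (simp add: abs_mult divide_right_mono)
      finally show ?thesis .
    qed
    then have "\<bar>transition Y (sqrt T) (U (- 1) 0) x - transition Y (sqrt T) (U 1 0) x\<bar> \<le> 2 * B' / m\<^sup>2"
      by (intro transition_diff_le Y_mem U0)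
    moreover have "(A * R + B * K + 3 * B') / m\<^sup>2 = (A * R + B * K + B') / m\<^sup>2 + 2 * B' / m\<^sup>2"
      by (simp add: add_divide_distrib)
    moreover have "0 \<le> 2 * B' / m\<^sup>2"
      using \<theta>(2)[of 0] abs_ge_zero[of "\<theta> 0"] by (intro divide_nonneg_nonneg zero_le_power2) linarith
    ultimately show "\<bar>transition Y (sqrt T) (U 1 0) x - ?w\<bar>
        \<le> (A * R + B * K + 3 * B') / m\<^sup>2 + (\<epsilon> + 2 * q * B * K / m) * T"
      using up low final[of 1 x] final[of "- 1" x] e unfolding e_def[symmetric] by linarith
  qed
qed

end

lemma generator_diff_le:
  assumes "0 \<le> p" "p \<le> q"
  shows "\<bar>generator p q (u + v) - generator p q u\<bar> \<le> q / 2 * \<bar>v\<bar>"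
proof -
  have "generator p q v \<le> q / 2 * \<bar>v\<bar>" "generator p q (- v) \<le> q / 2 * \<bar>v\<bar>"
    using generator_le[of p q v] generator_le[of p q "- v"] assms by simp_all
  moreover have "generator p q u \<le> generator p q (u + v) + generator p q (- v)"
    using generator_subadditive[OF assms, of "u + v" "- v"] by simp
  ultimately show ?thesis
    using generator_subadditive[OF assms, of u v] unfolding abs_le_iff by linarith
qed

lemma sum_wave_bound_nonneg: "0 \<le> (\<Sum>i\<leftarrow>l. wave_bound T i)"
  by (rule sum_list_nonneg) (auto simp: wave_bound_def)

text \<open>Chooses m once C, D and e' are fixed: e' T takes half of the tolerance, and the rest is
  at most (C + D T) / m, because m \<ge> 1 gives C / m^2 \<le> C / m.\<close>

lemma large_frequency:
  fixes C D e e' T :: real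
  assumes "0 \<le> C" "0 < e" "e' * T \<le> e / 2"
  obtains m where "1 \<le> m" "C / m\<^sup>2 + (e' + D / m) * T \<le> e"
proof -
  define m where "m = max 1 (2 * (C + D * T) / e)"
  have m: "1 \<le> m" by (simp add: m_def)
  have "2 * (C + D * T) / e \<le> m" by (simp add: m_def)
  then have "C + D * T \<le> e / 2 * m" using assms(2) by (simp add: pos_divide_le_eq algebra_simps)
  then have "(C + D * T) / m \<le> e / 2" using m by (simp add: pos_divide_le_eq)
  moreover have "C / m\<^sup>2 \<le> C / m"
    using m assms(1) mult_left_mono[of 1 m m] by (intro divide_left_mono) (auto simp: power2_eq_square)
  moreover have "(C + D * T) / m = C / m + D * T / m" by (rule add_divide_distrib)
  moreover have "(e' + D / m) * T = e' * T + D * T / m" by (simp add: distrib_right)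
  ultimately have "C / m\<^sup>2 + (e' + D / m) * T \<le> e" using assms(3) by linarith
  with m show ?thesis by (rule that)
qed

text \<open>\<open>\<delta>\<^sup>2 * (u * arctan u - ln (1 + u\<^sup>2) / 2)\<close> with \<open>u = z / \<delta>\<close> has slope at most \<open>2 * \<delta>\<close>, but its second derivative is at
  least \<open>1 / 2\<close> for \<open>\<bar>z\<bar> \<le> \<delta>\<close>.\<close>

lemma C2_Lip_arctan_barrier:
  assumes \<Phi>: "C2_Lip \<Phi> \<Phi>1 \<Phi>2" and \<delta>: "0 < \<delta>"
  shows "\<exists>\<theta> \<theta>1. C2_Lip \<theta> \<theta>1 (\<lambda>x. (\<Phi>1 x)\<^sup>2 / (1 + (\<Phi> x / \<delta>)\<^sup>2) + \<delta> * arctan (\<Phi> x / \<delta>) * \<Phi>2 x)"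
proof -
  define F where "F z = \<delta>\<^sup>2 * ((z / \<delta>) * arctan (z / \<delta>) - ln (1 + (z / \<delta>)\<^sup>2) / 2)" for z
  have pos: "0 < 1 + u\<^sup>2" for u :: real using zero_le_power2[of u] by linarith
  have dF: "(F has_real_derivative \<delta> * arctan (z / \<delta>)) (at z)" for z
  proof -
    have "((\<lambda>u. u * arctan u - ln (1 + u\<^sup>2) / 2) has_real_derivative arctan u) (at u)" for u
    proof -
      have "((\<lambda>u. 1 + u\<^sup>2) has_real_derivative 2 * u) (at u)"
        by (auto intro!: derivative_eq_intros)
      from DERIV_chain2[OF DERIV_ln[OF pos] this]
      have "((\<lambda>u. ln (1 + u\<^sup>2)) has_real_derivative inverse (1 + u\<^sup>2) * (2 * u)) (at u)" .
      then have "((\<lambda>u. u * arctan u - ln (1 + u\<^sup>2) / 2) has_real_derivative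
          (1 * arctan u + inverse (1 + u\<^sup>2) * u) - inverse (1 + u\<^sup>2) * (2 * u) / 2) (at u)"
        by (intro DERIV_diff DERIV_mult DERIV_ident DERIV_arctan DERIV_cdivide)
      then show ?thesis by simp
    qed
    note d = this
    have "((\<lambda>z. z / \<delta>) has_real_derivative 1 / \<delta>) (at z)" using \<delta> by (auto intro!: derivative_eq_intros)
    from DERIV_cmult[OF DERIV_chain2[OF d this], of "\<delta>\<^sup>2"]
    have "(F has_real_derivative \<delta>\<^sup>2 * (arctan (z / \<delta>) * (1 / \<delta>))) (at z)"
      unfolding F_def[abs_def] .
    moreover have "\<delta>\<^sup>2 * (arctan (z / \<delta>) * (1 / \<delta>)) = \<delta> * arctan (z / \<delta>)"
      using \<delta> by (simp add: power2_eq_square)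
    ultimately show ?thesis by (simp only:)
  qed
  have dA: "((\<lambda>z. \<delta> * arctan (z / \<delta>)) has_real_derivative 1 / (1 + (z / \<delta>)\<^sup>2)) (at z)" for z
  proof -
    have "((\<lambda>z. z / \<delta>) has_real_derivative 1 / \<delta>) (at z)" using \<delta> by (auto intro!: derivative_eq_intros)
    from DERIV_cmult[OF DERIV_chain2[OF DERIV_arctan this], of \<delta>]
    have "((\<lambda>z. \<delta> * arctan (z / \<delta>)) has_real_derivative \<delta> * (inverse (1 + (z / \<delta>)\<^sup>2) * (1 / \<delta>))) (at z)" .
    moreover have "\<delta> * (r * (1 / \<delta>)) = r" for r using \<delta> by simp
    ultimately show ?thesis by (simp only: inverse_eq_divide)
  qed
  have dQ: "((\<lambda>z. 1 / (1 + (z / \<delta>)\<^sup>2)) has_real_derivative - (2 * (z / \<delta>) / \<delta>) / (1 + (z / \<delta>)\<^sup>2)\<^sup>2) (at z)" for z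
  proof -
    have "((\<lambda>z. 1 + (z / \<delta>)\<^sup>2) has_real_derivative 2 * (z / \<delta>) / \<delta>) (at z)"
      using \<delta> by (auto intro!: derivative_eq_intros)
    from DERIV_inverse_fun[OF this] pos[of "z / \<delta>"]
    show ?thesis by (simp add: divide_inverse numeral_2_eq_2)
  qed
  have atan2: "\<bar>arctan u\<bar> \<le> 2" for u :: real
    using arctan_bounded[of u] pi_less_4 by (simp add: abs_le_iff)
  have A: "\<bar>\<delta> * arctan (z / \<delta>)\<bar> \<le> \<delta> * 2" for z
    using \<delta> atan2[of "z / \<delta>"] by (simp add: abs_mult)
  have Q: "\<bar>1 / (1 + (z / \<delta>)\<^sup>2)\<bar> \<le> 1" for z
  proof -
    have "1 / (1 + (z / \<delta>)\<^sup>2) \<le> 1 / 1" by (intro frac_le) auto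
    moreover have "0 \<le> 1 / (1 + (z / \<delta>)\<^sup>2)" using pos[of "z / \<delta>"] by (intro divide_nonneg_nonneg) auto
    ultimately show ?thesis by simp
  qed
  have dQ_le: "\<bar>- (2 * (z / \<delta>) / \<delta>) / (1 + (z / \<delta>)\<^sup>2)\<^sup>2\<bar> \<le> 1 / \<delta>" for z
  proof -
    have "2 * \<bar>u\<bar> / (1 + u\<^sup>2)\<^sup>2 \<le> 1" for u :: real
    proof -
      have "2 * \<bar>u\<bar> \<le> 1 + u\<^sup>2"
        using zero_le_power2[of "\<bar>u\<bar> - 1"] by (simp add: power2_diff)
      also have "\<dots> \<le> (1 + u\<^sup>2)\<^sup>2" by (rule self_le_power) auto
      finally show ?thesis using pos[of u] by (simp add: pos_divide_le_eq)
    qed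
    from divide_right_mono[OF this[of "z / \<delta>"], of \<delta>] \<delta> show ?thesis
      by (simp add: abs_mult abs_divide ac_simps)
  qed
  have \<Phi>_mem: "\<Phi> \<in> Cb_Lip" using \<Phi> by (simp add: C2_Lip_def)
  have lip: "(\<lambda>x. F (\<Phi> x)) \<in> Cb_Lip" "(\<lambda>x. \<delta> * arctan (\<Phi> x / \<delta>)) \<in> Cb_Lip" "(\<lambda>x. 1 / (1 + (\<Phi> x / \<delta>)\<^sup>2)) \<in> Cb_Lip"
    using Cb_Lip_lipschitz_compose[OF \<Phi>_mem lipschitz_of_deriv_bound[OF dF A]]
      Cb_Lip_lipschitz_compose[OF \<Phi>_mem lipschitz_of_deriv_bound[OF dA Q]]
      Cb_Lip_lipschitz_compose[OF \<Phi>_mem lipschitz_of_deriv_bound[OF dQ dQ_le]] \<delta>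
    by simp_all
  have d: "(\<Phi> has_real_derivative \<Phi>1 x) (at x)" "(\<Phi>1 has_real_derivative \<Phi>2 x) (at x)" for x
    using \<Phi> by (auto simp: C2_Lip_def)
  have mem: "\<Phi>1 \<in> Cb_Lip" "\<Phi>2 \<in> Cb_Lip" using \<Phi> by (auto simp: C2_Lip_def)
  have "C2_Lip (\<lambda>x. F (\<Phi> x)) (\<lambda>x. \<delta> * arctan (\<Phi> x / \<delta>) * \<Phi>1 x)
      (\<lambda>x. (1 / (1 + (\<Phi> x / \<delta>)\<^sup>2)) * (\<Phi>1 x * \<Phi>1 x) + \<delta> * arctan (\<Phi> x / \<delta>) * \<Phi>2 x)"
    unfolding C2_Lip_def
  proof (intro conjI allI lip Cb_Lip_add Cb_Lip_mult mem)
    show "((\<lambda>x. F (\<Phi> x)) has_real_derivative \<delta> * arctan (\<Phi> x / \<delta>) * \<Phi>1 x) (at x)" for x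
      by (rule DERIV_chain2[OF dF d(1)])
    show "((\<lambda>x. \<delta> * arctan (\<Phi> x / \<delta>) * \<Phi>1 x) has_real_derivative
        1 / (1 + (\<Phi> x / \<delta>)\<^sup>2) * (\<Phi>1 x * \<Phi>1 x) + \<delta> * arctan (\<Phi> x / \<delta>) * \<Phi>2 x) (at x)" for x
      using DERIV_mult[OF DERIV_chain2[OF dA d(1)] d(2), of x] by (simp add: algebra_simps)
  qed
  then show ?thesis by (auto simp: power2_eq_square)
qed

section \<open>Density when the lower variance is positive\<close>

context centered_semigroup
begin

text \<open>The pattern is an exact eigenfunction, G(\<Phi>2) = -\<Phi>/2. Where |\<Phi>| \<ge>
  \<delta> it fixes the sign of the curvature, G multiplies by p/2 or q/2, and f h n with f = 2/p or
  2/q contributes exactly h n. In the zone |\<Phi>| < \<delta> this fails by at most C0, and the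
  barrier, whose G is at most e' - C0 there, makes up for it.\<close>

lemma transition_dense_waves_positive:
  fixes l :: "mode list"
  assumes p: "0 < lower_var E Y" and T: "0 \<le> T" and e: "0 < e"
  shows "\<exists>\<psi>\<in>Cb_Lip. \<forall>x. \<bar>transition Y (sqrt T) \<psi> x - (\<Sum>i\<leftarrow>l. wave i x)\<bar> \<le> e"
proof -
  define p where "p = lower_var E Y"
  define q where "q = upper_var E Y"
  have pq: "0 < p" "p \<le> q" "0 < q" using p var_bounds by (auto simp: p_def q_def)
  define K where "K = (\<Sum>i\<leftarrow>l. wave_bound (q / 2 * T) i)"
  have K: "0 \<le> K" unfolding K_def by (rule sum_wave_bound_nonneg)
  define P where "P = pi * (sqrt p + sqrt q)"
  have P: "0 < P" using pq by (simp add: P_def add_pos_pos)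
  have sq: "0 < sqrt p" "0 < sqrt q" "sqrt p \<le> sqrt q" using pq by auto
  obtain \<Phi> \<Phi>1 where \<Phi>0: "C2_Lip \<Phi> \<Phi>1 (\<lambda>x. max 0 (- \<Phi> x) / (sqrt q)\<^sup>2 - max 0 (\<Phi> x) / (sqrt p)\<^sup>2)"
    and per: "\<And>x. \<Phi> (x + P) = \<Phi> x" and range: "\<And>x. - sqrt q \<le> \<Phi> x" "\<And>x. \<Phi> x \<le> sqrt p"
    and energy0: "\<And>x. (\<Phi>1 x)\<^sup>2 + (max 0 (- \<Phi> x) / sqrt q)\<^sup>2 + (max 0 (\<Phi> x) / sqrt p)\<^sup>2 = 1"
    by (rule half_wave_pattern[OF sq(1,2), folded P_def]) blast
  have \<Phi>: "C2_Lip \<Phi> \<Phi>1 (\<lambda>x. max 0 (- \<Phi> x) / q - max 0 (\<Phi> x) / p)"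
    using \<Phi>0 pq by simp
  have energy: "(\<Phi>1 x)\<^sup>2 + (max 0 (- \<Phi> x))\<^sup>2 / q + (max 0 (\<Phi> x))\<^sup>2 / p = 1" for x
    using energy0[of x] pq by (simp add: power_divide)
  define \<Phi>2 where "\<Phi>2 x = max 0 (- \<Phi> x) / q - max 0 (\<Phi> x) / p" for x
  note \<Phi>' = \<Phi>[folded \<Phi>2_def[abs_def]]
  have absR: "\<bar>\<Phi> x\<bar> \<le> sqrt q" for x using range[of x] sq unfolding abs_le_iff by linarith
  have "\<Phi>2 \<in> Cb_Lip" using \<Phi>' by (simp add: C2_Lip_def)
  then obtain R2 where R2: "\<And>x. \<bar>\<Phi>2 x\<bar> \<le> R2" by (rule Cb_LipE) blast
  have R20: "0 \<le> R2" using R2[of 0] by linarith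
  define \<rho> where "\<rho> = q / p"
  have \<rho>: "1 \<le> \<rho>" using pq by (simp add: \<rho>_def)
  \<comment> \<open>q / 2 is a Lipschitz constant of G and \<rho> K bounds f h n; the second summand
    bounds h n.\<close>
  define C0 where "C0 = q / 2 * (\<rho> * K) + q / 2 * K"
  have C0: "0 \<le> C0" using pq K \<rho> by (simp add: C0_def)
  \<comment> \<open>Chosen so that p/2 K' times 1/4 is C0, where 1/4 is a lower bound of \<Phi>1^2 /
    (1 + (\<Phi>/\<delta>)^2) in the zone |\<Phi>| < \<delta>.\<close>
  define K' where "K' = 8 * C0 / p"
  have K': "0 \<le> K'" using pq C0 by (simp add: K'_def)
  define e' where "e' = e / (2 * (T + 1))"
  have e': "0 < e'" "e' * T \<le> e / 2" using e T by (auto simp: e'_def field_simps)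
  \<comment> \<open>By the energy identity, the first bound gives \<Phi>1^2 \<ge> 1/2 where |\<Phi>|
    < \<delta>. The second limits what the arctan term adds to G of the barrier to e'.\<close>
  define \<delta> where "\<delta> = min (sqrt (p / 2)) (e' / (q * K' * R2 + 1))"
  have qKR: "0 \<le> q * K' * R2" using pq K' R20 by simp
  have \<delta>: "0 < \<delta>" "\<delta>\<^sup>2 \<le> p / 2" "q * K' * R2 * \<delta> \<le> e'"
  proof -
    show "0 < \<delta>" using pq e' qKR by (simp add: \<delta>_def add_nonneg_pos)
    have "\<delta> \<le> sqrt (p / 2)" by (simp add: \<delta>_def)
    then have "\<delta>\<^sup>2 \<le> (sqrt (p / 2))\<^sup>2" using \<open>0 < \<delta>\<close> by (intro power_mono) auto
    then show "\<delta>\<^sup>2 \<le> p / 2" using pq by simp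
    have "\<delta> \<le> e' / (q * K' * R2 + 1)" by (simp add: \<delta>_def)
    then have "(q * K' * R2 + 1) * \<delta> \<le> e'" using qKR by (simp add: pos_le_divide_eq mult.commute)
    then show "q * K' * R2 * \<delta> \<le> e'" using \<open>0 < \<delta>\<close> by (simp add: distrib_right)
  qed
  obtain \<theta>' \<theta>1' where \<theta>': "C2_Lip \<theta>' \<theta>1' (\<lambda>x. (\<Phi>1 x)\<^sup>2 / (1 + (\<Phi> x / \<delta>)\<^sup>2) + \<delta> * arctan (\<Phi> x / \<delta>) * \<Phi>2 x)"
    using C2_Lip_arctan_barrier[OF \<Phi>' \<delta>(1)] by blast
  define \<theta>2 where "\<theta>2 x = - K' * ((\<Phi>1 x)\<^sup>2 / (1 + (\<Phi> x / \<delta>)\<^sup>2) + \<delta> * arctan (\<Phi> x / \<delta>) * \<Phi>2 x)" for x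
  have \<theta>: "C2_Lip (\<lambda>x. - K' * \<theta>' x) (\<lambda>x. - K' * \<theta>1' x) \<theta>2"
    unfolding \<theta>2_def[abs_def] by (rule C2_Lip_cmult[OF \<theta>'])
  then have "(\<lambda>x. - K' * \<theta>' x) \<in> Cb_Lip" by (simp only: C2_Lip_def)
  then obtain B' where B': "\<And>x. \<bar>- K' * \<theta>' x\<bar> \<le> B'" by (rule Cb_LipE) blast
  \<comment> \<open>The reciprocal 2/p or 2/q of the slope of G that the pattern selects,
    interpolated linearly in \<Phi> across the zone so that f is Lipschitz.\<close>
  define f where "f x = (1 / p + 1 / q) + (1 / p - 1 / q) * max (- 1) (min 1 (\<Phi> x / \<delta>))" for x
  have f_mem: "f \<in> Cb_Lip"
  proof -
    have "(\<lambda>x. max (- 1) (min 1 (\<Phi> x / \<delta>))) \<in> Cb_Lip"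
    proof (rule Cb_Lip_lipschitz_compose[of \<Phi> "\<lambda>z. max (- 1) (min 1 (z / \<delta>))" "1 / \<delta>"])
      show "\<Phi> \<in> Cb_Lip" using \<Phi> by (simp add: C2_Lip_def)
      fix x y :: real
      have "\<bar>max (- 1) (min 1 u) - max (- 1) (min 1 v)\<bar> \<le> \<bar>u - v\<bar>" for u v :: real
        by linarith
      then have "\<bar>max (- 1) (min 1 (x / \<delta>)) - max (- 1) (min 1 (y / \<delta>))\<bar> \<le> \<bar>x / \<delta> - y / \<delta>\<bar>" .
      also have "\<dots> = 1 / \<delta> * \<bar>x - y\<bar>" using \<delta> by (simp flip: diff_divide_distrib)
      finally show "\<bar>max (- 1) (min 1 (x / \<delta>)) - max (- 1) (min 1 (y / \<delta>))\<bar> \<le> 1 / \<delta> * \<bar>x - y\<bar>" .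
    qed (use \<delta> in auto)
    then show ?thesis unfolding f_def[abs_def] by (intro Cb_Lip_add Cb_Lip_const Cb_Lip_cmult)
  qed
  have qp: "1 / q \<le> 1 / p" using pq by (simp add: frac_le)
  have f_bounds: "2 / q \<le> f x" "f x \<le> 2 / p" for x
  proof -
    define D where "D = 1 / p - 1 / q"
    define k where "k = max (- 1) (min 1 (\<Phi> x / \<delta>))"
    have D: "0 \<le> D" using qp by (simp add: D_def)
    have k: "- 1 \<le> k" "k \<le> 1" by (simp_all add: k_def)
    have fx: "f x = (1 / p + 1 / q) + D * k" by (simp only: f_def D_def k_def)
    have Dk: "D * - 1 \<le> D * k" "D * k \<le> D * 1" by (rule mult_left_mono[OF k(1) D], rule mult_left_mono[OF k(2) D])
    have two: "2 / r = 1 / r + 1 / r" for r :: real by (simp only: add_divide_distrib[symmetric] one_add_one)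
    show "2 / q \<le> f x" using Dk(1) two[of q] fx D_def by linarith
    show "f x \<le> 2 / p" using Dk(2) two[of p] fx D_def by linarith
  qed
  have f_nonneg: "0 \<le> f x" for x
  proof (rule order_trans[OF _ f_bounds(1)])
    show "0 \<le> 2 / q" using pq(3) by simp
  qed
  have f_per: "f (x + P) = f x" for x by (simp only: f_def per)
  obtain c \<eta> \<eta>1 \<xi> where \<eta>: "C2_Lip \<eta> \<eta>1 (\<lambda>x. f x - c)" "\<And>x y. \<bar>\<eta>1 x - \<eta>1 y\<bar> \<le> c * P"
      "\<And>x. \<bar>\<eta>1 x\<bar> \<le> c * P" "\<And>x. \<bar>\<eta> x\<bar> \<le> c * P\<^sup>2" "f \<xi> = c"
    by (rule periodic_second_antiderivative[OF f_mem f_nonneg f_per P]) blast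
  have c: "2 / q \<le> c" "c \<le> 2 / p" "0 < c"
  proof -
    show c: "2 / q \<le> c" "c \<le> 2 / p" using f_bounds[of \<xi>] \<eta>(5) by simp_all
    have "0 < 2 / q" using pq(3) by simp
    with c(1) show "0 < c" by linarith
  qed
  \<comment> \<open>c is the mean of the reciprocal slope, so the homogenized diffusivity is the
    harmonic mean 1/c, and 1 + h (f - c) = f h.\<close>
  define h where "h = 1 / c"
  have h: "0 \<le> h" "h \<le> q / 2"
  proof -
    show "0 \<le> h" using c by (simp add: h_def)
    have "2 \<le> c * q" using c(1) pq by (simp add: pos_divide_le_eq)
    then show "h \<le> q / 2" using c(3) by (simp add: h_def pos_divide_le_eq mult.commute)
  qed
  define B where "B = max P (P\<^sup>2)"
  have \<eta>': "C2_Lip (\<lambda>x. h * \<eta> x) (\<lambda>x. h * \<eta>1 x) (\<lambda>x. h * (f x - c))" by (rule C2_Lip_cmult[OF \<eta>(1)])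
  have \<eta>_le: "\<bar>h * \<eta> x\<bar> \<le> B" "\<bar>h * \<eta>1 x\<bar> \<le> B" for x
  proof -
    have "\<bar>h * \<eta> x\<bar> \<le> P\<^sup>2" "\<bar>h * \<eta>1 x\<bar> \<le> P"
      using \<eta>(4)[of x] \<eta>(3)[of x] c by (simp_all add: h_def abs_mult pos_divide_le_eq mult.commute)
    then show "\<bar>h * \<eta> x\<bar> \<le> B" "\<bar>h * \<eta>1 x\<bar> \<le> B" by (simp_all add: B_def)
  qed
  have B0: "0 \<le> B" using P by (simp add: B_def)
  have fh: "1 + h * (f x - c) = f x * h" for x using c by (simp add: h_def field_simps)
  \<comment> \<open>Makes M |\<Phi>2| \<ge> \<rho> K \<ge> |f h n| as soon as |\<Phi>| \<ge>
    \<delta> and M \<ge> A; no m is involved.\<close>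
  define A where "A = \<rho> * K * q / \<delta>"
  have A0: "0 \<le> A" using \<rho> K pq \<delta> by (simp add: A_def)
  have A\<delta>: "A * \<delta> = \<rho> * K * q" using \<delta> by (simp add: A_def)
  have fh_le: "0 \<le> f x * h" "f x * h \<le> \<rho>" for x
  proof -
    have "0 \<le> f x" by (rule f_nonneg)
    then show "0 \<le> f x * h" using h by simp
    have "f x * h \<le> 2 / p * (q / 2)" using f_bounds(2)[of x] h \<open>0 \<le> f x\<close> pq by (intro mult_mono) auto
    then show "f x * h \<le> \<rho>" by (simp add: \<rho>_def)
  qed
  have barrier: "G (\<theta>2 y) \<le> - (p / 2 * K' * ((\<Phi>1 y)\<^sup>2 / (1 + (\<Phi> y / \<delta>)\<^sup>2))) + e'" for y
  proof -
    define X where "X = (\<Phi>1 y)\<^sup>2 / (1 + (\<Phi> y / \<delta>)\<^sup>2)"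
    have X: "0 \<le> X" unfolding X_def using zero_le_power2[of "\<Phi> y / \<delta>"] by (intro divide_nonneg_nonneg) auto
    have "\<theta>2 y = - (K' * X) + - K' * (\<delta> * arctan (\<Phi> y / \<delta>) * \<Phi>2 y)"
      unfolding \<theta>2_def X_def[symmetric] by (simp only: distrib_left mult_minus_left)
    then have "G (\<theta>2 y) \<le> G (- (K' * X)) + G (- K' * (\<delta> * arctan (\<Phi> y / \<delta>) * \<Phi>2 y))"
      using generator_subadditive[OF var_bounds] by (simp only:)
    moreover have "G (- (K' * X)) = - (p / 2 * K' * X)"
      using K' X by (simp add: generator_def p_def[symmetric] q_def[symmetric])
    moreover have "G (- K' * (\<delta> * arctan (\<Phi> y / \<delta>) * \<Phi>2 y)) \<le> e'"
    proof -
      have "\<bar>arctan (\<Phi> y / \<delta>)\<bar> \<le> 2" using arctan_bounded[of "\<Phi> y / \<delta>"] pi_less_4 by (simp add: abs_le_iff)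
      then have 1: "\<bar>- K' * (\<delta> * arctan (\<Phi> y / \<delta>) * \<Phi>2 y)\<bar> \<le> K' * (\<delta> * 2 * R2)"
        using K' \<delta> R2[of y] by (simp only: abs_mult abs_minus) (intro mult_mono; simp)
      have "G (- K' * (\<delta> * arctan (\<Phi> y / \<delta>) * \<Phi>2 y)) \<le> q / 2 * \<bar>- K' * (\<delta> * arctan (\<Phi> y / \<delta>) * \<Phi>2 y)\<bar>"
        unfolding p_def[symmetric] q_def[symmetric] using pq by (intro generator_le) auto
      also have "\<dots> \<le> q / 2 * (K' * (\<delta> * 2 * R2))" using 1 pq by (intro mult_left_mono) auto
      also have "\<dots> = q * K' * R2 * \<delta>" by simp
      finally show ?thesis using \<delta>(3) by linarith
    qed
    ultimately show ?thesis unfolding X_def[symmetric] by linarith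
  qed
  have dominated: "\<bar>G (M * \<Phi>2 y + (1 + h * (f y - c)) * n) + M / 2 * \<Phi> y - h * n\<bar> + G (\<theta>2 y) \<le> e'"
    if M: "A \<le> M" and n: "\<bar>n\<bar> \<le> K" for y M n
  proof -
    have M0: "0 \<le> M" using M A0 by linarith
    have X: "0 \<le> p / 2 * K' * ((\<Phi>1 y)\<^sup>2 / (1 + (\<Phi> y / \<delta>)\<^sup>2))"
      using zero_le_power2[of "\<Phi> y / \<delta>"] pq K' by (intro mult_nonneg_nonneg divide_nonneg_nonneg) auto
    have fn: "\<bar>f y * h * n\<bar> \<le> \<rho> * K"
      unfolding abs_mult[of "f y * h"] using fh_le[of y] n \<rho> by (intro mult_mono) auto
    have GG: "G v = (q * max 0 v - p * max 0 (- v)) / 2" for v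
      by (simp add: generator_def p_def q_def)
    have G_neg: "G v = p / 2 * v" if "v \<le> 0" for v using that by (simp add: GG)
    have G_pos: "G v = q / 2 * v" if "0 \<le> v" for v using that by (simp add: GG)
    consider "\<delta> \<le> \<Phi> y" | "\<Phi> y \<le> - \<delta>" | "\<bar>\<Phi> y\<bar> < \<delta>" by linarith
    then show ?thesis
    proof cases
      case 1
      have \<Phi>2y: "\<Phi>2 y = - \<Phi> y / p" using 1 \<delta> by (simp add: \<Phi>2_def)
      have "1 \<le> \<Phi> y / \<delta>" using 1 \<delta> by simp
      then have "max (- 1) (min 1 (\<Phi> y / \<delta>)) = 1" by linarith
      then have fy: "f y = 2 / p" by (simp add: f_def)
      have "\<rho> * K * q \<le> M * \<Phi> y"
        unfolding A\<delta>[symmetric] using M 1 \<delta> M0 by (intro mult_mono) auto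
      moreover have "\<rho> * K * p \<le> \<rho> * K * q" using pq \<rho> K by (intro mult_left_mono) auto
      ultimately have "\<rho> * K \<le> M * \<Phi> y / p" using pq by (simp add: pos_le_divide_eq)
      then have "M * \<Phi>2 y + f y * h * n \<le> 0" using fn by (simp add: \<Phi>2y abs_le_iff)
      then have "G (M * \<Phi>2 y + f y * h * n) = p / 2 * (M * \<Phi>2 y + f y * h * n)" by (rule G_neg)
      also have "\<dots> = - (M / 2 * \<Phi> y) + h * n" unfolding \<Phi>2y fy using pq by (simp add: field_simps)
      finally show ?thesis using barrier[of y] X unfolding fh by simp
    next
      case 2
      have \<Phi>2y: "\<Phi>2 y = - \<Phi> y / q" using 2 \<delta> by (simp add: \<Phi>2_def)
      have "\<Phi> y / \<delta> \<le> - 1" using 2 \<delta> by (simp add: divide_le_eq)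
      then have "max (- 1) (min 1 (\<Phi> y / \<delta>)) = - 1" by linarith
      then have fy: "f y = 2 / q" by (simp add: f_def)
      have "\<rho> * K * q \<le> M * (- \<Phi> y)"
        unfolding A\<delta>[symmetric] using M 2 \<delta> M0 by (intro mult_mono) auto
      then have "\<rho> * K \<le> M * (- \<Phi> y) / q" using pq(3) by (simp only: pos_le_divide_eq)
      then have "0 \<le> M * \<Phi>2 y + f y * h * n" using fn by (simp add: \<Phi>2y abs_le_iff)
      then have "G (M * \<Phi>2 y + f y * h * n) = q / 2 * (M * \<Phi>2 y + f y * h * n)" by (rule G_pos)
      also have "\<dots> = - (M / 2 * \<Phi> y) + h * n" unfolding \<Phi>2y fy using pq by (simp add: field_simps)
      finally show ?thesis using barrier[of y] X unfolding fh by simp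
    next
      case 3
      have G0: "G (M * \<Phi>2 y) = - (M / 2 * \<Phi> y)"
      proof (cases "0 \<le> \<Phi> y")
        case True
        then have "\<Phi>2 y = - (\<Phi> y / p)" by (simp add: \<Phi>2_def)
        then show ?thesis using True M0 pq by (simp add: GG)
      next
        case False
        then have "\<Phi>2 y = - \<Phi> y / q" by (simp add: \<Phi>2_def)
        moreover have "0 \<le> M * (- \<Phi> y / q)" using False M0 pq by (intro mult_nonneg_nonneg divide_nonneg_nonneg) auto
        ultimately show ?thesis using pq by (simp add: GG)
      qed
      have "\<bar>G (M * \<Phi>2 y + f y * h * n) - G (M * \<Phi>2 y)\<bar> \<le> q / 2 * (\<rho> * K)"
        using generator_diff_le[of p q "M * \<Phi>2 y" "f y * h * n"] fn pq mult_left_mono[OF fn, of "q / 2"]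
        unfolding p_def[symmetric] q_def[symmetric] by linarith
      moreover have "\<bar>h * n\<bar> \<le> q / 2 * K" unfolding abs_mult using h n K pq by (intro mult_mono) auto
      ultimately have 4: "\<bar>G (M * \<Phi>2 y + f y * h * n) + M / 2 * \<Phi> y - h * n\<bar> \<le> C0"
        unfolding C0_def G0 by linarith
      have s: "(\<Phi> y)\<^sup>2 \<le> \<delta>\<^sup>2" using 3 \<delta> by (simp add: abs_le_square_iff[symmetric])
      have "(max 0 (- \<Phi> y))\<^sup>2 / q + (max 0 (\<Phi> y))\<^sup>2 / p \<le> (\<Phi> y)\<^sup>2 / p"
        using pq by (auto simp: max_def intro!: divide_left_mono)
      also have "\<dots> \<le> 1 / 2" using s \<delta>(2) pq by (simp add: divide_le_eq)
      finally have \<Phi>1: "1 / 2 \<le> (\<Phi>1 y)\<^sup>2" using energy[of y] by linarith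
      have "(\<Phi> y / \<delta>)\<^sup>2 \<le> 1" using s \<delta> by (simp add: power_divide)
      then have "(1 / 2) / 2 \<le> (\<Phi>1 y)\<^sup>2 / (1 + (\<Phi> y / \<delta>)\<^sup>2)"
      proof (intro frac_le)
        show "0 < 1 + (\<Phi> y / \<delta>)\<^sup>2" using zero_le_power2[of "\<Phi> y / \<delta>"] by linarith
      qed (use \<Phi>1 in auto)
      then have "p / 2 * K' * (1 / 4) \<le> p / 2 * K' * ((\<Phi>1 y)\<^sup>2 / (1 + (\<Phi> y / \<delta>)\<^sup>2))"
        using pq K' by (intro mult_left_mono) auto
      moreover have "p / 2 * K' * (1 / 4) = C0" using pq by (simp add: K'_def)
      ultimately show ?thesis using barrier[of y] 4 unfolding fh by linarith
    qed
  qed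
  have B'0: "0 \<le> B'" using B'[of 0] by linarith
  have "0 \<le> A * sqrt q + B * K + 3 * B'" using A0 B0 K B'0 sq by simp
  then obtain m where m: "1 \<le> m"
    "(A * sqrt q + B * K + 3 * B') / m\<^sup>2 + (e' + 2 * q * B * K / m) * T \<le> e"
    using e e'(2) by (rule large_frequency)
  note m(2)
  moreover have "\<exists>\<psi>\<in>Cb_Lip. \<forall>x. \<bar>transition Y (sqrt T) \<psi> x - (\<Sum>i\<leftarrow>l. wave i x)\<bar>
      \<le> (A * sqrt q + B * K + 3 * B') / m\<^sup>2 + (e' + 2 * q * B * K / m) * T"
    unfolding K_def q_def
    by (rule transition_approximates_waves[OF \<Phi>' absR[unfolded q_def] \<eta>' \<eta>_le \<theta> B' m(1) A0 T h[unfolded q_def]])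
       (use e' dominated in \<open>auto simp: K_def q_def\<close>)
  ultimately show ?thesis by (meson order_trans)
qed

end

section \<open>Density when the lower variance vanishes\<close>

context centered_semigroup
begin

text \<open>G now vanishes on negative curvatures, so positive arcs cannot decay. They are made
  short and low, of height a, and the eigenvalue equation fails there by at most M a / 2. On them f
  = -\<Phi>2, so the waves only rescale a curvature that G ignores; elsewhere f = 0. The homogenized
  diffusivity is 0, the waves are frozen, and the barrier is taken to be 0.\<close>

lemma transition_dense_waves_zero:
  fixes l :: "mode list"
  assumes p: "lower_var E Y = 0" and q0: "0 < upper_var E Y" and T: "0 \<le> T" and e: "0 < e"
  shows "\<exists>\<psi>\<in>Cb_Lip. \<forall>x. \<bar>transition Y (sqrt T) \<psi> x - (\<Sum>i\<leftarrow>l. wave i x)\<bar> \<le> e"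
proof -
  define q where "q = upper_var E Y"
  have q: "0 < q" using q0 by (simp add: q_def)
  define K where "K = (\<Sum>i\<leftarrow>l. wave_bound (q / 2 * T) i)"
  have K: "0 \<le> K" unfolding K_def by (rule sum_wave_bound_nonneg)
  define b where "b = sqrt q"
  have b: "0 < b" "b\<^sup>2 = q" using q by (simp_all add: b_def)
  \<comment> \<open>Bounds the period pi (a + b) for every a \<le> b: the constants A and B must not
    depend on a, which is chosen only after m.\<close>
  define P0 where "P0 = 2 * pi * b"
  have P0: "0 < P0" using b by (simp add: P0_def)
  define B where "B = max P0 (P0\<^sup>2)"
  have B: "P0 \<le> B" "P0\<^sup>2 \<le> B" "0 \<le> B" using P0 by (auto simp: B_def)
  \<comment> \<open>The mean c of f will satisfy 1/c \<le> P \<le> P0, so n / c \<le> K P0 = A \<le>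
    M keeps the total curvature non-positive on the positive arcs.\<close>
  define A where "A = K * P0"
  have A: "0 \<le> A" using K P0 by (simp add: A_def)
  define e' where "e' = e / (2 * (T + 1))"
  have e': "0 < e'" "e' * T \<le> e / 2" using e T by (auto simp: e'_def field_simps)
  have "0 \<le> A * b + B * K + 3 * 0" using A B K b by simp
  then obtain m where m: "1 \<le> m"
    "(A * b + B * K + 3 * 0) / m\<^sup>2 + (e' + 2 * q * B * K / m) * T \<le> e"
    using e e'(2) by (rule large_frequency)
  define N where "N = A * exp (m\<^sup>2 / 2 * T)"
  have N: "0 \<le> N" using A by (simp add: N_def)
  \<comment> \<open>N is the largest curvature amplitude up to time T; with N a \<le> e' the failing
    eigenvalue equation stays within the tolerance.\<close>
  define a where "a = min b (e' / (N + 1))"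
  have a: "0 < a" "a \<le> b" "N * a \<le> e'"
  proof -
    have "0 < e' / (N + 1)" using e'(1) N by simp
    then show "0 < a" "a \<le> b" using b(1) by (simp_all only: a_def min_less_iff_conj min.cobounded1 simp_thms)
    have "a \<le> e' / (N + 1)" by (simp add: a_def)
    then have "(N + 1) * a \<le> e'" using N by (simp add: pos_le_divide_eq mult.commute)
    then show "N * a \<le> e'" using \<open>0 < a\<close> by (simp add: distrib_right)
  qed
  define P where "P = pi * (a + b)"
  have P: "0 < P" "P \<le> P0" "pi * a \<le> P" using a b by (simp_all add: P_def P0_def add_pos_pos distrib_left)
  obtain \<Phi> \<Phi>1 where \<Phi>: "C2_Lip \<Phi> \<Phi>1 (\<lambda>x. max 0 (- \<Phi> x) / b\<^sup>2 - max 0 (\<Phi> x) / a\<^sup>2)"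
    and per: "\<And>x. \<Phi> (x + P) = \<Phi> x" and range: "\<And>x. - b \<le> \<Phi> x" "\<And>x. \<Phi> x \<le> a"
    and ends: "\<Phi>1 0 = 1" "\<Phi>1 (pi * a) = - 1"
    by (rule half_wave_pattern[OF a(1) b(1), folded P_def]) blast
  define \<Phi>2 where "\<Phi>2 x = max 0 (- \<Phi> x) / b\<^sup>2 - max 0 (\<Phi> x) / a\<^sup>2" for x
  note \<Phi>' = \<Phi>[folded \<Phi>2_def[abs_def]]
  have absR: "\<bar>\<Phi> x\<bar> \<le> b" for x using range[of x] a unfolding abs_le_iff by linarith
  define f where "f x = max 0 (\<Phi> x) / a\<^sup>2" for x
  have f_mem: "f \<in> Cb_Lip"
  proof -
    have "\<Phi> \<in> Cb_Lip" using \<Phi> by (simp add: C2_Lip_def)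
    then have "(\<lambda>x. max 0 (\<Phi> x)) \<in> Cb_Lip" by (rule Cb_Lip_lipschitz_compose[of _ "max 0" 1]) auto
    from Cb_Lip_cmult[OF this, of "inverse (a\<^sup>2)"] show ?thesis
      by (simp add: f_def[abs_def] divide_inverse mult.commute)
  qed
  have f_nonneg: "0 \<le> f x" for x by (simp add: f_def)
  have f_per: "f (x + P) = f x" for x by (simp only: f_def per)
  obtain c \<eta> \<eta>1 \<xi> where \<eta>: "C2_Lip \<eta> \<eta>1 (\<lambda>x. f x - c)" "\<And>x y. \<bar>\<eta>1 x - \<eta>1 y\<bar> \<le> c * P"
      "\<And>x. \<bar>\<eta>1 x\<bar> \<le> c * P" "\<And>x. \<bar>\<eta> x\<bar> \<le> c * P\<^sup>2" "f \<xi> = c"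
    by (rule periodic_second_antiderivative[OF f_mem f_nonneg f_per P(1)]) blast
  \<comment> \<open>\<open>f\<close> carries the whole slope change of \<open>\<Phi>\<close> on a half wave, which bounds its mean \<open>c\<close> from below however small \<open>a\<close> is.\<close>
  have c: "1 / P \<le> c"
  proof -
    have "(\<lambda>x. \<eta>1 x + c * x + \<Phi>1 x) 0 \<le> (\<lambda>x. \<eta>1 x + c * x + \<Phi>1 x) (pi * a)"
    proof (rule DERIV_nonneg_imp_nondecreasing[where f = "\<lambda>x. \<eta>1 x + c * x + \<Phi>1 x"])
      show "0 \<le> pi * a" using a by simp
      fix x
      have "((\<lambda>x. \<eta>1 x + c * x + \<Phi>1 x) has_real_derivative (f x - c) + c * 1 + \<Phi>2 x) (at x)"
        using \<eta>(1) \<Phi>' unfolding C2_Lip_def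
        by (intro DERIV_add DERIV_cmult DERIV_ident) auto
      moreover have "0 \<le> (f x - c) + c * 1 + \<Phi>2 x" by (simp add: f_def \<Phi>2_def)
      ultimately show "\<exists>y. ((\<lambda>x. \<eta>1 x + c * x + \<Phi>1 x) has_real_derivative y) (at x) \<and> 0 \<le> y" by blast
    qed
    then have "2 \<le> (\<eta>1 (pi * a) - \<eta>1 0) + c * (pi * a)" by (simp add: ends)
    also have "\<dots> \<le> c * P + c * P"
    proof (intro add_mono)
      show "\<eta>1 (pi * a) - \<eta>1 0 \<le> c * P" using \<eta>(2)[of "pi * a" 0] by linarith
      have "0 \<le> c" using \<eta>(5) f_nonneg by auto
      then show "c * (pi * a) \<le> c * P" using P(3) by (intro mult_left_mono)
    qed
    finally show ?thesis using P(1) by (simp add: pos_divide_le_eq mult.commute)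
  qed
  have c0: "0 < c"
  proof -
    have "0 < 1 / P" using P(1) by simp
    with c show ?thesis by linarith
  qed
  have c1: "1 \<le> c * P" using c P(1) by (simp add: pos_divide_le_eq)
  have \<eta>': "C2_Lip (\<lambda>x. 1 / c * \<eta> x) (\<lambda>x. 1 / c * \<eta>1 x) (\<lambda>x. 1 / c * (f x - c))" by (rule C2_Lip_cmult[OF \<eta>(1)])
  have \<eta>_le: "\<bar>1 / c * \<eta> x\<bar> \<le> B" "\<bar>1 / c * \<eta>1 x\<bar> \<le> B" for x
  proof -
    have "P\<^sup>2 \<le> P0\<^sup>2" using P by (intro power_mono) auto
    moreover have "\<bar>1 / c * \<eta> x\<bar> \<le> P\<^sup>2" "\<bar>1 / c * \<eta>1 x\<bar> \<le> P"
      using \<eta>(4)[of x] \<eta>(3)[of x] c0 by (simp_all add: abs_mult pos_divide_le_eq mult.commute)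
    ultimately show "\<bar>1 / c * \<eta> x\<bar> \<le> B" "\<bar>1 / c * \<eta>1 x\<bar> \<le> B" using B P(2) by linarith+
  qed
  have fc: "1 + 1 / c * (f x - c) = f x / c" for x using c0 by (simp add: field_simps)
  have GG: "G v = q / 2 * max 0 v" for v by (simp add: generator_def p q_def)
  have dominated: "\<bar>G (M * \<Phi>2 y + (1 + 1 / c * (f y - c)) * n) + M / 2 * \<Phi> y - 0 * n\<bar> + G 0 \<le> e'"
    if M: "A \<le> M" "M \<le> N" and n: "\<bar>n\<bar> \<le> K" for y M n
  proof (cases "0 \<le> \<Phi> y")
    case True
    have "n \<le> K * (c * P)"
    proof -
      have "K * 1 \<le> K * (c * P)" using c1 K by (rule mult_left_mono)
      with n show ?thesis by linarith
    qed
    also have "\<dots> \<le> M * c"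
    proof -
      have "K * P \<le> K * P0" using P K by (intro mult_left_mono)
      then have "K * P \<le> M" using M(1) by (simp add: A_def)
      then have "(K * P) * c \<le> M * c" using c0 by (intro mult_right_mono) auto
      then show ?thesis by (simp only: mult.assoc mult.commute[of c P])
    qed
    finally have "n / c \<le> M" using c0 by (simp only: pos_divide_le_eq)
    then have "f y * (n / c - M) \<le> 0" using f_nonneg[of y] by (simp add: mult_nonneg_nonpos)
    moreover have "M * \<Phi>2 y + f y / c * n = f y * (n / c - M)"
    proof -
      have "\<Phi>2 y = - f y" using True by (simp add: \<Phi>2_def f_def)
      then show ?thesis by (simp add: algebra_simps)
    qed
    ultimately have G0: "G (M * \<Phi>2 y + f y / c * n) = 0" "G 0 = 0" by (simp_all only: GG max.absorb1 mult_zero_right max.idem)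
    have "M * \<Phi> y \<le> N * a" using M A range[of y] True by (intro mult_mono) auto
    moreover have "\<bar>0 + M / 2 * \<Phi> y - 0 * n\<bar> = M * \<Phi> y / 2" using M A True by simp
    ultimately show ?thesis unfolding fc G0 using a(3) e'(1) by linarith
  next
    case False
    then have fy: "f y = 0" by (simp add: f_def)
    have "\<Phi>2 y = - \<Phi> y / q" using False b by (simp add: \<Phi>2_def)
    moreover have "0 \<le> M * (- \<Phi> y / q)" using False M A q by (intro mult_nonneg_nonneg divide_nonneg_nonneg) auto
    ultimately have G0: "G (M * \<Phi>2 y) = - (M / 2 * \<Phi> y)" "G 0 = 0" using q by (simp_all add: GG)
    have "M * \<Phi>2 y + f y / c * n = M * \<Phi>2 y" unfolding fy by simp
    then have "G (M * \<Phi>2 y + f y / c * n) = - (M / 2 * \<Phi> y)" by (simp only: G0)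
    then show ?thesis using e'(1) G0(2) unfolding fc by simp
  qed
  have zero: "C2_Lip (\<lambda>x. 0) (\<lambda>x. 0) (\<lambda>x. 0)" by (auto simp: C2_Lip_def)
  note m(2)
  moreover have "\<exists>\<psi>\<in>Cb_Lip. \<forall>x. \<bar>transition Y (sqrt T) \<psi> x - (\<Sum>i\<leftarrow>l. wave i x)\<bar>
      \<le> (A * b + B * K + 3 * 0) / m\<^sup>2 + (e' + 2 * q * B * K / m) * T"
    unfolding K_def q_def
    by (rule transition_approximates_waves[where h = 0, OF \<Phi>' absR \<eta>' \<eta>_le zero _ m(1) A T])
       (use e' q dominated in \<open>auto simp: K_def q_def N_def\<close>)
  ultimately show ?thesis by (meson order_trans)
qed

lemma transition_dense_waves:
  fixes l :: "mode list"
  assumes "0 < upper_var E Y" "0 \<le> T" "0 < e"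
  shows "\<exists>\<psi>\<in>Cb_Lip. \<forall>x. \<bar>transition Y (sqrt T) \<psi> x - (\<Sum>i\<leftarrow>l. wave i x)\<bar> \<le> e"
  using transition_dense_waves_zero[OF _ assms] transition_dense_waves_positive[OF _ assms(2,3)] var_bounds(1)
  by (cases "lower_var E Y = 0") auto

end

section \<open>Trigonometric sums and determination of laws\<close>

definition wave_sums :: "(real \<Rightarrow> real) set" where
  "wave_sums = {\<lambda>x. \<Sum>i\<leftarrow>l. wave i x | l. True}"

lemma wave_sums_add: "F \<in> wave_sums \<Longrightarrow> F' \<in> wave_sums \<Longrightarrow> (\<lambda>x. F x + F' x) \<in> wave_sums"
proof -
  assume "F \<in> wave_sums" "F' \<in> wave_sums"
  then obtain l l' where "F = (\<lambda>x. \<Sum>i\<leftarrow>l. wave i x)" "F' = (\<lambda>x. \<Sum>i\<leftarrow>l'. wave i x)"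
    by (auto simp: wave_sums_def)
  then have "(\<lambda>x. F x + F' x) = (\<lambda>x. \<Sum>i\<leftarrow>l @ l'. wave i x)" by simp
  then show ?thesis unfolding wave_sums_def by blast
qed

lemma wave_sums_wave: "wave i \<in> wave_sums"
proof -
  have "wave i = (\<lambda>x. \<Sum>i\<leftarrow>[i]. wave i x)" by simp
  then show ?thesis unfolding wave_sums_def by blast
qed

lemma wave_sums_zero: "(\<lambda>x. 0) \<in> wave_sums"
proof -
  have "(\<lambda>x. 0) = (\<lambda>x. \<Sum>i\<leftarrow>[]. wave i x)" by simp
  then show ?thesis unfolding wave_sums_def by blast
qed

text \<open>Product-to-sum formulas make the trigonometric sums an algebra, so polynomials in sin(x
  / N) belong to it.\<close>

lemma wave_sums_mult:
  assumes "F \<in> wave_sums" "F' \<in> wave_sums"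
  shows "(\<lambda>x. F x * F' x) \<in> wave_sums"
proof -
  have ww: "(\<lambda>x. wave i x * wave j x) \<in> wave_sums" for i j
  proof -
    obtain c k d where i: "i = (c, k, d)" by (cases i)
    obtain c' k' d' where j: "j = (c', k', d')" by (cases j)
    have "(\<lambda>x. wave i x * wave j x) = (\<lambda>x. wave (c * c' / 2, k - k', d - d') x + wave (c * c' / 2, k + k', d + d') x)"
    proof
      fix x
      have "(k - k') * x + (d - d') = (k * x + d) - (k' * x + d')" "(k + k') * x + (d + d') = (k * x + d) + (k' * x + d')"
        by (simp_all add: algebra_simps)
      then show "wave i x * wave j x = wave (c * c' / 2, k - k', d - d') x + wave (c * c' / 2, k + k', d + d') x"
        unfolding i j wave_def fst_conv snd_conv by (simp only: cos_diff cos_add) (simp add: algebra_simps)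
    qed
    then show ?thesis by (simp only: wave_sums_add wave_sums_wave)
  qed
  have wl: "(\<lambda>x. wave i x * (\<Sum>j\<leftarrow>l. wave j x)) \<in> wave_sums" for i l
  proof (induction l)
    case (Cons j l)
    from wave_sums_add[OF ww[of i j] this] show ?case by (simp add: distrib_left)
  qed (simp add: wave_sums_zero)
  have "(\<lambda>x. (\<Sum>i\<leftarrow>l. wave i x) * (\<Sum>j\<leftarrow>l'. wave j x)) \<in> wave_sums" for l l'
  proof (induction l)
    case (Cons i l)
    from wave_sums_add[OF wl[of i l'] this] show ?case by (simp add: distrib_right)
  qed (simp add: wave_sums_zero)
  with assms show ?thesis by (auto simp: wave_sums_def)
qed

text \<open>The function \<open>\<phi> (N * arcsin (sin (x / N)))\<close> is a continuous function of \<open>sin (x / N)\<close>, agrees with \<open>\<phi>\<close> on \<open>[- N, N]\<close> and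
  keeps the bounds of \<open>\<phi>\<close>.\<close>

lemma Cb_Lip_wave_sum_approximation:
  fixes \<phi> :: "real \<Rightarrow> real"
  assumes \<phi>: "\<phi> \<in> Cb_Lip" and B: "\<And>x. \<bar>\<phi> x\<bar> \<le> B" and N: "0 < N" and e: "0 < e"
  obtains F where "F \<in> wave_sums" "\<And>x. \<bar>x\<bar> \<le> N \<Longrightarrow> \<bar>\<phi> x - F x\<bar> \<le> e" "\<And>x. \<bar>F x\<bar> \<le> B + e"
proof -
  from \<phi> obtain B' L where L: "\<And>x. \<bar>\<phi> x\<bar> \<le> B'" "\<And>x y. \<bar>\<phi> x - \<phi> y\<bar> \<le> L * dist x y" "0 \<le> L"
    by (rule Cb_LipE) blast
  have cont: "continuous_on UNIV \<phi>"
    using L(2,3) by (intro lipschitz_on_continuous_on[of L] lipschitz_onI) (auto simp: dist_real_def)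
  have "continuous_on {- 1..1} (\<lambda>s. \<phi> (N * arcsin s))"
    by (rule continuous_on_compose2[OF cont]) (auto intro!: continuous_intros)
  then obtain g where g: "real_polynomial_function g" and ge: "\<And>s. s \<in> {- 1..1} \<Longrightarrow> \<bar>\<phi> (N * arcsin s) - g s\<bar> < e"
    using Stone_Weierstrass_real_polynomial_function[of "{- 1..1::real}" _ e] e by blast
  define F where "F x = g (sin (x / N))" for x
  show ?thesis
  proof (rule that[of F])
    have s: "(\<lambda>x. sin (x / N)) \<in> wave_sums"
    proof -
      have "wave (1, 1 / N, - (pi / 2)) = (\<lambda>x. sin (x / N))"
        by (simp add: fun_eq_iff wave_def cos_diff)
      then show ?thesis using wave_sums_wave by metis
    qed
    have const_mem: "(\<lambda>x. c) \<in> wave_sums" for c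
    proof -
      have "wave (c, 0, 0) = (\<lambda>x. c)" by (auto simp: wave_def)
      then show ?thesis using wave_sums_wave by metis
    qed
    show "F \<in> wave_sums"
      using g unfolding F_def[abs_def]
    proof (induction rule: real_polynomial_function.induct)
      case (linear h)
      then obtain c where "h = (\<lambda>s. s * c)" using real_bounded_linear by blast
      then show ?case using wave_sums_mult[OF s const_mem] by simp
    next
      case (const c)
      show ?case by (rule const_mem)
    next
      case (add g h)
      then show ?case by (intro wave_sums_add)
    next
      case (mult g h)
      then show ?case by (intro wave_sums_mult)
    qed
    have near: "\<bar>\<phi> (N * arcsin (sin (x / N))) - F x\<bar> < e" for x
      unfolding F_def by (rule ge) simp
    show "\<bar>\<phi> x - F x\<bar> \<le> e" if "\<bar>x\<bar> \<le> N" for x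
    proof -
      have "\<bar>x / N\<bar> \<le> 1" using that N by (simp add: divide_le_eq)
      moreover have "1 \<le> pi / 2" using pi_ge_two by simp
      ultimately have "arcsin (sin (x / N)) = x / N" by (intro arcsin_sin) linarith+
      then show ?thesis using near[of x] N by simp
    qed
    show "\<bar>F x\<bar> \<le> B + e" for x using near[of x] B[of "N * arcsin (sin (x / N))"] by linarith
  qed
qed

context sublinear_expectation_space
begin

text \<open>Trigonometric sums approximate a test function on a bounded interval only, but with a
  uniform bound, so a Chebyshev estimate with second moments handles the rest. Hence it suffices
  that R approximates trigonometric sums uniformly.\<close>

lemma ident_distr_of_dense:
  assumes XY: "X \<in> H" "Y \<in> H"
    and R: "\<And>\<psi>. \<psi> \<in> R \<Longrightarrow> \<psi> \<in> Cb_Lip" "\<And>\<psi>. \<psi> \<in> R \<Longrightarrow> E (\<lambda>\<omega>. \<psi> (X \<omega>)) = E (\<lambda>\<omega>. \<psi> (Y \<omega>))"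
    and dense: "\<And>F e. F \<in> wave_sums \<Longrightarrow> 0 < e \<Longrightarrow> \<exists>\<psi>\<in>R. \<forall>x. \<bar>\<psi> x - F x\<bar> \<le> e"
  shows "ident_distr E X E Y"
  unfolding ident_distr_def
proof
  fix \<phi> :: "real \<Rightarrow> real" assume \<phi>: "\<phi> \<in> Cb_Lip"
  then obtain B where B: "\<And>x. \<bar>\<phi> x\<bar> \<le> B" by (rule Cb_LipE) blast
  have B0: "0 \<le> B" using B[of 0] by linarith
  define S where "S = E (\<lambda>\<omega>. (X \<omega>)\<^sup>2) + E (\<lambda>\<omega>. (Y \<omega>)\<^sup>2)"
  have nn: "0 \<le> E (\<lambda>\<omega>. (Z \<omega>)\<^sup>2)" if "Z \<in> H" for Z using that by (intro expectation_nonneg square_mem) auto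
  have "\<bar>E (\<lambda>\<omega>. \<phi> (X \<omega>)) - E (\<lambda>\<omega>. \<phi> (Y \<omega>))\<bar> \<le> e" if e: "0 < e" for e
  proof -
    \<comment> \<open>\<open>X\<close> and \<open>Y\<close> cost 2 d each, and both tails together
      another d.\<close>
    define d where "d = min 1 (e / 5)"
    have d: "0 < d" "d \<le> 1" "5 * d \<le> e" using e by (auto simp: d_def)
    define N where "N = max 1 ((2 * B + 1) * S / d)"
    have N: "1 \<le> N" "(2 * B + 1) * S \<le> d * N\<^sup>2"
    proof -
      show N1: "1 \<le> N" by (simp add: N_def)
      have "(2 * B + 1) * S / d \<le> N" by (simp add: N_def)
      also have "N \<le> N\<^sup>2" using N1 by (rule self_le_power) simp
      finally show "(2 * B + 1) * S \<le> d * N\<^sup>2" using d by (simp add: pos_divide_le_eq mult.commute)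
    qed
    have "0 < N" using N by simp
    obtain F where F: "F \<in> wave_sums" "\<And>x. \<bar>x\<bar> \<le> N \<Longrightarrow> \<bar>\<phi> x - F x\<bar> \<le> d" "\<And>x. \<bar>F x\<bar> \<le> B + d"
      using Cb_Lip_wave_sum_approximation[OF \<phi> B \<open>0 < N\<close> d(1)] by blast
    obtain \<psi> where \<psi>: "\<psi> \<in> R" "\<And>x. \<bar>\<psi> x - F x\<bar> \<le> d" using dense[OF F(1) d(1)] by blast
    have near: "\<bar>E (\<lambda>\<omega>. \<phi> (Z \<omega>)) - E (\<lambda>\<omega>. \<psi> (Z \<omega>))\<bar> \<le> (2 * B + 1) / N\<^sup>2 * E (\<lambda>\<omega>. (Z \<omega>)\<^sup>2) + 2 * d" if Z: "Z \<in> H" for Z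
    proof -
      have "\<bar>E (\<lambda>\<omega>. \<phi> (Z \<omega>)) - E (\<lambda>\<omega>. \<psi> (Z \<omega>))\<bar> \<le> E (\<lambda>\<omega>. (2 * B + 1) / N\<^sup>2 * (Z \<omega>)\<^sup>2 + 2 * d)"
      proof (rule expectation_abs_diff)
        show "(\<lambda>\<omega>. \<phi> (Z \<omega>)) \<in> H" "(\<lambda>\<omega>. \<psi> (Z \<omega>)) \<in> H"
          by (rule Cb_Lip_mem1[OF Z \<phi>], rule Cb_Lip_mem1[OF Z R(1)[OF \<psi>(1)]])
        show "(\<lambda>\<omega>. (2 * B + 1) / N\<^sup>2 * (Z \<omega>)\<^sup>2 + 2 * d) \<in> H" by (intro mem_intros Z)
        fix \<omega>
        have "\<bar>\<phi> z - F z\<bar> \<le> (2 * B + 1) / N\<^sup>2 * z\<^sup>2 + d" for z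
        proof (cases "\<bar>z\<bar> \<le> N")
          case True
          have "0 \<le> (2 * B + 1) / N\<^sup>2 * z\<^sup>2" using B0 by simp
          then show ?thesis using F(2)[OF True] by linarith
        next
          case False
          then have "N\<^sup>2 \<le> \<bar>z\<bar>\<^sup>2" using N by (intro power_mono) auto
          then have "1 \<le> z\<^sup>2 / N\<^sup>2" using N by simp
          then have "(2 * B + 1) * 1 \<le> (2 * B + 1) * (z\<^sup>2 / N\<^sup>2)" using B0 by (intro mult_left_mono) auto
          moreover have "\<bar>\<phi> z - F z\<bar> \<le> 2 * B + d" using B[of z] F(3)[of z] by linarith
          ultimately show ?thesis by simp
        qed
        from this[of "Z \<omega>"] \<psi>(2)[of "Z \<omega>"]
        show "\<bar>\<phi> (Z \<omega>) - \<psi> (Z \<omega>)\<bar> \<le> (2 * B + 1) / N\<^sup>2 * (Z \<omega>)\<^sup>2 + 2 * d" by linarith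
      qed
      also have "\<dots> = (2 * B + 1) / N\<^sup>2 * E (\<lambda>\<omega>. (Z \<omega>)\<^sup>2) + 2 * d"
      proof -
        have "0 \<le> (2 * B + 1) / N\<^sup>2" using B0 by simp
        then show ?thesis
          by (simp only: expectation_add_const[OF scale_mem[OF square_mem[OF Z]]] pos_homogeneous[OF square_mem[OF Z]])
      qed
      finally show ?thesis .
    qed
    have "(2 * B + 1) / N\<^sup>2 * E (\<lambda>\<omega>. (X \<omega>)\<^sup>2) + (2 * B + 1) / N\<^sup>2 * E (\<lambda>\<omega>. (Y \<omega>)\<^sup>2) \<le> d"
    proof -
      have "(2 * B + 1) / N\<^sup>2 * E (\<lambda>\<omega>. (X \<omega>)\<^sup>2) + (2 * B + 1) / N\<^sup>2 * E (\<lambda>\<omega>. (Y \<omega>)\<^sup>2) = (2 * B + 1) * S / N\<^sup>2"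
        using N by (simp add: S_def field_simps)
      also have "\<dots> \<le> d" using N by (simp add: pos_divide_le_eq)
      finally show ?thesis .
    qed
    then show ?thesis using near[OF XY(1)] near[OF XY(2)] R(2)[OF \<psi>(1)] d by linarith
  qed
  then have "\<bar>E (\<lambda>\<omega>. \<phi> (X \<omega>)) - E (\<lambda>\<omega>. \<phi> (Y \<omega>))\<bar> \<le> 0" by (rule field_le_epsilon[where y = 0, simplified])
  then show "E (\<lambda>\<omega>. \<phi> (X \<omega>)) = E (\<lambda>\<omega>. \<phi> (Y \<omega>))" by simp
qed

end

section \<open>The characterization\<close>

context sublinear_expectation_space
begin

text \<open>With \<open>X\<close> frozen the cross term is a multiple of \<open>Y\<close> and drops
  out. Since l^2 and k^2 are non-negative, homogeneity applies for either sign of s; s = 1 and s =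
  -1 give the upper and the lower variance.\<close>

lemma second_moment_linear_indep:
  assumes ind: "indep_of E Y X" and XY: "X \<in> H" "Y \<in> H"
    and Y0: "E Y = 0" "E (\<lambda>\<omega>. - Y \<omega>) = 0"
  shows "E (\<lambda>\<omega>. s * (l * X \<omega> + k * Y \<omega>)\<^sup>2) = l\<^sup>2 * E (\<lambda>\<omega>. s * (X \<omega>)\<^sup>2) + k\<^sup>2 * E (\<lambda>\<omega>. s * (Y \<omega>)\<^sup>2)"
proof -
  have pl: "poly_lipschitz (\<lambda>p::real \<times> real. s * (l * fst p + k * snd p)\<^sup>2)" by (intro poly_lipschitz_intros)
  have sm: "(\<lambda>\<omega>. s * (Z \<omega>)\<^sup>2) \<in> H" if "Z \<in> H" for Z using that by (intro scale_mem square_mem)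
  have hom: "E (\<lambda>\<omega>. c\<^sup>2 * (s * (Z \<omega>)\<^sup>2)) = c\<^sup>2 * E (\<lambda>\<omega>. s * (Z \<omega>)\<^sup>2)" if "Z \<in> H" for Z c
    using sm[OF that] by (rule pos_homogeneous) simp
  have inner: "E (\<lambda>\<omega>. s * (l * x + k * Y \<omega>)\<^sup>2) = l\<^sup>2 * (s * x\<^sup>2) + k\<^sup>2 * E (\<lambda>\<omega>. s * (Y \<omega>)\<^sup>2)" for x
  proof -
    have "(\<lambda>\<omega>. s * (l * x + k * Y \<omega>)\<^sup>2)
        = (\<lambda>\<omega>. (k\<^sup>2 * (s * (Y \<omega>)\<^sup>2) + l\<^sup>2 * (s * x\<^sup>2)) + (2 * s * l * x * k) * Y \<omega>)"
      by (simp add: fun_eq_iff power2_eq_square algebra_simps)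
    then have "E (\<lambda>\<omega>. s * (l * x + k * Y \<omega>)\<^sup>2) = E (\<lambda>\<omega>. (k\<^sup>2 * (s * (Y \<omega>)\<^sup>2) + l\<^sup>2 * (s * x\<^sup>2)) + (2 * s * l * x * k) * Y \<omega>)"
      by (simp only:)
    also have "\<dots> = E (\<lambda>\<omega>. k\<^sup>2 * (s * (Y \<omega>)\<^sup>2) + l\<^sup>2 * (s * x\<^sup>2))"
      by (intro expectation_add_certain add_mem const_mem scale_mem square_mem XY Y0)
    also have "\<dots> = E (\<lambda>\<omega>. k\<^sup>2 * (s * (Y \<omega>)\<^sup>2)) + l\<^sup>2 * (s * x\<^sup>2)"
      by (intro expectation_add_const scale_mem square_mem XY)
    finally show ?thesis by (simp only: hom[OF XY(2)] add.commute)
  qed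
  have "E (\<lambda>\<omega>. s * (l * X \<omega> + k * Y \<omega>)\<^sup>2) = E (\<lambda>\<omega>. l\<^sup>2 * (s * (X \<omega>)\<^sup>2) + k\<^sup>2 * E (\<lambda>\<omega>. s * (Y \<omega>)\<^sup>2))"
    using indep_of_poly_lipschitz[OF ind XY pl] unfolding fst_conv snd_conv inner .
  also have "\<dots> = E (\<lambda>\<omega>. l\<^sup>2 * (s * (X \<omega>)\<^sup>2)) + k\<^sup>2 * E (\<lambda>\<omega>. s * (Y \<omega>)\<^sup>2)"
    by (intro expectation_add_const scale_mem square_mem XY)
  finally show ?thesis by (simp only: hom[OF XY(1)])
qed

end

context centered_semigroup
begin

text \<open>The hypothesis determines \<open>E (\<psi> X)\<close> only for \<open>\<psi>\<close> in the range of \<open>transition Y (sqrt T)\<close>. This range is dense.\<close>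

lemma ident_distr_scaled:
  assumes X: "X \<in> H" and T: "0 \<le> T" and b: "0 \<le> b" and var: "0 < upper_var E Y"
    and step: "\<And>\<psi>. \<psi> \<in> Cb_Lip \<Longrightarrow>
      transition X 1 (transition Y (sqrt T) \<psi>) 0 = transition Y (sqrt (b + T)) \<psi> 0"
  shows "ident_distr E X E (\<lambda>\<omega>. sqrt b * Y \<omega>)"
proof (rule ident_distr_of_dense[where R = "transition Y (sqrt T) ` Cb_Lip"])
  show "(\<lambda>\<omega>. sqrt b * Y \<omega>) \<in> H" by (intro scale_mem Y_mem)
  show "\<psi> \<in> Cb_Lip" if "\<psi> \<in> transition Y (sqrt T) ` Cb_Lip" for \<psi>
    using that Y_mem by auto
  show "E (\<lambda>\<omega>. \<psi> (X \<omega>)) = E (\<lambda>\<omega>. \<psi> (sqrt b * Y \<omega>))" if R: "\<psi> \<in> transition Y (sqrt T) ` Cb_Lip" for \<psi>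
  proof -
    from R obtain \<phi> where \<phi>: "\<phi> \<in> Cb_Lip" "\<psi> = transition Y (sqrt T) \<phi>" by blast
    have "transition X 1 \<psi> 0 = transition Y (sqrt b) \<psi> 0"
      unfolding \<phi>(2) step[OF \<phi>(1)] using semigroup[OF \<phi>(1) b T] by simp
    then show ?thesis by (simp add: transition_def)
  qed
  show "\<exists>\<psi>\<in>transition Y (sqrt T) ` Cb_Lip. \<forall>x. \<bar>\<psi> x - F x\<bar> \<le> e" if "F \<in> wave_sums" "0 < e" for F e
    using that transition_dense_waves[OF var T that(2)] by (auto simp: wave_sums_def)
qed (rule X)

text \<open>In law, \<open>X\<close> is \<open>Y\<close> with time multiplied by b, so the semigroup
  law carries over.\<close>

lemma G_normal_of_ident_distr:
  assumes X: "X \<in> H" and b: "0 \<le> b" and id: "ident_distr E X E (\<lambda>\<omega>. sqrt b * Y \<omega>)"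
  shows "G_normal H E X"
proof (rule G_normalI[OF X])
  have tr: "transition X (sqrt t) \<phi> = transition Y (sqrt (t * b)) \<phi>" if "\<phi> \<in> Cb_Lip" for t \<phi>
  proof
    show "transition X (sqrt t) \<phi> x = transition Y (sqrt (t * b)) \<phi> x" for x
      using transition_ident_distr[OF id that, of "sqrt t" x]
      by (simp add: transition_def real_sqrt_mult mult.assoc)
  qed
  show "transition X (sqrt s) (transition X (sqrt t) \<phi>) 0 = transition X (sqrt (s + t)) \<phi> 0"
    if "\<phi> \<in> Cb_Lip" "0 \<le> s" "0 \<le> t" for \<phi> s t
    using semigroup[OF that(1), of "s * b" "t * b" 0] that b
    by (simp add: tr transition_Cb_Lip Y_mem distrib_right)
qed

end

theorem theorem3p2:
  fixes H :: "('a \<Rightarrow> real) set" and E :: "('a \<Rightarrow> real) \<Rightarrow> real"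
    and X Y :: "'a \<Rightarrow> real" and I :: "real set" and f :: "real \<Rightarrow> real"
  assumes "sublinear_expectation_space H E"
    and "X \<in> H" and "Y \<in> H"
    and "nondegenerate E X" and "nondegenerate E Y"
    and "is_interval I" and "0 \<in> interior I"
    and "\<And>l. l \<in> I \<Longrightarrow> 0 \<le> f l"
    and "indep_of E Y X"
    and "\<And>l. l \<in> I \<Longrightarrow> 0 \<le> f l \<Longrightarrow> nondegenerate E (\<lambda>\<omega>. l * X \<omega> + f l * Y \<omega>)"
    and "\<And>l\<^sub>1 l\<^sub>2. l\<^sub>1 \<in> I \<Longrightarrow> 0 \<le> f l\<^sub>1 \<Longrightarrow> l\<^sub>2 \<in> I \<Longrightarrow> 0 \<le> f l\<^sub>2 \<Longrightarrow>
           ident_distr E (\<lambda>\<omega>. l\<^sub>1 * X \<omega> + f l\<^sub>1 * Y \<omega>) E (\<lambda>\<omega>. l\<^sub>2 * X \<omega> + f l\<^sub>2 * Y \<omega>)"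
  shows "\<exists>a b. a > 0 \<and> b > 0 \<and>
           (\<forall>l\<in>I. f l = sqrt (a - b * l\<^sup>2)) \<and>
           G_normal H E X \<and> G_normal H E Y \<and>
           upper_var E X = b * upper_var E Y \<and>
           lower_var E X = b * lower_var E Y"
proof -
  interpret sublinear_expectation_space H E by fact
  note X = \<open>X \<in> H\<close> and Y = \<open>Y \<in> H\<close> and ind = \<open>indep_of E Y X\<close>
  note f_nonneg = assms(8)
  obtain e where e: "0 < e" "cball 0 e \<subseteq> I"
    using \<open>0 \<in> interior I\<close> by (auto simp: mem_interior_cball)
  have I: "l \<in> I" if "\<bar>l\<bar> \<le> e" for l using that e(2) by (auto simp: dist_real_def)
  have I0: "0 \<in> I" using I[of 0] e by simp
  \<comment> \<open>At l = 0 the combination is f(0) Y, which is degenerate if f(0) = 0.\<close>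
  have f0: "0 < f 0"
  proof (rule ccontr)
    assume "\<not> 0 < f 0"
    then have "f 0 = 0" using f_nonneg[OF I0] by simp
    then show False using assms(10)[OF I0 f_nonneg[OF I0]] const[of 0] by (simp add: nondegenerate_def)
  qed
  have id: "ident_distr E (\<lambda>\<omega>. l * X \<omega> + f l * Y \<omega>) E (\<lambda>\<omega>. f 0 * Y \<omega>)" if "l \<in> I" for l
    using assms(11)[OF that f_nonneg[OF that] I0 f_nonneg[OF I0]] by simp
  have Y0: "E Y = 0"
    by (rule mean_zero_of_ident_distr[where f = f, OF X Y ind assms(4,5) e(1) f0])
       (intro f_nonneg id I; simp)+
  have Y0': "E (\<lambda>\<omega>. - Y \<omega>) = 0"
  proof (rule mean_zero_of_ident_distr[where f = f, OF minus_mem[OF X] minus_mem[OF Y] indep_of_minus[OF ind] _ _ e(1) f0])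
    show "nondegenerate E (\<lambda>\<omega>. - X \<omega>)" "nondegenerate E (\<lambda>\<omega>. - Y \<omega>)"
      using assms(4,5) by (simp_all add: nondegenerate_def)
    show "ident_distr E (\<lambda>\<omega>. l * - X \<omega> + f l * - Y \<omega>) E (\<lambda>\<omega>. f 0 * - Y \<omega>)" if "0 \<le> l" "l \<le> e" for l
      using ident_distr_minus[OF id[OF I[of l]]] that by (simp add: algebra_simps)
  qed (intro f_nonneg I; simp)
  define a where "a = (f 0)\<^sup>2"
  define b where "b = upper_var E X / upper_var E Y"
  have pos: "0 < upper_var E X" "0 < upper_var E Y"
    using nondegenerate_second_moment_pos assms(4,5) by (auto simp: upper_var_def)
  have a: "0 < a" and b: "0 < b" using f0 pos by (auto simp: a_def b_def)
  have second: "l\<^sup>2 * E (\<lambda>\<omega>. s * (X \<omega>)\<^sup>2) + (f l)\<^sup>2 * E (\<lambda>\<omega>. s * (Y \<omega>)\<^sup>2) = a * E (\<lambda>\<omega>. s * (Y \<omega>)\<^sup>2)"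
    if "l \<in> I" for l s
  proof -
    have Z: "(\<lambda>\<omega>. l * X \<omega> + f l * Y \<omega>) \<in> H" "(\<lambda>\<omega>. f 0 * Y \<omega>) \<in> H" by (intro add_mem scale_mem X Y)+
    have "poly_lipschitz (\<lambda>z::real. s * z\<^sup>2)"
      by (intro poly_lipschitz_mult poly_lipschitz_const poly_lipschitz_power poly_lipschitz_id)
    from ident_distr_poly_lipschitz[OF id[OF that] Z this]
    have "E (\<lambda>\<omega>. s * (l * X \<omega> + f l * Y \<omega>)\<^sup>2) = E (\<lambda>\<omega>. s * (0 * X \<omega> + f 0 * Y \<omega>)\<^sup>2)" by simp
    then show ?thesis unfolding second_moment_linear_indep[OF ind X Y Y0 Y0'] by (simp add: a_def)
  qed
  have f2: "(f l)\<^sup>2 = a - b * l\<^sup>2" if "l \<in> I" for l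
  proof -
    have "l\<^sup>2 * upper_var E X + (f l)\<^sup>2 * upper_var E Y = a * upper_var E Y"
      using second[OF that, of 1] by (simp add: upper_var_def)
    moreover have "upper_var E X = b * upper_var E Y" using pos by (simp add: b_def)
    ultimately have "upper_var E Y * (f l)\<^sup>2 = upper_var E Y * (a - b * l\<^sup>2)" by (simp add: algebra_simps)
    then show ?thesis using pos by simp
  qed
  have lower: "lower_var E X = b * lower_var E Y"
  proof -
    have "e\<^sup>2 * lower_var E X + (f e)\<^sup>2 * lower_var E Y = a * lower_var E Y"
      using second[OF I[of e], of "- 1"] e by (simp add: lower_var_def)
    then have "e\<^sup>2 * lower_var E X = e\<^sup>2 * (b * lower_var E Y)"
      using f2[OF I[of e]] e by (simp add: algebra_simps)
    then show ?thesis using e by simp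
  qed
  have step: "transition X r (transition Y (sqrt t) \<phi>) x = transition Y (sqrt (t + b * r\<^sup>2)) \<phi> x"
    if \<phi>: "\<phi> \<in> Cb_Lip" and t: "0 < t" and r: "0 \<le> r" "r\<^sup>2 \<le> e\<^sup>2 / a * t" for \<phi> t r x
  proof -
    \<comment> \<open>The scale at which the combination for l = r / s becomes r X + sqrt t Y and
      the one for l = 0 becomes sqrt(t + b r^2) Y. The condition on r^2 puts l within distance e of
      0.\<close>
    define s where "s = sqrt (t + b * r\<^sup>2) / f 0"
    have tb: "0 < t + b * r\<^sup>2" using t b by (intro add_pos_nonneg) auto
    then have s: "0 < s" using f0 by (simp add: s_def)
    have "s\<^sup>2 = (t + b * r\<^sup>2) / a"
      unfolding s_def a_def power_divide real_sqrt_pow2[OF less_imp_le[OF tb]] ..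
    with a have s2: "s\<^sup>2 * a = t + b * r\<^sup>2" by (metis less_irrefl nonzero_eq_divide_eq)
    define l where "l = r / s"
    have l: "0 \<le> l" "s * l = r" unfolding l_def using r(1) s by simp_all
    have "\<bar>l\<bar> \<le> e"
    proof -
      have "r\<^sup>2 \<le> e\<^sup>2 * t / a" using r(2) by (simp only: times_divide_eq_left)
      then have "r\<^sup>2 * a \<le> e\<^sup>2 * t" using a by (simp only: pos_le_divide_eq)
      also have "\<dots> \<le> e\<^sup>2 * (t + b * r\<^sup>2)" using b by (intro mult_left_mono) auto
      also have "\<dots> = (e * s)\<^sup>2 * a" by (simp only: s2[symmetric] power_mult_distrib mult.assoc)
      finally have "r\<^sup>2 \<le> (e * s)\<^sup>2" using a by (rule mult_right_le_imp_le)
      moreover have "0 \<le> e * s" using e(1) s by simp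
      ultimately have "r \<le> e * s" by (rule power2_le_imp_le)
      then have "l \<le> e" unfolding l_def using s by (simp only: pos_divide_le_eq)
      with l(1) show ?thesis by simp
    qed
    then have lI: "l \<in> I" by (rule I)
    have "(s * f l)\<^sup>2 = s\<^sup>2 * a - b * (s * l)\<^sup>2"
      unfolding power_mult_distrib f2[OF lI] by (simp add: algebra_simps)
    then have "(s * f l)\<^sup>2 = t" unfolding s2 l(2) by simp
    from real_sqrt_unique[OF this] have sf: "s * f l = sqrt t" using s f_nonneg[OF lI] by simp
    have "transition X r (transition Y (sqrt t) \<phi>) x = E (\<lambda>\<omega>. \<phi> (x + (r * X \<omega> + sqrt t * Y \<omega>)))"
      by (rule transition_indep[OF ind \<phi>])
    also have "\<dots> = transition (\<lambda>\<omega>. l * X \<omega> + f l * Y \<omega>) s \<phi> x"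
    proof -
      have "s * (l * u + f l * v) = r * u + sqrt t * v" for u v
        by (simp only: distrib_left mult.assoc[symmetric] l(2) sf)
      then show ?thesis by (simp only: transition_def)
    qed
    also have "\<dots> = transition (\<lambda>\<omega>. f 0 * Y \<omega>) s \<phi> x"
      by (rule transition_ident_distr[OF id[OF lI] \<phi>])
    also have "\<dots> = transition Y (s * f 0) \<phi> x" by (simp add: transition_def mult.assoc)
    also have "s * f 0 = sqrt (t + b * r\<^sup>2)" using f0 by (simp add: s_def)
    finally show ?thesis .
  qed
  interpret centered_semigroup H E Y
  proof
    show "transition Y (sqrt s) (transition Y (sqrt t) \<phi>) x = transition Y (sqrt (s + t)) \<phi> x"
      if "\<phi> \<in> Cb_Lip" "0 \<le> s" "0 \<le> t" for \<phi> s t x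
    proof (rule transition_semigroup[OF X Y b _ step that])
      show "0 < e\<^sup>2 / a" using a e(1) by simp
    qed
  qed (rule Y Y0 Y0')+
  have "ident_distr E X E (\<lambda>\<omega>. sqrt b * Y \<omega>)"
  proof (rule ident_distr_scaled[OF X _ _ pos(2)])
    \<comment> \<open>a / e^2 is the least time from which \<open>step\<close> permits a step of
      \<open>X\<close> with r = 1.\<close>
    show "transition X 1 (transition Y (sqrt (a / e\<^sup>2)) \<psi>) 0 = transition Y (sqrt (b + a / e\<^sup>2)) \<psi> 0"
      if "\<psi> \<in> Cb_Lip" for \<psi>
      using step[OF that, of "a / e\<^sup>2" 1 0] a e by (simp add: add.commute)
  qed (use a b in auto)
  then have "G_normal H E X" by (rule G_normal_of_ident_distr[OF X less_imp_le[OF b]])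
  moreover have "G_normal H E Y" by (rule G_normalI[OF Y semigroup])
  moreover have "f l = sqrt (a - b * l\<^sup>2)" if "l \<in> I" for l
    using real_sqrt_unique[OF f2[OF that] f_nonneg[OF that]] by (rule sym)
  moreover have "upper_var E X = b * upper_var E Y" using pos by (simp add: b_def)
  ultimately show ?thesis using a b lower by blast
qed

end
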